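(* Let $1\le q<p<\infty$ and, for each $n\in\mathbb N$, let $\mathscr Z^{(n)}$ be a random vector uniformly distributed on $\mathbb B_p^n$ (distribution $\mathbf U_{n,p}$). Let $z>m_{p,q}$ be such that $z^*=(z^q,1)\in\mathcal J_p$. Then $$\mathbb P\left(n^{1/p-1/q}\|\mathscr Z^{(n)}\|_q>z\right)=\frac{1}{\sqrt{2\pi n}\,\gamma(z)}\,e^{-n\Lambda_p^*(z^* )}\,(1+o(1))\qquad(n\to\infty),$$ where $o(1)$ denotes a sequence tending to $0$ as $n\to\infty$ and $\gamma(z)>0$ is given by $$\gamma(z)^2=\det\mathfrak H_{z^*}\,\tau(z^* )_1^2\,\big(qz^q\tau(z^* )_1+1\big)^2\Big[\tfrac{z^{2q}q^2}{p^2}(\mathfrak H_{z^*}^{-1})_{11}+\tfrac{2z^qq}{p}(\mathfrak H_{z^*}^{-1})_{12}+(\mathfrak H_{z^*}^{-1})_{22}+\tau(z^* )_1\tfrac{z^qq(q-p)}{p^2}\Big].$$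
   Context: For $x\in\mathbb R^n$, $\|x\|_r=(\sum_i|x_i|^r)^{1/r}$ for $1\le r<\infty$; $\mathbb B_p^n=\{x:\|x\|_p\le1\}$ and $\mathbf U_{n,p}(\cdot)=\mathrm{vol}_n(\cdot)/\mathrm{vol}_n(\mathbb B_p^n)$. Let $f_p(x)=\frac{1}{2p^{1/p}\Gamma(1+1/p)}e^{-|x|^p/p}$, $M_p(r)=\int_{\mathbb R}|x|^rf_p(x)\,dx$, $m_{p,q}=M_p(q)^{1/q}$. For $\tau\in\mathbb R^2$, $\Lambda_p(\tau)=\log\int_{\mathbb R}e^{\tau_1|y|^q+\tau_2|y|^p}f_p(y)\,dy$, finite exactly on $\mathcal D_p=\mathbb R\times(-\infty,1/p)$; $\Lambda_p^*(x)=\sup_{\tau\in\mathbb R^2}(\langle x,\tau\rangle-\Lambda_p(\tau))$. $\mathcal J_p$ is the set of $x\in\mathbb R^2$ for which there exists $\tau(x)\in\mathcal D_p$ with $\nabla_\tau\Lambda_p(\tau(x))=x$ (such $\tau(x)$ is unique). For $x\in\mathcal J_p$, $\mathfrak H_x$ is the Hessian of $\Lambda_p$ at $\tau(x)$ (positive definite). For $z>0$, $z^*:=(z^q,1)$. *)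

theory Defs
  imports "HOL-Analysis.Analysis"
begin

text \<open>Points of R^n are represented as extensional functions on the index set {..<n}.\<close>

definition lebn :: "nat \<Rightarrow> (nat \<Rightarrow> real) measure" where
  "lebn n = PiM {..<n} (\<lambda>_. lborel)"

definition lnorm :: "nat \<Rightarrow> real \<Rightarrow> (nat \<Rightarrow> real) \<Rightarrow> real" where
  "lnorm n r x = (\<Sum>i<n. \<bar>x i\<bar> powr r) powr (1 / r)"

definition Ball_p :: "nat \<Rightarrow> real \<Rightarrow> (nat \<Rightarrow> real) set" where
  "Ball_p n p = {x \<in> space (lebn n). lnorm n p x \<le> 1}"

definition U_np :: "nat \<Rightarrow> real \<Rightarrow> (nat \<Rightarrow> real) set \<Rightarrow> real" where
  "U_np n p A = measure (lebn n) A / measure (lebn n) (Ball_p n p)"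

definition f_p :: "real \<Rightarrow> real \<Rightarrow> real" where
  "f_p p x = exp (- (\<bar>x\<bar> powr p) / p) / (2 * p powr (1 / p) * Gamma (1 + 1 / p))"

definition M_p :: "real \<Rightarrow> real \<Rightarrow> real" where
  "M_p p r = (LINT x|lborel. \<bar>x\<bar> powr r * f_p p x)"

definition m_pq :: "real \<Rightarrow> real \<Rightarrow> real" where
  "m_pq p q = M_p p q powr (1 / q)"

definition Lambda_p :: "real \<Rightarrow> real \<Rightarrow> real \<times> real \<Rightarrow> real" where
  "Lambda_p p q \<tau> = ln (LINT y|lborel. exp (fst \<tau> * \<bar>y\<bar> powr q + snd \<tau> * \<bar>y\<bar> powr p) * f_p p y)"

definition D_p :: "real \<Rightarrow> (real \<times> real) set" where
  "D_p p = {\<tau>. snd \<tau> < 1 / p}"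

text \<open>Legendre transform; Lambda_p = +infinity outside D_p, so the sup can be taken over D_p.\<close>
definition Lambda_star :: "real \<Rightarrow> real \<Rightarrow> real \<times> real \<Rightarrow> real" where
  "Lambda_star p q x = (SUP \<tau>\<in>D_p p. fst x * fst \<tau> + snd x * snd \<tau> - Lambda_p p q \<tau>)"

definition d1 :: "(real \<times> real \<Rightarrow> real) \<Rightarrow> real \<times> real \<Rightarrow> real" where
  "d1 F \<tau> = deriv (\<lambda>s. F (s, snd \<tau>)) (fst \<tau>)"

definition d2 :: "(real \<times> real \<Rightarrow> real) \<Rightarrow> real \<times> real \<Rightarrow> real" where
  "d2 F \<tau> = deriv (\<lambda>s. F (fst \<tau>, s)) (snd \<tau>)"

definition grad_Lambda :: "real \<Rightarrow> real \<Rightarrow> real \<times> real \<Rightarrow> real \<times> real" where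
  "grad_Lambda p q \<tau> = (d1 (Lambda_p p q) \<tau>, d2 (Lambda_p p q) \<tau>)"

definition J_p :: "real \<Rightarrow> real \<Rightarrow> (real \<times> real) set" where
  "J_p p q = {x. \<exists>\<tau>\<in>D_p p. Lambda_p p q differentiable (at \<tau>) \<and> grad_Lambda p q \<tau> = x}"

definition tau_of :: "real \<Rightarrow> real \<Rightarrow> real \<times> real \<Rightarrow> real \<times> real" where
  "tau_of p q x = (THE \<tau>. \<tau> \<in> D_p p \<and> Lambda_p p q differentiable (at \<tau>) \<and> grad_Lambda p q \<tau> = x)"

definition H11 :: "real \<Rightarrow> real \<Rightarrow> real \<times> real \<Rightarrow> real" where
  "H11 p q x = d1 (d1 (Lambda_p p q)) (tau_of p q x)"
definition H12 :: "real \<Rightarrow> real \<Rightarrow> real \<times> real \<Rightarrow> real" where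
  "H12 p q x = d2 (d1 (Lambda_p p q)) (tau_of p q x)"
definition H22 :: "real \<Rightarrow> real \<Rightarrow> real \<times> real \<Rightarrow> real" where
  "H22 p q x = d2 (d2 (Lambda_p p q)) (tau_of p q x)"

definition detH :: "real \<Rightarrow> real \<Rightarrow> real \<times> real \<Rightarrow> real" where
  "detH p q x = H11 p q x * H22 p q x - H12 p q x ^ 2"

definition Hinv11 :: "real \<Rightarrow> real \<Rightarrow> real \<times> real \<Rightarrow> real" where
  "Hinv11 p q x = H22 p q x / detH p q x"
definition Hinv12 :: "real \<Rightarrow> real \<Rightarrow> real \<times> real \<Rightarrow> real" where
  "Hinv12 p q x = - H12 p q x / detH p q x"
definition Hinv22 :: "real \<Rightarrow> real \<Rightarrow> real \<times> real \<Rightarrow> real" where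
  "Hinv22 p q x = H11 p q x / detH p q x"

definition zstar :: "real \<Rightarrow> real \<Rightarrow> real \<times> real" where
  "zstar q z = (z powr q, 1)"

definition gamma_sq :: "real \<Rightarrow> real \<Rightarrow> real \<Rightarrow> real" where
  "gamma_sq p q z = (let x = zstar q z; t1 = fst (tau_of p q x) in
     detH p q x * t1 ^ 2 * (q * z powr q * t1 + 1) ^ 2 *
     ((z powr (2 * q) * q ^ 2 / p ^ 2) * Hinv11 p q x + (2 * z powr q * q / p) * Hinv12 p q x
      + Hinv22 p q x + t1 * (z powr q * q * (q - p) / p ^ 2)))"

definition gamma_z :: "real \<Rightarrow> real \<Rightarrow> real \<Rightarrow> real" where
  "gamma_z p q z = sqrt (gamma_sq p q z)"

end

theory Submission
  imports Defs "HOL-Probability.Probability"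
begin

text \<open>Rescaling by \<open>n powr (1 / p)\<close> turns the probability into the quotient of the Lebesgue volumes of
  \<open>{S_p \<le> n, S_q > n z^q}\<close> and \<open>{S_p \<le> n}\<close>, where \<open>S_r x = \<Sum> i < n. |x i|^r\<close>. The denominator is explicit:
  integrating \<open>exp (- S_p / p)\<close> over its sublevel sets gives a Gamma function, to which Stirling's formula
  applies. For the numerator, let \<open>\<tau>\<close> be dual to \<open>(z^q, 1)\<close> and \<open>b = 1 / p - \<tau>_2\<close>. With respect to the product
  of the tilted densities, proportional to \<open>exp (\<tau>_1 |y|^q - b |y|^p)\<close>, the volume becomes
  \<open>exp (- n \<Lambda>*)\<close> times known factors times the expectation of \<open>exp (- \<tau>_1 X - b W)\<close> over the quadrant
  \<open>X > 0, W \<ge> 0\<close>, where \<open>X = S_q - n z^q\<close> and \<open>W = n - S_p\<close> are centered sums of n i.i.d. terms. A planar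
  local limit theorem (smoothing with Fejer kernels, in the style of Stone) shows that this expectation is
  asymptotic to \<open>1 / (2 \<pi> n sqrt (det H) \<tau>_1 b)\<close>. Integration by parts against the tilted density gives
  \<open>p b = 1 + q z^q \<tau>_1\<close> and linear relations between the entries of the Hessian; together they reduce the
  bracket in \<open>\<gamma>(z)^2\<close> to \<open>1 / p\<close>.\<close>

section \<open>The Fejer kernel\<close>

text \<open>A single step of the walk is a function of one real variable y, so the law of (X, W)
  lives on the curve (|y|^q, |y|^p) and has no planar density; decay of its characteristic function
  at infinity is not at hand. The Fejer kernel avoids this question: its Fourier transform
  \<open>tent\<close> has compact support, so after smoothing only the characteristic function on a
  square matters, and there modulus below 1 off the origin plus compactness suffice. The price is
  that the kernel itself has unbounded support. Its mass outside a small square is controlled by a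
  bound of order 1 / n for the exponential quadrant expectation that is uniform over all shifts of
  the quadrant; this bound comes from the upper half of the same smoothing inequality. The weight
  must be integrable over the quadrant: z > m_pq gives \<tau>_1 > 0, and \<tau> in
  \<open>D_p\<close> gives b > 0. The quadrant is half open, so it is squeezed between the open and
  the closed one.\<close>

definition tent :: "real \<Rightarrow> real" where
  "tent s = max 0 (1 - \<bar>s\<bar>)"

definition fejer :: "real \<Rightarrow> real" where
  "fejer x = (sinc (x / 2))\<^sup>2"

lemma tent_nonneg [simp]: "0 \<le> tent s"
  and tent_le_1: "tent s \<le> 1"
  by (auto simp: tent_def)

lemma tent_eq_0: "1 \<le> \<bar>s\<bar> \<Longrightarrow> tent s = 0"
  by (simp add: tent_def)

lemma tent_measurable [measurable]: "tent \<in> borel_measurable borel"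
  unfolding tent_def by measurable

lemma fejer_nonneg [simp]: "0 \<le> fejer x"
  by (simp add: fejer_def)

lemma fejer_minus [simp]: "fejer (- x) = fejer x"
  by (simp add: fejer_def)

lemma fejer_measurable [measurable]: "fejer \<in> borel_measurable borel"
  unfolding fejer_def by (rule borel_measurable_power, rule measurable_compose[OF _ borel_measurable_sinc]) simp

lemma isCont_fejer: "isCont fejer x"
  unfolding fejer_def by (intro continuous_intros continuous_within_compose3[OF isCont_sinc]) simp_all

lemma fejer_altdef: "x \<noteq> 0 \<Longrightarrow> fejer x = 2 * (1 - cos x) / x\<^sup>2"
  using cos_double_sin[of "x / 2"] by (simp add: fejer_def power2_eq_square field_simps)

lemma has_bochner_integral_tent_iexp:
  "has_bochner_integral lborel (\<lambda>s. complex_of_real (tent s) * iexp (s * x)) (complex_of_real (fejer x))"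
proof -
  \<comment> \<open>The corner of \<open>tent\<close> at 0 splits the integral into two pieces with
    smooth antiderivatives; the shared endpoint is negligible.\<close>
  have *: "has_bochner_integral lborel (\<lambda>s. complex_of_real (tent s) * iexp (s * x)) (F 1 - F 0 + (G 0 - G (-1)))"
    if F: "\<And>s. (F has_vector_derivative (complex_of_real (1 - s) * iexp (s * x))) (at s)"
    and G: "\<And>s. (G has_vector_derivative (complex_of_real (1 + s) * iexp (s * x))) (at s)" for F G
  proof -
    have "has_bochner_integral lborel (\<lambda>s. indicator {0..1} s *\<^sub>R (complex_of_real (1 - s) * iexp (s * x))) (F 1 - F 0)"
      by (rule has_bochner_integral_FTC_Icc)
         (use has_vector_derivative_at_within[OF F] in \<open>auto intro!: continuous_intros\<close>)
    moreover have "has_bochner_integral lborel (\<lambda>s. indicator {-1..0} s *\<^sub>R (complex_of_real (1 + s) * iexp (s * x))) (G 0 - G (-1))"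
      by (rule has_bochner_integral_FTC_Icc)
         (use has_vector_derivative_at_within[OF G] in \<open>auto intro!: continuous_intros\<close>)
    ultimately have "has_bochner_integral lborel (\<lambda>s. indicator {0..1} s *\<^sub>R (complex_of_real (1 - s) * iexp (s * x))
        + indicator {-1..0} s *\<^sub>R (complex_of_real (1 + s) * iexp (s * x))) (F 1 - F 0 + (G 0 - G (-1)))"
      by (rule has_bochner_integral_add)
    then show ?thesis
      by (rule has_bochner_integral_cong_AE[THEN iffD1, rotated -1])
         (use AE_lborel_singleton[of "0::real"] in \<open>auto simp: tent_def indicator_def max_def elim!: eventually_mono\<close>)
  qed
  show ?thesis
  proof (cases "x = 0")
    case True
    have "has_bochner_integral lborel (\<lambda>s. complex_of_real (tent s) * iexp (s * x))
      ((\<lambda>s. complex_of_real (s - s\<^sup>2 / 2)) 1 - (\<lambda>s. complex_of_real (s - s\<^sup>2 / 2)) 0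
      + ((\<lambda>s. complex_of_real (s + s\<^sup>2 / 2)) 0 - (\<lambda>s. complex_of_real (s + s\<^sup>2 / 2)) (-1)))"
      by (rule *) (auto simp: True has_vector_derivative_complex_iff intro!: derivative_eq_intros)
    then show ?thesis by (simp add: True fejer_def)
  next
    case False
    \<comment> \<open>Antiderivatives found by one integration by parts; they divide by x, so x = 0
      is treated apart.\<close>
    define F where "F s = (complex_of_real (1 - s) / (\<i> * x) + 1 / (\<i> * x)^2) * iexp (s * x)" for s :: real
    define G where "G s = (complex_of_real (1 + s) / (\<i> * x) - 1 / (\<i> * x)^2) * iexp (s * x)" for s :: real
    have "has_bochner_integral lborel (\<lambda>s. complex_of_real (tent s) * iexp (s * x)) (F 1 - F 0 + (G 0 - G (-1)))"
    proof (rule *)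
      have e: "((\<lambda>s. iexp (s * x)) has_vector_derivative (\<i> * x) * iexp (s * x)) (at s)" for s
        by (auto intro!: derivative_eq_intros simp: Re_exp Im_exp has_vector_derivative_complex_iff)
      fix s
      show "(F has_vector_derivative (complex_of_real (1 - s) * iexp (s * x))) (at s)"
        unfolding F_def
        by (rule has_vector_derivative_eq_rhs, rule has_vector_derivative_mult[OF _ e])
           (use False in \<open>auto intro!: derivative_eq_intros has_vector_derivative_of_real simp: field_simps power2_eq_square\<close>)
      show "(G has_vector_derivative (complex_of_real (1 + s) * iexp (s * x))) (at s)"
        unfolding G_def
        by (rule has_vector_derivative_eq_rhs, rule has_vector_derivative_mult[OF _ e])
           (use False in \<open>auto intro!: derivative_eq_intros has_vector_derivative_of_real simp: field_simps power2_eq_square\<close>)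
    qed
    moreover have "F 1 - F 0 + (G 0 - G (-1)) = complex_of_real (fejer x)"
      using False by (simp add: F_def G_def fejer_altdef complex_eq_iff Re_exp Im_exp Re_divide Im_divide power2_eq_square field_simps)
    ultimately show ?thesis by simp
  qed
qed

text \<open>Integrating 2 (1 - cos x) / x^2 by parts gives an antiderivative containing the sine
  integral. Since \<open>Si\<close> tends to pi / 2 at infinity, each half-line contributes
  pi.\<close>

lemma nn_integral_fejer: "(\<integral>\<^sup>+x. ennreal (fejer x) \<partial>lborel) = ennreal (2 * pi)"
proof -
  define F where "F x = 2 * Si x - 2 * (1 - cos x) / x" for x :: real
  have D: "(F has_real_derivative fejer x) (at x)" if "x > 0" for x
    unfolding F_def using that
    by (auto intro!: derivative_eq_intros DERIV_Si simp: fejer_altdef field_simps power2_eq_square)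
  have lim0: "(F \<longlongrightarrow> 0) (at_right 0)"
  proof -
    have "((\<lambda>x. (1 - cos x) / x) \<longlongrightarrow> (0::real)) (at_right 0)"
      by real_asymp
    moreover have "(Si \<longlongrightarrow> Si 0) (at_right 0)"
      using isCont_Si[of 0] unfolding isCont_def by (rule tendsto_mono[rotated]) (simp add: at_le)
    ultimately have "((\<lambda>x. 2 * Si x - 2 * ((1 - cos x) / x)) \<longlongrightarrow> 2 * Si 0 - 2 * 0) (at_right 0)"
      by (intro tendsto_intros)
    then show ?thesis by (simp add: F_def[abs_def] Si_def zero_ereal_def[symmetric])
  qed
  have limi: "(F \<longlongrightarrow> pi) at_top"
  proof -
    have "((\<lambda>x. (1 - cos x) / x) \<longlongrightarrow> (0::real)) at_top" by real_asymp
    then have "((\<lambda>x. 2 * Si x - 2 * ((1 - cos x) / x)) \<longlongrightarrow> 2 * (pi / 2) - 2 * 0) at_top"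
      by (intro tendsto_intros Si_at_top)
    then show ?thesis by (simp add: F_def[abs_def])
  qed
  have l0: "((F \<circ> real_of_ereal) \<longlongrightarrow> 0) (at_right 0)"
    using lim0 by (simp add: zero_ereal_def ereal_tendsto_simps)
  have li: "((F \<circ> real_of_ereal) \<longlongrightarrow> pi) (at_left \<infinity>)"
    using limi by (simp add: ereal_tendsto_simps)
  have FTC: "set_integrable lborel (einterval 0 \<infinity>) fejer" "(LBINT x=0..\<infinity>. fejer x) = pi - 0"
    by (rule interval_integral_FTC_nonneg[OF _ _ _ _ l0 li]; use D in \<open>auto simp: isCont_fejer\<close>)+
  have E: "einterval 0 \<infinity> = {0<..}" by (auto simp: einterval_def)
  have pos: "(\<integral>\<^sup>+x. ennreal (fejer x) * indicator {0<..} x \<partial>lborel) = ennreal pi"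
  proof -
    have "(\<integral>\<^sup>+x. ennreal (fejer x) * indicator {0<..} x \<partial>lborel) = (\<integral>\<^sup>+x. ennreal (indicator {0<..} x *\<^sub>R fejer x) \<partial>lborel)"
      by (intro nn_integral_cong) (auto split: split_indicator)
    also have "\<dots> = ennreal (\<integral>x. indicator {0<..} x *\<^sub>R fejer x \<partial>lborel)"
      using FTC(1) unfolding set_integrable_def E by (intro nn_integral_eq_integral) auto
    also have "(\<integral>x. indicator {0<..} x *\<^sub>R fejer x \<partial>lborel) = pi"
      using FTC(2) by (simp add: interval_lebesgue_integral_0_infty set_lebesgue_integral_def)
    finally show ?thesis .
  qed
  have neg: "(\<integral>\<^sup>+x. ennreal (fejer x) * indicator {..<0} x \<partial>lborel) = ennreal pi"
    by (subst nn_integral_real_affine[where c="-1" and t=0])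
       (auto simp: pos[symmetric] intro!: nn_integral_cong split: split_indicator)
  have "(\<integral>\<^sup>+x. ennreal (fejer x) \<partial>lborel) =
      (\<integral>\<^sup>+x. ennreal (fejer x) * indicator {0<..} x + ennreal (fejer x) * indicator {..<0} x \<partial>lborel)"
    using AE_lborel_singleton[of "0::real"]
    by (intro nn_integral_cong_AE) (auto split: split_indicator elim!: eventually_mono)
  also have "\<dots> = ennreal pi + ennreal pi"
    by (subst nn_integral_add) (auto simp: pos neg)
  also have "\<dots> = ennreal (2 * pi)" by (simp add: ennreal_plus[symmetric] del: ennreal_plus)
  finally show ?thesis .
qed

section \<open>Smoothing exponential tails\<close>

definition exp_tail :: "real \<Rightarrow> real \<Rightarrow> real" where
  "exp_tail a y = exp (- a * y) * indicator {0..} y"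

lemma exp_tail_nonneg [simp]: "0 \<le> exp_tail a y"
  by (simp add: exp_tail_def)

lemma exp_tail_measurable [measurable]: "exp_tail a \<in> borel_measurable borel"
  unfolding exp_tail_def by measurable

lemma exp_tail_le_1: "0 < a \<Longrightarrow> exp_tail a y \<le> 1"
  by (auto simp: exp_tail_def indicator_def)

lemma nn_integral_exp_tail: "0 < a \<Longrightarrow> (\<integral>\<^sup>+y. ennreal (exp_tail a y) \<partial>lborel) = ennreal (1 / a)"
proof -
  assume a: "0 < a"
  have "(\<integral>\<^sup>+y. ennreal (exp (- a * y)) * indicator {0..} y \<partial>lborel) = ennreal (0 - (- exp (- a * 0) / a))"
    by (rule nn_integral_FTC_atLeast[where F="\<lambda>y. - exp (- a * y) / a"])
       (use a in \<open>auto intro!: derivative_eq_intros simp: field_simps, real_asymp\<close>)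
  moreover have "(\<integral>\<^sup>+y. ennreal (exp (- a * y)) * indicator {0..} y \<partial>lborel) = (\<integral>\<^sup>+y. ennreal (exp_tail a y) \<partial>lborel)"
    by (intro nn_integral_cong) (auto simp: exp_tail_def split: split_indicator)
  ultimately show ?thesis by simp
qed

text \<open>In both inequalities the argument moves by an amount strictly between 0 and 2 e, which
  costs at most the factor exp (2 a e). Moving up keeps a nonnegative argument nonnegative; if the
  argument moved down is still nonnegative, then u was positive, so the closed tail is bounded by an
  open one.\<close>

lemma exp_tail_shift_le:
  assumes "0 < a" "\<bar>w\<bar> < e"
  shows "exp_tail a u \<le> exp (2 * a * e) * exp_tail a (u + e - w)"
    and "exp_tail a (u - e - w) \<le> exp (2 * a * e) * (exp (- a * u) * indicator {0<..} u)"
proof -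
  have *: "a * w \<le> a * e" "- (a * w) \<le> a * e"
    using assms mult_left_mono[of w e a] mult_left_mono[of "- w" e a] by auto
  have 1: "exp (- a * u) \<le> exp (2 * a * e) * exp (- a * (u + e - w))"
    unfolding exp_add[symmetric] exp_le_cancel_iff using * by (simp add: algebra_simps)
  have 2: "exp (- a * (u - e - w)) \<le> exp (2 * a * e) * exp (- a * u)"
    unfolding exp_add[symmetric] exp_le_cancel_iff using * by (simp add: algebra_simps)
  show "exp_tail a u \<le> exp (2 * a * e) * exp_tail a (u + e - w)"
    using 1 assms by (auto simp: exp_tail_def indicator_def)
  show "exp_tail a (u - e - w) \<le> exp (2 * a * e) * (exp (- a * u) * indicator {0<..} u)"
    using 2 assms by (auto simp: exp_tail_def indicator_def)
qed

section \<open>Two-sided comparison of a quadrant expectation with its smoothed version\<close>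

locale smoothing = P?: finite_measure P for P :: "'a measure" +
  fixes U V :: "'a \<Rightarrow> real" and k :: "real \<Rightarrow> real" and a b h m K :: real
  assumes UV_measurable [measurable]: "U \<in> borel_measurable P" "V \<in> borel_measurable P"
    and k_measurable [measurable]: "k \<in> borel_measurable borel"
    and k_nonneg: "\<And>w. 0 \<le> k w"
    and ab_pos: "0 < a" "0 < b"
    and mass: "(\<integral>\<^sup>+w. ennreal (k w) \<partial>lborel) = ennreal K"
    and inner_mass: "(\<integral>\<^sup>+w. ennreal (k w) * indicator {-h<..<h} w \<partial>lborel) = ennreal m"
    and m_pos: "0 < m" and m_le: "m \<le> K"
begin

definition H :: "real \<Rightarrow> real \<Rightarrow> ennreal" where
  "H x y = (\<integral>\<^sup>+xi. ennreal (exp_tail a (U xi + x)) * ennreal (exp_tail b (V xi + y)) \<partial>P)"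

text \<open>Here the law of (U, V) is replaced by its smoothing with k in each coordinate: the inner
  integral is the smoothed density at (y1 - x, y2 - y).\<close>

definition J :: "real \<Rightarrow> real \<Rightarrow> ennreal" where
  "J x y = (\<integral>\<^sup>+y1. \<integral>\<^sup>+y2. ennreal (exp_tail a y1) * ennreal (exp_tail b y2) *
     (\<integral>\<^sup>+xi. ennreal (k (U xi + x - y1)) * ennreal (k (V xi + y - y2)) \<partial>P) \<partial>lborel \<partial>lborel)"

lemma H_measurable [measurable]: "case_prod H \<in> borel_measurable (borel \<Otimes>\<^sub>M borel)"
  unfolding H_def by measurable

lemma inner_sub:
  "(\<integral>\<^sup>+w. ennreal (k w) * ennreal (exp_tail c (u - w)) \<partial>lborel) = (\<integral>\<^sup>+w. ennreal (exp_tail c w) * ennreal (k (u - w)) \<partial>lborel)"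
  by (subst nn_integral_real_affine[where c="-1" and t=u]) (auto simp: mult.commute)

lemma swap3:
  assumes [measurable]: "(\<lambda>x. f (fst x) (fst (snd x)) (snd (snd x))) \<in> borel_measurable (lborel \<Otimes>\<^sub>M (lborel \<Otimes>\<^sub>M P))"
  shows "(\<integral>\<^sup>+(y1::real). \<integral>\<^sup>+(y2::real). \<integral>\<^sup>+xi. f y1 y2 xi \<partial>P \<partial>lborel \<partial>lborel)
    = (\<integral>\<^sup>+xi. \<integral>\<^sup>+y1. \<integral>\<^sup>+y2. f y1 y2 xi \<partial>lborel \<partial>lborel \<partial>P)"
proof -
  interpret Q: pair_sigma_finite lborel P ..
  have 1: "(\<lambda>(y2, xi). f y1 y2 xi) \<in> borel_measurable (lborel \<Otimes>\<^sub>M P)" for y1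
  proof -
    have "(\<lambda>z. f (fst (y1, z)) (fst (snd (y1, z))) (snd (snd (y1, z)))) \<in> borel_measurable (lborel \<Otimes>\<^sub>M P)"
      by (rule measurable_compose[OF _ assms]) simp
    then show ?thesis by (simp add: case_prod_beta')
  qed
  have 2: "(\<lambda>(y1, xi). \<integral>\<^sup>+y2. f y1 y2 xi \<partial>lborel) \<in> borel_measurable (lborel \<Otimes>\<^sub>M P)"
  proof -
    have "(\<lambda>(w, y2). (\<lambda>x. f (fst x) (fst (snd x)) (snd (snd x))) (fst w, y2, snd w)) \<in> borel_measurable ((lborel \<Otimes>\<^sub>M P) \<Otimes>\<^sub>M lborel)"
      by (subst case_prod_beta', rule measurable_compose[OF _ assms]) simp
    then show ?thesis by (simp add: case_prod_beta' lborel.borel_measurable_nn_integral_fst)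
  qed
  show ?thesis
    by (simp add: Q.Fubini'[OF 1, symmetric] Q.Fubini'[OF 2, symmetric])
qed

lemma nn_integral_times:
  fixes f g :: "real \<Rightarrow> ennreal"
  assumes [measurable]: "f \<in> borel_measurable borel" "g \<in> borel_measurable borel"
  shows "(\<integral>\<^sup>+x. \<integral>\<^sup>+y. f x * g y \<partial>lborel \<partial>lborel) = (\<integral>\<^sup>+x. f x \<partial>lborel) * (\<integral>\<^sup>+y. g y \<partial>lborel)"
  by (simp add: nn_integral_cmult nn_integral_multc)

text \<open>Tonelli's theorem and the reflection w = U + x - y1 move the smoothing from the law to
  the quadrant: \<open>J\<close> is an average of the expectations \<open>H\<close> over randomly
  shifted quadrants.\<close>

lemma J_eq: "J x y = (\<integral>\<^sup>+w1. \<integral>\<^sup>+w2. ennreal (k w1) * ennreal (k w2) * H (x - w1) (y - w2) \<partial>lborel \<partial>lborel)"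
proof -
  let ?f = "\<lambda>y1 y2 xi. (ennreal (exp_tail a y1) * ennreal (k (U xi + x - y1))) *
    (ennreal (exp_tail b y2) * ennreal (k (V xi + y - y2)))"
  let ?g = "\<lambda>w1 w2 xi. (ennreal (k w1) * ennreal (exp_tail a (U xi + x - w1))) *
    (ennreal (k w2) * ennreal (exp_tail b (V xi + y - w2)))"
  have "J x y = (\<integral>\<^sup>+y1. \<integral>\<^sup>+y2. \<integral>\<^sup>+xi. ?f y1 y2 xi \<partial>P \<partial>lborel \<partial>lborel)"
    unfolding J_def by (subst nn_integral_cmult[symmetric]) (simp_all add: mult_ac)
  also have "\<dots> = (\<integral>\<^sup>+xi. \<integral>\<^sup>+y1. \<integral>\<^sup>+y2. ?f y1 y2 xi \<partial>lborel \<partial>lborel \<partial>P)"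
    by (rule swap3) measurable
  also have "\<dots> = (\<integral>\<^sup>+xi. \<integral>\<^sup>+w1. \<integral>\<^sup>+w2. ?g w1 w2 xi \<partial>lborel \<partial>lborel \<partial>P)"
  proof (rule nn_integral_cong)
    fix xi
    show "(\<integral>\<^sup>+y1. \<integral>\<^sup>+y2. ?f y1 y2 xi \<partial>lborel \<partial>lborel) =
      (\<integral>\<^sup>+w1. \<integral>\<^sup>+w2. ?g w1 w2 xi \<partial>lborel \<partial>lborel)"
      by (subst (1 2) nn_integral_times) (simp_all add: inner_sub)
  qed
  also have "\<dots> = (\<integral>\<^sup>+w1. \<integral>\<^sup>+w2. \<integral>\<^sup>+xi. ?g w1 w2 xi \<partial>P \<partial>lborel \<partial>lborel)"
    by (rule swap3[symmetric]) measurable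
  also have "\<dots> = (\<integral>\<^sup>+w1. \<integral>\<^sup>+w2. ennreal (k w1) * ennreal (k w2) * H (x - w1) (y - w2) \<partial>lborel \<partial>lborel)"
    unfolding H_def by (subst nn_integral_cmult[symmetric]) (simp_all add: add_diff_eq mult_ac)
  finally show ?thesis .
qed

lemma inner_mass2:
  "(\<integral>\<^sup>+w1. \<integral>\<^sup>+w2. (ennreal (k w1) * indicator {-h<..<h} w1) * (ennreal (k w2) * indicator {-h<..<h} w2) \<partial>lborel \<partial>lborel)
    = ennreal (m\<^sup>2)"
  using m_pos by (subst nn_integral_times) (simp_all add: inner_mass power2_eq_square ennreal_mult)

lemma mass2:
  "(\<integral>\<^sup>+w1. \<integral>\<^sup>+w2. ennreal (k w1) * ennreal (k w2) \<partial>lborel \<partial>lborel) = ennreal (K\<^sup>2)"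
  using m_pos m_le by (subst nn_integral_times) (simp_all add: mass power2_eq_square ennreal_mult)

text \<open>Only the part of the average \<open>J_eq\<close> with both shifts in (-h, h) is kept.
  Starting from (x + h, y + h) guarantees that each quadrant kept contains the original one, so
  \<open>exp_tail_shift_le\<close> applies.\<close>

lemma H_le_J: "ennreal (m\<^sup>2) * H x y \<le> ennreal (exp (2 * (a + b) * h)) * J (x + h) (y + h)"
proof -
  let ?i = "\<lambda>w1 w2. (ennreal (k w1) * indicator {-h<..<h} w1) * (ennreal (k w2) * indicator {-h<..<h} w2)"
  have H_le: "H x y \<le> ennreal (exp (2 * (a + b) * h)) * H (x + h - w1) (y + h - w2)"
    if "\<bar>w1\<bar> < h" "\<bar>w2\<bar> < h" for w1 w2
  proof -
    have "ennreal (exp_tail a (U xi + x)) * ennreal (exp_tail b (V xi + y)) \<le> ennreal (exp (2 * (a + b) * h)) *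
        (ennreal (exp_tail a (U xi + (x + h - w1))) * ennreal (exp_tail b (V xi + (y + h - w2))))" for xi
    proof -
      have "exp_tail a (U xi + x) * exp_tail b (V xi + y) \<le>
          (exp (2 * a * h) * exp_tail a (U xi + x + h - w1)) * (exp (2 * b * h) * exp_tail b (V xi + y + h - w2))"
        by (intro mult_mono exp_tail_shift_le ab_pos that) auto
      also have "\<dots> = exp (2 * (a + b) * h) * (exp_tail a (U xi + (x + h - w1)) * exp_tail b (V xi + (y + h - w2)))"
        by (simp add: exp_add algebra_simps)
      finally have "ennreal (exp_tail a (U xi + x) * exp_tail b (V xi + y)) \<le> ennreal \<dots>"
        by (rule ennreal_leI)
      then show ?thesis by (simp add: ennreal_mult)
    qed
    then show ?thesis
      unfolding H_def by (subst nn_integral_cmult[symmetric]) (auto intro!: nn_integral_mono)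
  qed
  have "ennreal (m\<^sup>2) * H x y = (\<integral>\<^sup>+w1. \<integral>\<^sup>+w2. ?i w1 w2 * H x y \<partial>lborel \<partial>lborel)"
    unfolding inner_mass2[symmetric] by (subst nn_integral_multc[symmetric]; (intro nn_integral_cong nn_integral_multc[symmetric])?; measurable)
  also have "\<dots> \<le> (\<integral>\<^sup>+w1. \<integral>\<^sup>+w2. ennreal (exp (2 * (a + b) * h)) *
      (ennreal (k w1) * ennreal (k w2) * H (x + h - w1) (y + h - w2)) \<partial>lborel \<partial>lborel)"
  proof (intro nn_integral_mono)
    fix w1 w2
    show "?i w1 w2 * H x y
      \<le> ennreal (exp (2 * (a + b) * h)) * (ennreal (k w1) * ennreal (k w2) * H (x + h - w1) (y + h - w2))"
      using mult_left_mono[OF H_le[of w1 w2], of "ennreal (k w1) * ennreal (k w2)"]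
      by (auto simp: indicator_def abs_less_iff mult_ac)
  qed
  also have "\<dots> = ennreal (exp (2 * (a + b) * h)) * J (x + h) (y + h)"
    unfolding J_eq by (subst nn_integral_cmult[symmetric]; (intro nn_integral_cong nn_integral_cmult)?; measurable)
  finally show ?thesis .
qed

text \<open>The open quadrant, in contrast to the closed one in \<open>H\<close>; the event of
  interest lies between the two.\<close>

definition H0 :: ennreal where
  "H0 = (\<integral>\<^sup>+xi. ennreal (exp (- a * U xi) * indicator {0<..} (U xi)) * ennreal (exp (- b * V xi) * indicator {0<..} (V xi)) \<partial>P)"

text \<open>The average \<open>J_eq\<close> is split. For shifts in the square (-h, h)^2 every
  quadrant based at (-h, -h) lies inside the open one; for the others only the uniform bound C is
  available, weighted with the remaining mass K^2 - m^2.\<close>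

lemma J_le_H0:
  assumes C: "\<And>x y. H x y \<le> ennreal C" and "0 \<le> C"
  shows "J (- h) (- h) \<le> ennreal (exp (2 * (a + b) * h)) * ennreal (m\<^sup>2) * H0 + ennreal (K\<^sup>2 - m\<^sup>2) * ennreal C"
proof -
  let ?i = "\<lambda>w1 w2. (ennreal (k w1) * indicator {-h<..<h} w1) * (ennreal (k w2) * indicator {-h<..<h} w2)"
  let ?o = "\<lambda>w1 w2. ennreal (k w1) * ennreal (k w2) * (if \<bar>w1\<bar> < h \<and> \<bar>w2\<bar> < h then 0 else 1)"
  have io: "ennreal (k w1) * ennreal (k w2) = ?i w1 w2 + ?o w1 w2" for w1 w2
    by (auto simp: indicator_def abs_less_iff)
  have "ennreal (K\<^sup>2) = ennreal (m\<^sup>2) + (\<integral>\<^sup>+w1. \<integral>\<^sup>+w2. ?o w1 w2 \<partial>lborel \<partial>lborel)"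
  proof -
    have "ennreal (K\<^sup>2) = (\<integral>\<^sup>+w1. \<integral>\<^sup>+w2. ?i w1 w2 + ?o w1 w2 \<partial>lborel \<partial>lborel)"
      unfolding mass2[symmetric] by (intro nn_integral_cong io)
    also have "\<dots> = (\<integral>\<^sup>+w1. (\<integral>\<^sup>+w2. ?i w1 w2 \<partial>lborel) + (\<integral>\<^sup>+w2. ?o w1 w2 \<partial>lborel) \<partial>lborel)"
      by (intro nn_integral_cong nn_integral_add; measurable)
    also have "\<dots> = (\<integral>\<^sup>+w1. \<integral>\<^sup>+w2. ?i w1 w2 \<partial>lborel \<partial>lborel) + (\<integral>\<^sup>+w1. \<integral>\<^sup>+w2. ?o w1 w2 \<partial>lborel \<partial>lborel)"
      by (intro nn_integral_add; measurable)
    finally show ?thesis by (simp only: inner_mass2)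
  qed
  then have o: "(\<integral>\<^sup>+w1. \<integral>\<^sup>+w2. ?o w1 w2 \<partial>lborel \<partial>lborel) = ennreal (K\<^sup>2 - m\<^sup>2)"
    using m_pos m_le by (subst ennreal_minus[symmetric]) (simp_all only: ennreal_add_diff_cancel_left ennreal_neq_top zero_le_power2 simp_thms)
  have H_le: "H (- h - w1) (- h - w2) \<le> ennreal (exp (2 * (a + b) * h)) * H0"
    if "\<bar>w1\<bar> < h" "\<bar>w2\<bar> < h" for w1 w2
  proof -
    have "ennreal (exp_tail a (U xi + (- h - w1))) * ennreal (exp_tail b (V xi + (- h - w2))) \<le> ennreal (exp (2 * (a + b) * h)) *
        (ennreal (exp (- a * U xi) * indicator {0<..} (U xi)) * ennreal (exp (- b * V xi) * indicator {0<..} (V xi)))" for xi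
    proof -
      have "exp_tail a (U xi - h - w1) * exp_tail b (V xi - h - w2) \<le>
          (exp (2 * a * h) * (exp (- a * U xi) * indicator {0<..} (U xi))) * (exp (2 * b * h) * (exp (- b * V xi) * indicator {0<..} (V xi)))"
        by (intro mult_mono exp_tail_shift_le ab_pos that) auto
      also have "\<dots> = exp (2 * (a + b) * h) * ((exp (- a * U xi) * indicator {0<..} (U xi)) * (exp (- b * V xi) * indicator {0<..} (V xi)))"
        by (simp add: exp_add algebra_simps)
      finally have "ennreal (exp_tail a (U xi - h - w1) * exp_tail b (V xi - h - w2)) \<le> ennreal \<dots>"
        by (rule ennreal_leI)
      then show ?thesis by (simp add: ennreal_mult diff_diff_eq add_diff_eq)
    qed
    then show ?thesis
      unfolding H_def H0_def by (subst nn_integral_cmult[symmetric]) (auto intro!: nn_integral_mono)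
  qed
  have "J (- h) (- h) = (\<integral>\<^sup>+w1. \<integral>\<^sup>+w2. ennreal (k w1) * ennreal (k w2) * H (- h - w1) (- h - w2) \<partial>lborel \<partial>lborel)"
    by (rule J_eq)
  also have "\<dots> \<le> (\<integral>\<^sup>+w1. \<integral>\<^sup>+w2. ?i w1 w2 * (ennreal (exp (2 * (a + b) * h)) * H0) + ?o w1 w2 * ennreal C \<partial>lborel \<partial>lborel)"
  proof (intro nn_integral_mono)
    fix w1 w2
    show "ennreal (k w1) * ennreal (k w2) * H (- h - w1) (- h - w2) \<le> ?i w1 w2 * (ennreal (exp (2 * (a + b) * h)) * H0) + ?o w1 w2 * ennreal C"
      using mult_left_mono[OF H_le[of w1 w2], of "ennreal (k w1) * ennreal (k w2)"]
        mult_left_mono[OF C[of "- h - w1" "- h - w2"], of "ennreal (k w1) * ennreal (k w2)"]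
      by (auto simp: indicator_def abs_less_iff mult_ac)
  qed
  also have "\<dots> = ennreal (m\<^sup>2) * (ennreal (exp (2 * (a + b) * h)) * H0) + ennreal (K\<^sup>2 - m\<^sup>2) * ennreal C"
  proof -
    have "(\<integral>\<^sup>+w1. \<integral>\<^sup>+w2. ?i w1 w2 * c + ?o w1 w2 * d \<partial>lborel \<partial>lborel) = ennreal (m\<^sup>2) * c + ennreal (K\<^sup>2 - m\<^sup>2) * d" for c d
    proof -
      have "(\<integral>\<^sup>+w1. \<integral>\<^sup>+w2. ?i w1 w2 * c + ?o w1 w2 * d \<partial>lborel \<partial>lborel) =
        (\<integral>\<^sup>+w1. (\<integral>\<^sup>+w2. ?i w1 w2 \<partial>lborel) * c + (\<integral>\<^sup>+w2. ?o w1 w2 \<partial>lborel) * d \<partial>lborel)"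
        by (intro nn_integral_cong, subst nn_integral_add; (subst nn_integral_multc)?; (subst nn_integral_multc)?; measurable)
      also have "\<dots> = (\<integral>\<^sup>+w1. \<integral>\<^sup>+w2. ?i w1 w2 \<partial>lborel \<partial>lborel) * c + (\<integral>\<^sup>+w1. \<integral>\<^sup>+w2. ?o w1 w2 \<partial>lborel \<partial>lborel) * d"
        by (subst nn_integral_add; (subst nn_integral_multc)?; (subst nn_integral_multc)?; measurable)
      finally show ?thesis by (simp only: inner_mass2 o)
    qed
    then show ?thesis .
  qed
  finally show ?thesis by (simp only: mult_ac)
qed

end

section \<open>Characteristic functions of planar random vectors\<close>

text \<open>Excluded from simplification below, so that exponents keep the form
  \<open>\<i> * complex_of_real r\<close>, whose exponential visibly has modulus 1.\<close>

lemmas of_real_arith = of_real_add of_real_mult of_real_diff of_real_minus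

lemma iexp_quadratic_approx:
  "cmod (iexp x - (1 + \<i> * complex_of_real x - complex_of_real (x\<^sup>2) / 2)) \<le> \<bar>x\<bar> ^ 3 / 6"
  using iexp_approx1[of x 2]
  by (simp add: numeral_eq_Suc power2_eq_square algebra_simps)

lemma nn_integral_gauss_1d:
  assumes "0 < a"
  shows "(\<integral>\<^sup>+x. ennreal (exp (- (a * (x - c)\<^sup>2) / 2)) \<partial>lborel) = ennreal (sqrt (2 * pi / a))"
proof -
  have "exp (- (a * (x - c)\<^sup>2) / 2) = sqrt (2 * pi / a) * normal_density c (1 / sqrt a) x" for x
    using assms by (simp add: normal_density_def real_sqrt_divide real_sqrt_mult power_divide field_simps)
  then have "(\<integral>\<^sup>+x. ennreal (exp (- (a * (x - c)\<^sup>2) / 2)) \<partial>lborel) =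
      ennreal (sqrt (2 * pi / a)) * (\<integral>\<^sup>+x. ennreal (normal_density c (1 / sqrt a) x) \<partial>lborel)"
    using assms by (subst nn_integral_cmult[symmetric]) (auto simp: ennreal_mult[symmetric])
  also have "(\<integral>\<^sup>+x. ennreal (normal_density c (1 / sqrt a) x) \<partial>lborel) = 1"
    using assms by (subst nn_integral_eq_integral) (auto simp: )
  finally show ?thesis by simp
qed

text \<open>Completing the square in the first coordinate leaves (A D - B^2) / A as coefficient of
  the second square, so the integral factors into two one-dimensional ones.\<close>

lemma nn_integral_gauss_2d:
  fixes A B D :: real
  assumes "0 < A" "0 < A * D - B\<^sup>2"
  shows "(\<integral>\<^sup>+u. ennreal (exp (- (A * (fst u)\<^sup>2 + 2 * B * fst u * snd u + D * (snd u)\<^sup>2) / 2)) \<partial>lborel)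
    = ennreal (2 * pi / sqrt (A * D - B\<^sup>2))"
proof -
  let ?d = "A * D - B\<^sup>2"
  have eq: "exp (- (A * s\<^sup>2 + 2 * B * s * t + D * t\<^sup>2) / 2) =
      exp (- (A * (s - (- B * t / A))\<^sup>2) / 2) * exp (- (?d / A * (t - 0)\<^sup>2) / 2)" for s t
  proof -
    define r where "r = B / A"
    have B: "B = r * A" using assms by (simp add: r_def)
    have "?d / A = D - r\<^sup>2 * A" using assms by (simp add: B power2_eq_square diff_divide_distrib)
    moreover have "- B * t / A = - r * t" using assms by (simp add: r_def)
    moreover have "- (A * s\<^sup>2 + 2 * B * s * t + D * t\<^sup>2) / 2 = - (A * (s - (- r * t))\<^sup>2) / 2 + - ((D - r\<^sup>2 * A) * (t - 0)\<^sup>2) / 2"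
      unfolding B by (simp add: power2_eq_square field_simps)
    ultimately show ?thesis
      by (simp only: exp_add)
  qed
  have inner: "(\<integral>\<^sup>+s. ennreal (exp (- (A * (s - c)\<^sup>2) / 2) * k) \<partial>lborel) = ennreal k * ennreal (sqrt (2 * pi / A))"
    if "0 \<le> k" for c k
    using nn_integral_gauss_1d[OF assms(1), of c] that
    by (simp add: ennreal_mult nn_integral_cmult mult.commute)
  have "(\<integral>\<^sup>+u. ennreal (exp (- (A * (fst u)\<^sup>2 + 2 * B * fst u * snd u + D * (snd u)\<^sup>2) / 2)) \<partial>(lborel \<Otimes>\<^sub>M lborel))
      = (\<integral>\<^sup>+t. \<integral>\<^sup>+s. ennreal (exp (- (A * s\<^sup>2 + 2 * B * s * t + D * t\<^sup>2) / 2)) \<partial>lborel \<partial>lborel)"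
    by (subst lborel_pair.nn_integral_snd[symmetric]) simp_all
  also have "\<dots> = (\<integral>\<^sup>+t. ennreal (exp (- (?d / A * (t - 0)\<^sup>2) / 2)) * ennreal (sqrt (2 * pi / A)) \<partial>lborel)"
    unfolding eq by (intro nn_integral_cong inner) simp
  also have "\<dots> = ennreal (sqrt (2 * pi / (?d / A))) * ennreal (sqrt (2 * pi / A))"
    using assms by (subst nn_integral_multc, simp, subst nn_integral_gauss_1d) auto
  also have "\<dots> = ennreal (2 * pi / sqrt ?d)"
  proof -
    have "sqrt (2 * pi / (?d / A)) * sqrt (2 * pi / A) = sqrt ((2 * pi)\<^sup>2 / ?d)"
      unfolding real_sqrt_mult[symmetric] using assms
      by (intro arg_cong[where f=sqrt]) (simp add: power2_eq_square)
    also have "\<dots> = 2 * pi / sqrt ?d"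
      unfolding real_sqrt_divide real_sqrt_abs by simp
    finally show ?thesis
      using assms by (subst ennreal_mult[symmetric]) auto
  qed
  finally show ?thesis by (simp add: lborel_prod)
qed

lemma integral_lborel_scaleR:
  fixes f :: "'a::euclidean_space \<Rightarrow> 'b::{banach, second_countable_topology}"
  assumes [measurable]: "f \<in> borel_measurable borel" and "0 < r"
  shows "integral\<^sup>L lborel f = r ^ DIM('a) *\<^sub>R (\<integral>x. f (r *\<^sub>R x) \<partial>lborel)"
proof -
  have "integral\<^sup>L lborel f = integral\<^sup>L (density (distr lborel borel (\<lambda>x. 0 + r *\<^sub>R x)) (\<lambda>_. ennreal (r ^ DIM('a)))) f"
    using lborel_affine[of r "0::'a"] assms(2) by (simp add: ennreal_power)
  also have "\<dots> = r ^ DIM('a) *\<^sub>R (\<integral>x. f (r *\<^sub>R x) \<partial>lborel)"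
    using assms(2) by (subst integral_density) (simp_all add: integral_distr)
  finally show ?thesis .
qed

text \<open>The condition \<open>nonlattice\<close> excludes modulus 1 at each single point but says
  nothing about the limit at infinity; it also forces a nondegenerate covariance. Third moments give
  an explicit cubic remainder in the expansion of the characteristic function.\<close>

locale planar_variable = prob_space M for M :: "'a measure" +
  fixes X W :: "'a \<Rightarrow> real"
  assumes X_measurable [measurable]: "X \<in> borel_measurable M"
    and W_measurable [measurable]: "W \<in> borel_measurable M"
    and third_moments: "integrable M (\<lambda>xi. \<bar>X xi\<bar> ^ 3)" "integrable M (\<lambda>xi. \<bar>W xi\<bar> ^ 3)"
    and centered: "expectation X = 0" "expectation W = 0"
    and nonlattice: "\<And>s t. (s, t) \<noteq> (0, 0) \<Longrightarrow> cmod (\<integral>xi. iexp (s * X xi + t * W xi) \<partial>M) < 1"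
begin

definition "vX = expectation (\<lambda>xi. (X xi)\<^sup>2)"
definition "vW = expectation (\<lambda>xi. (W xi)\<^sup>2)"
definition "cov = expectation (\<lambda>xi. X xi * W xi)"
definition "disc = vX * vW - cov\<^sup>2"

definition phi :: "real \<times> real \<Rightarrow> complex" where
  "phi u = (\<integral>xi. iexp (fst u * X xi + snd u * W xi) \<partial>M)"

definition Q :: "real \<times> real \<Rightarrow> real" where
  "Q u = vX * (fst u)\<^sup>2 + 2 * cov * fst u * snd u + vW * (snd u)\<^sup>2"

definition sq :: "real \<times> real \<Rightarrow> real" where
  "sq u = (fst u)\<^sup>2 + (snd u)\<^sup>2"

definition R3 :: real where
  "R3 = expectation (\<lambda>xi. (\<bar>X xi\<bar> + \<bar>W xi\<bar>) ^ 3)"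

lemma integrable_R3: "integrable M (\<lambda>xi. (\<bar>X xi\<bar> + \<bar>W xi\<bar>) ^ 3)"
proof (rule Bochner_Integration.integrable_bound)
  show "integrable M (\<lambda>xi. 4 * (\<bar>X xi\<bar> ^ 3 + \<bar>W xi\<bar> ^ 3))"
    using third_moments by simp
  have "(a + b) ^ 3 \<le> 4 * (a ^ 3 + b ^ 3)" if "0 \<le> a" "0 \<le> b" for a b :: real
  proof -
    have "4 * (a ^ 3 + b ^ 3) - (a + b) ^ 3 = 3 * (a + b) * (a - b)\<^sup>2"
      by (simp add: power2_eq_square power3_eq_cube algebra_simps)
    moreover have "0 \<le> 3 * (a + b) * (a - b)\<^sup>2" using that by simp
    ultimately show ?thesis by linarith
  qed
  then show "AE xi in M. norm ((\<bar>X xi\<bar> + \<bar>W xi\<bar>) ^ 3) \<le> norm (4 * (\<bar>X xi\<bar> ^ 3 + \<bar>W xi\<bar> ^ 3))"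
    by (intro AE_I2) simp
qed simp

lemma integrable_bounded_moment:
  assumes [measurable]: "f \<in> borel_measurable M"
    and f: "\<And>xi. \<bar>f xi\<bar> \<le> (\<bar>X xi\<bar> + \<bar>W xi\<bar>) ^ n" and "n \<le> 3"
  shows "integrable M f"
proof (rule Bochner_Integration.integrable_bound)
  show "integrable M (\<lambda>xi. 1 + (\<bar>X xi\<bar> + \<bar>W xi\<bar>) ^ 3)"
    using integrable_R3 by simp
  have "r ^ n \<le> 1 + r ^ 3" if "0 \<le> r" for r :: real
  proof (cases "1 \<le> r")
    case True
    then show ?thesis using power_increasing[OF \<open>n \<le> 3\<close>, of r] by simp
  next
    case False
    then have "r ^ n \<le> 1" using that by (intro power_le_one) auto
    then show ?thesis using zero_le_power[OF that, of 3] by linarith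
  qed
  from order_trans[OF f this]
  show "AE xi in M. norm (f xi) \<le> norm (1 + (\<bar>X xi\<bar> + \<bar>W xi\<bar>) ^ 3)"
    by (intro AE_I2) (simp add: )
qed simp

lemma integrable_moments [simp, intro]:
  "integrable M X" "integrable M W" "integrable M (\<lambda>xi. (X xi)\<^sup>2)" "integrable M (\<lambda>xi. (W xi)\<^sup>2)"
  "integrable M (\<lambda>xi. X xi * W xi)"
proof -
  show "integrable M X" by (rule integrable_bounded_moment[where n=1]) auto
  show "integrable M W" by (rule integrable_bounded_moment[where n=1]) auto
  show "integrable M (\<lambda>xi. (X xi)\<^sup>2)"
    by (rule integrable_bounded_moment[where n=2]) (auto simp: abs_le_square_iff[symmetric])
  show "integrable M (\<lambda>xi. (W xi)\<^sup>2)"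
    by (rule integrable_bounded_moment[where n=2]) (auto simp: abs_le_square_iff[symmetric])
  show "integrable M (\<lambda>xi. X xi * W xi)"
    by (rule integrable_bounded_moment[where n=2]) (auto simp: abs_mult power2_eq_square algebra_simps)
qed

lemma expectation_square: "expectation (\<lambda>xi. (fst u * X xi + snd u * W xi)\<^sup>2) = Q u"
proof -
  have "(\<lambda>xi. (fst u * X xi + snd u * W xi)\<^sup>2) =
      (\<lambda>xi. (fst u)\<^sup>2 * (X xi)\<^sup>2 + 2 * fst u * snd u * (X xi * W xi) + (snd u)\<^sup>2 * (W xi)\<^sup>2)"
    by (auto simp: power2_eq_square algebra_simps)
  then show ?thesis by (simp add: Q_def vX_def vW_def cov_def)
qed

lemma integrable_square: "integrable M (\<lambda>xi. (fst u * X xi + snd u * W xi)\<^sup>2)"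
proof -
  have "(\<lambda>xi. (fst u * X xi + snd u * W xi)\<^sup>2) =
      (\<lambda>xi. (fst u)\<^sup>2 * (X xi)\<^sup>2 + 2 * fst u * snd u * (X xi * W xi) + (snd u)\<^sup>2 * (W xi)\<^sup>2)"
    by (auto simp: power2_eq_square algebra_simps)
  then show ?thesis by simp
qed

lemma integrable_iexp_linear [simp]: "integrable M (\<lambda>xi. iexp (s * X xi + t * W xi))"
  by (rule integrable_const_bound[where B=1]) (auto simp del: of_real_arith)

lemma phi_le_1: "cmod (phi u) \<le> 1"
proof -
  have "cmod (phi u) \<le> (\<integral>xi. cmod (iexp (fst u * X xi + snd u * W xi)) \<partial>M)"
    unfolding phi_def by (rule integral_norm_bound)
  then show ?thesis by (simp add: prob_space del: of_real_arith)
qed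

lemma continuous_phi: "continuous_on S phi"
proof -
  have "isCont phi u" for u
    unfolding continuous_at_sequentially
  proof safe
    fix v assume v: "v \<longlonglongrightarrow> u"
    show "(phi \<circ> v) \<longlonglongrightarrow> phi u"
      unfolding comp_def phi_def
      by (rule integral_dominated_convergence[where w="\<lambda>_. 1"])
         (auto intro!: tendsto_intros v simp del: of_real_arith)
  qed
  then show ?thesis by (simp add: continuous_at_imp_continuous_on)
qed

lemma phi_measurable [measurable]: "phi \<in> borel_measurable borel"
  by (rule borel_measurable_continuous_onI[OF continuous_phi])

text \<open>If Q u vanished, the combination of X and W with coefficients u would be 0 almost
  surely, so the characteristic function would equal 1 at u, against
  \<open>nonlattice\<close>.\<close>

lemma Q_pos: "u \<noteq> 0 \<Longrightarrow> 0 < Q u"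
proof (rule ccontr)
  assume u: "u \<noteq> 0" and "\<not> 0 < Q u"
  moreover have "0 \<le> Q u"
    unfolding expectation_square[symmetric] by (intro integral_nonneg_AE) auto
  ultimately have "expectation (\<lambda>xi. (fst u * X xi + snd u * W xi)\<^sup>2) = 0"
    by (simp add: expectation_square)
  then have "AE xi in M. (fst u * X xi + snd u * W xi)\<^sup>2 = 0"
    by (subst (asm) integral_nonneg_eq_0_iff_AE[OF integrable_square]) auto
  then have "AE xi in M. iexp (fst u * X xi + snd u * W xi) = 1"
    by eventually_elim (simp del: of_real_arith)
  then have "phi u = (\<integral>xi. 1 \<partial>M)"
    unfolding phi_def by (intro integral_cong_AE) (auto simp del: of_real_arith)
  then have "cmod (phi u) = 1" by (simp add: prob_space)
  moreover have "cmod (phi u) < 1"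
    using nonlattice[of "fst u" "snd u"] u unfolding phi_def by (simp add: prod_eq_iff)
  ultimately show False by simp
qed

lemma vX_pos: "0 < vX" and vW_pos: "0 < vW"
  using Q_pos[of "(1, 0)"] Q_pos[of "(0, 1)"] by (simp_all add: Q_def zero_prod_def)

lemma disc_pos: "0 < disc"
proof -
  have "Q (cov, - vX) = vX * disc"
    by (simp add: Q_def disc_def power2_eq_square algebra_simps)
  moreover have "0 < Q (cov, - vX)"
    using vX_pos by (intro Q_pos) (simp add: zero_prod_def)
  ultimately show ?thesis using vX_pos by (simp add: zero_less_mult_iff)
qed

text \<open>Determinant over trace: a lower bound for the smaller eigenvalue of the covariance
  matrix.\<close>

definition "lam = disc / (vX + vW)"

lemma lam_pos: "0 < lam"
  using disc_pos vX_pos vW_pos by (simp add: lam_def)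

lemma Q_ge: "lam * sq u \<le> Q u"
proof -
  have tr: "0 < vX + vW" using vX_pos vW_pos by simp
  \<comment> \<open>Cayley-Hamilton: for the covariance matrix S, trace(S) <Su, u> - det(S) |u|^2 =
    |Su|^2.\<close>
  have "(vX + vW) * (Q u - lam * sq u) = (vX * fst u + cov * snd u)\<^sup>2 + (cov * fst u + vW * snd u)\<^sup>2"
    using tr by (simp add: Q_def lam_def sq_def disc_def field_simps power2_eq_square)
  also have "\<dots> \<ge> 0" by simp
  finally show ?thesis using tr by (simp add: zero_le_mult_iff)
qed

lemma phi_approx: "cmod (phi u - (1 - Q u / 2)) \<le> (\<bar>fst u\<bar> + \<bar>snd u\<bar>) ^ 3 * R3 / 6"
proof -
  let ?L = "\<lambda>xi. fst u * X xi + snd u * W xi"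
  let ?T = "\<lambda>xi. 1 + \<i> * complex_of_real (?L xi) - complex_of_real ((?L xi)\<^sup>2) / 2"
  have L: "has_bochner_integral M ?L 0"
    by (simp add: has_bochner_integral_iff centered)
  have L2: "has_bochner_integral M (\<lambda>xi. (?L xi)\<^sup>2) (Q u)"
    by (simp add: has_bochner_integral_iff integrable_square expectation_square)
  have "has_bochner_integral M (\<lambda>xi. 1) (1 :: complex)"
    by (simp add: has_bochner_integral_iff prob_space)
  then have "has_bochner_integral M ?T
      (1 + \<i> * complex_of_real 0 - complex_of_real (Q u) / 2)"
    by (intro has_bochner_integral_diff has_bochner_integral_add has_bochner_integral_mult_right
        has_bochner_integral_divide has_bochner_integral_of_real L L2) auto
  then have i: "integrable M ?T"
    and "(\<integral>xi. ?T xi \<partial>M) = 1 - Q u / 2"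
    by (auto simp: has_bochner_integral_iff)
  then have eq: "phi u - (1 - Q u / 2) = (\<integral>xi. iexp (?L xi) - ?T xi \<partial>M)"
    unfolding phi_def by (simp only: Bochner_Integration.integral_diff[OF integrable_iexp_linear i])
  have "cmod (\<integral>xi. iexp (?L xi) - ?T xi \<partial>M) \<le> (\<integral>xi. (\<bar>fst u\<bar> + \<bar>snd u\<bar>) ^ 3 * (\<bar>X xi\<bar> + \<bar>W xi\<bar>) ^ 3 / 6 \<partial>M)"
  proof (rule order_trans[OF integral_norm_bound], rule integral_mono)
    show "integrable M (\<lambda>xi. cmod (iexp (?L xi) - ?T xi))"
      by (intro integrable_norm Bochner_Integration.integrable_diff integrable_iexp_linear i)
    show "integrable M (\<lambda>xi. (\<bar>fst u\<bar> + \<bar>snd u\<bar>) ^ 3 * (\<bar>X xi\<bar> + \<bar>W xi\<bar>) ^ 3 / 6)"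
      using integrable_R3 by simp
    fix xi
    have "\<bar>?L xi\<bar> \<le> \<bar>fst u\<bar> * \<bar>X xi\<bar> + \<bar>snd u\<bar> * \<bar>W xi\<bar>"
      using abs_triangle_ineq[of "fst u * X xi" "snd u * W xi"] by (simp add: abs_mult)
    also have "\<dots> \<le> (\<bar>fst u\<bar> + \<bar>snd u\<bar>) * (\<bar>X xi\<bar> + \<bar>W xi\<bar>)"
      by (simp add: algebra_simps)
    finally have "\<bar>?L xi\<bar> ^ 3 \<le> ((\<bar>fst u\<bar> + \<bar>snd u\<bar>) * (\<bar>X xi\<bar> + \<bar>W xi\<bar>)) ^ 3"
      by (rule power_mono) simp
    then have "\<bar>?L xi\<bar> ^ 3 / 6 \<le> (\<bar>fst u\<bar> + \<bar>snd u\<bar>) ^ 3 * (\<bar>X xi\<bar> + \<bar>W xi\<bar>) ^ 3 / 6"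
      by (simp add: power_mult_distrib)
    then show "cmod (iexp (?L xi) - ?T xi)
        \<le> (\<bar>fst u\<bar> + \<bar>snd u\<bar>) ^ 3 * (\<bar>X xi\<bar> + \<bar>W xi\<bar>) ^ 3 / 6"
      by (rule order_trans[OF iexp_quadratic_approx])
  qed
  then show ?thesis
    unfolding eq[symmetric] by (simp add: R3_def)
qed

lemma R3_nonneg: "0 \<le> R3"
  unfolding R3_def by (intro integral_nonneg_AE) auto

lemma abs_sum_sq: "(\<bar>fst u\<bar> + \<bar>snd u\<bar>)\<^sup>2 \<le> 2 * sq u"
  using sum_squares_bound[of "\<bar>fst u\<bar>" "\<bar>snd u\<bar>"] by (simp add: sq_def power2_eq_square algebra_simps)

lemma phi_decay_local: "\<exists>\<delta>>0. \<forall>u. \<bar>fst u\<bar> + \<bar>snd u\<bar> \<le> \<delta> \<longrightarrow> cmod (phi u) \<le> exp (- (lam / 4) * sq u)"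
proof -
  \<comment> \<open>The first bound keeps Q u below 2, so that |1 - Q u / 2| = 1 - Q u / 2. The
    second makes the cubic remainder at most \<open>lam / 4 * sq u\<close>, half of the decrease
    that \<open>Q_ge\<close> provides.\<close>
  define \<delta> where "\<delta> = min (sqrt (1 / (vX + vW + \<bar>cov\<bar> + 1))) (lam / (4 * (R3 + 1)))"
  let ?T = "vX + vW + \<bar>cov\<bar> + 1"
  have T: "0 < ?T" using vX_pos vW_pos by simp
  have pos: "0 < \<delta>"
    using vX_pos vW_pos lam_pos R3_nonneg by (simp add: \<delta>_def)
  moreover have "cmod (phi u) \<le> exp (- (lam / 4) * sq u)" if u: "\<bar>fst u\<bar> + \<bar>snd u\<bar> \<le> \<delta>" for u
  proof -
    let ?r = "\<bar>fst u\<bar> + \<bar>snd u\<bar>"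
    have r: "0 \<le> ?r" "?r \<le> sqrt (1 / ?T)" "?r \<le> lam / (4 * (R3 + 1))"
      using u by (auto simp: \<delta>_def)
    have "?r\<^sup>2 \<le> (sqrt (1 / ?T))\<^sup>2" using r by (intro power_mono) auto
    then have r2: "?r\<^sup>2 * ?T \<le> 1" using T by (simp add: field_simps)
    have "Q u \<le> vX * ?r\<^sup>2 + 2 * \<bar>cov\<bar> * (\<bar>fst u\<bar> * \<bar>snd u\<bar>) + vW * ?r\<^sup>2"
    proof -
      have "(fst u)\<^sup>2 \<le> ?r\<^sup>2" "(snd u)\<^sup>2 \<le> ?r\<^sup>2" by (simp_all add: abs_le_square_iff[symmetric])
      then have "vX * (fst u)\<^sup>2 \<le> vX * ?r\<^sup>2" "vW * (snd u)\<^sup>2 \<le> vW * ?r\<^sup>2"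
        using vX_pos vW_pos by (auto intro!: mult_left_mono)
      moreover have "2 * cov * fst u * snd u \<le> 2 * \<bar>cov\<bar> * (\<bar>fst u\<bar> * \<bar>snd u\<bar>)"
        using abs_ge_self[of "2 * cov * fst u * snd u"] by (simp add: abs_mult mult_ac)
      ultimately show ?thesis unfolding Q_def by linarith
    qed
    also have "\<dots> \<le> vX * ?r\<^sup>2 + \<bar>cov\<bar> * ?r\<^sup>2 + vW * ?r\<^sup>2"
    proof -
      have "2 * (\<bar>fst u\<bar> * \<bar>snd u\<bar>) \<le> ?r\<^sup>2" by (simp add: power2_eq_square algebra_simps)
      then have "\<bar>cov\<bar> * (2 * (\<bar>fst u\<bar> * \<bar>snd u\<bar>)) \<le> \<bar>cov\<bar> * ?r\<^sup>2" by (intro mult_left_mono) auto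
      then show ?thesis by (simp add: mult_ac)
    qed
    also have "\<dots> \<le> ?r\<^sup>2 * ?T" by (simp add: algebra_simps)
    finally have Q2: "Q u \<le> 2" using r2 by simp
    have "?r ^ 3 * R3 / 6 \<le> lam / 4 * sq u"
    proof -
      have "?r ^ 3 * R3 = ?r\<^sup>2 * (?r * R3)" by (simp add: power2_eq_square power3_eq_cube)
      also have "\<dots> \<le> (2 * sq u) * (lam / (4 * (R3 + 1)) * (R3 + 1))"
        using r R3_nonneg abs_sum_sq lam_pos by (intro mult_mono) (auto simp: sq_def)
      also have "\<dots> = sq u * lam / 2" using R3_nonneg by (simp add: field_simps)
      finally have "?r ^ 3 * R3 \<le> sq u * lam / 2" .
      moreover have "0 \<le> sq u * lam" using lam_pos by (simp add: sq_def)
      ultimately have "?r ^ 3 * R3 / 6 \<le> sq u * lam / 4" by linarith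
      then show ?thesis by (simp add: mult.commute)
    qed
    then have "cmod (phi u - (1 - Q u / 2)) \<le> lam / 4 * sq u"
      using phi_approx[of u] by linarith
    then have "cmod (phi u) \<le> cmod (complex_of_real (1 - Q u / 2)) + lam / 4 * sq u"
      using norm_triangle_ineq2[of "phi u" "complex_of_real (1 - Q u / 2)"] by simp
    also have "cmod (complex_of_real (1 - Q u / 2)) = 1 - Q u / 2"
      unfolding norm_of_real using Q2 by simp
    finally have "cmod (phi u) \<le> 1 + (- (lam / 4) * sq u)"
      using Q_ge[of u] by simp
    also have "\<dots> \<le> exp (- (lam / 4) * sq u)" by (rule exp_ge_add_one_self)
    finally show ?thesis .
  qed
  ultimately show ?thesis by auto
qed

text \<open>Near the origin the quadratic expansion applies. On the rest of the square, compactness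
  and \<open>nonlattice\<close> give a bound \<rho> < 1, and since \<open>sq u\<close> is bounded
  there, a small enough rate c makes the Gaussian exceed \<rho>.\<close>

lemma phi_decay: "\<exists>c>0. \<forall>u. \<bar>fst u\<bar> \<le> r \<longrightarrow> \<bar>snd u\<bar> \<le> r \<longrightarrow> cmod (phi u) \<le> exp (- c * sq u)"
proof -
  obtain \<delta> where \<delta>: "0 < \<delta>" "\<And>u. \<bar>fst u\<bar> + \<bar>snd u\<bar> \<le> \<delta> \<Longrightarrow> cmod (phi u) \<le> exp (- (lam / 4) * sq u)"
    using phi_decay_local by blast
  define S where "S = {u. \<bar>fst u\<bar> \<le> r \<and> \<bar>snd u\<bar> \<le> r \<and> \<delta> \<le> \<bar>fst u\<bar> + \<bar>snd u\<bar>}"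
  have "S = ({-r..r} \<times> {-r..r}) \<inter> {u. \<delta> \<le> \<bar>fst u\<bar> + \<bar>snd u\<bar>}"
    by (auto simp: S_def)
  moreover have "closed {u :: real \<times> real. \<delta> \<le> \<bar>fst u\<bar> + \<bar>snd u\<bar>}"
    by (intro closed_Collect_le continuous_intros)
  ultimately have S: "compact S"
    by (metis compact_Times compact_Icc compact_Int_closed)
  have "\<exists>\<rho>. 0 < \<rho> \<and> \<rho> < 1 \<and> (\<forall>u\<in>S. cmod (phi u) \<le> \<rho>)"
  proof (cases "S = {}")
    case True then show ?thesis by (intro exI[of _ "1/2"]) auto
  next
    case False
    obtain v where v: "v \<in> S" "\<And>u. u \<in> S \<Longrightarrow> cmod (phi u) \<le> cmod (phi v)"
      using continuous_attains_sup[OF S False, of "\<lambda>u. cmod (phi u)"] continuous_on_norm[OF continuous_phi] by auto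
    have "v \<noteq> 0" using v(1) \<delta>(1) by (auto simp: S_def)
    then have "cmod (phi v) < 1"
      using nonlattice[of "fst v" "snd v"] unfolding phi_def by (simp add: prod_eq_iff)
    \<comment> \<open>The maximum with 1/2 keeps \<rho> positive, since its logarithm is taken
      below.\<close>
    then show ?thesis using v(2) by (intro exI[of _ "max (1/2) (cmod (phi v))"]) (auto simp: le_max_iff_disj)
  qed
  then obtain \<rho> where \<rho>: "0 < \<rho>" "\<rho> < 1" "\<And>u. u \<in> S \<Longrightarrow> cmod (phi u) \<le> \<rho>" by blast
  \<comment> \<open>As \<open>sq u\<close> is at most 2 r^2 on the square, this rate gives exp (- k
    * sq u) \<ge> \<rho>; the extra 1 keeps the denominator positive even for r = 0.\<close>
  define k where "k = - ln \<rho> / (2 * r\<^sup>2 + 1)"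
  have r: "0 < 2 * r\<^sup>2 + 1" by (intro add_nonneg_pos) auto
  have k: "0 < k" "k * (2 * r\<^sup>2 + 1) = - ln \<rho>"
    unfolding k_def using \<rho>(1,2) r by (intro divide_pos_pos; simp) (use r in simp)
  define c where "c = min (lam / 4) k"
  have sq: "0 \<le> sq u" for u by (simp add: sq_def)
  have "0 < c" using lam_pos k by (simp add: c_def)
  moreover have "cmod (phi u) \<le> exp (- c * sq u)" if u: "\<bar>fst u\<bar> \<le> r" "\<bar>snd u\<bar> \<le> r" for u
  proof (cases "u \<in> S")
    case True
    have "(fst u)\<^sup>2 \<le> r\<^sup>2" "(snd u)\<^sup>2 \<le> r\<^sup>2" using u by (auto simp: abs_le_square_iff[symmetric])
    then have "sq u \<le> 2 * r\<^sup>2 + 1" by (simp add: sq_def)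
    then have "c * sq u \<le> k * (2 * r\<^sup>2 + 1)"
      using k(1) by (intro mult_mono) (auto simp: c_def sq)
    also note k(2)
    finally have "\<rho> \<le> exp (- c * sq u)" using \<rho>(1) by (simp add: ln_le_cancel_iff[symmetric] ln_ge_iff)
    then show ?thesis using \<rho>(3)[OF True] by simp
  next
    case False
    then have "cmod (phi u) \<le> exp (- (lam / 4) * sq u)" using u by (intro \<delta>) (auto simp: S_def)
    also have "\<dots> \<le> exp (- c * sq u)" using mult_right_mono[OF _ sq, of c "lam / 4" u] by (simp add: c_def)
    finally show ?thesis .
  qed
  ultimately show ?thesis by blast
qed

end

section \<open>A local limit theorem for exponential tails\<close>

lemma borel_measurable_fst_snd [measurable (raw)]:
  fixes f :: "'a \<Rightarrow> real \<times> real"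
  assumes "f \<in> borel_measurable M"
  shows "(\<lambda>x. fst (f x)) \<in> borel_measurable M" "(\<lambda>x. snd (f x)) \<in> borel_measurable M"
  using assms by (auto intro!: measurable_compose[OF assms] borel_measurable_continuous_onI continuous_intros)

lemma tent2_le_indicator:
  assumes "0 < k"
  shows "tent (fst u / k) * tent (snd u / k) \<le> indicator (cbox (- k, - k) (k, k)) u"
proof (cases "u \<in> cbox (- k, - k) (k, k)")
  case True
  then show ?thesis by (simp add: mult_le_one tent_le_1)
next
  case False
  then have "1 \<le> \<bar>fst u / k\<bar> \<or> 1 \<le> \<bar>snd u / k\<bar>"
    using assms by (cases u) (auto simp: cbox_Pair_eq abs_if field_simps split: if_splits)
  then show ?thesis by (auto simp: tent_eq_0)
qed

lemma integrable_tent2: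
  assumes "0 < k"
  shows "integrable lborel (\<lambda>u. tent (fst u / k) * tent (snd u / k))"
proof (rule Bochner_Integration.integrable_bound)
  show "integrable lborel (indicator (cbox (- k, - k) (k, k)) :: real \<times> real \<Rightarrow> real)"
    by (simp add: emeasure_lborel_cbox_eq)
  show "AE u in lborel. norm (tent (fst u / k) * tent (snd u / k)) \<le> norm (indicator (cbox (- k, - k) (k, k)) u :: real)"
    using tent2_le_indicator[OF assms] by (intro AE_I2) (simp add: )
qed simp

text \<open>For k > 0 the total mass is 2 * pi, concentrating near 0 as k grows; the function with
  this Fourier transform is \<open>tent (s / k)\<close>, supported in [-k, k].\<close>

definition fejer_kernel :: "real \<Rightarrow> real \<Rightarrow> real" where
  "fejer_kernel k x = k * fejer (k * x)"

lemma fejer_kernel_measurable [measurable]: "fejer_kernel k \<in> borel_measurable borel"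
  unfolding fejer_kernel_def by measurable

lemma fejer_kernel_nonneg: "0 < k \<Longrightarrow> 0 \<le> fejer_kernel k x"
  by (simp add: fejer_kernel_def)

lemma has_bochner_integral_tent_iexp_scaled:
  assumes "0 < k"
  shows "has_bochner_integral lborel (\<lambda>s. complex_of_real (tent (s / k)) * iexp (s * x)) (complex_of_real (fejer_kernel k x))"
proof -
  have "has_bochner_integral lborel (\<lambda>s. complex_of_real (tent (0 + (1 / k) * s)) * iexp ((0 + (1 / k) * s) * (k * x)))
      (complex_of_real (fejer (k * x)) /\<^sub>R \<bar>1 / k\<bar>)"
    by (rule lborel_has_bochner_integral_real_affine_iff[THEN iffD1, OF _ has_bochner_integral_tent_iexp])
       (use assms in simp)
  then show ?thesis
    using assms by (simp add: fejer_kernel_def scaleR_conv_of_real)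
qed

lemma integral_tent2_iexp:
  assumes "0 < k"
  shows "(\<integral>u. complex_of_real (tent (fst u / k) * tent (snd u / k)) * iexp (fst u * x + snd u * y) \<partial>lborel)
    = complex_of_real (fejer_kernel k x * fejer_kernel k y)"
proof -
  let ?f = "\<lambda>u. complex_of_real (tent (fst u / k) * tent (snd u / k)) * iexp (fst u * x + snd u * y)"
  have "integrable lborel ?f"
    by (rule Bochner_Integration.integrable_bound[OF integrable_tent2[OF assms]])
       (auto simp: norm_mult simp del: of_real_arith)
  then have "integrable (lborel \<Otimes>\<^sub>M lborel) (\<lambda>(s, t). ?f (s, t))"
    by (simp add: lborel_prod case_prod_beta')
  from lborel_pair.integral_fst[OF this]
  have "(\<integral>u. ?f u \<partial>lborel) = (\<integral>s. \<integral>t. ?f (s, t) \<partial>lborel \<partial>lborel)"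
    by (simp add: lborel_prod case_prod_beta')
  also have "\<dots> = (\<integral>s. complex_of_real (tent (s / k)) * iexp (s * x) * (\<integral>t. complex_of_real (tent (t / k)) * iexp (t * y) \<partial>lborel) \<partial>lborel)"
    by (subst integral_mult_right_zero[symmetric]) (simp add: exp_add algebra_simps)
  also have "\<dots> = complex_of_real (fejer_kernel k x * fejer_kernel k y)"
    using has_bochner_integral_tent_iexp_scaled[OF assms, THEN has_bochner_integral_integral_eq]
    by simp
  finally show ?thesis .
qed

lemma nn_integral_fejer_kernel:
  assumes "0 < k"
  shows "(\<integral>\<^sup>+x. ennreal (fejer_kernel k x) * indicator {-e<..<e} x \<partial>lborel) =
    (\<integral>\<^sup>+x. ennreal (fejer x) * indicator {-(k * e)<..<k * e} x \<partial>lborel)"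
    and "(\<integral>\<^sup>+x. ennreal (fejer_kernel k x) \<partial>lborel) = ennreal (2 * pi)"
proof -
  have *: "(\<integral>\<^sup>+x. g x \<partial>lborel) = (\<integral>\<^sup>+x. ennreal k * g (k * x) \<partial>lborel)" if [measurable]: "g \<in> borel_measurable borel" for g :: "real \<Rightarrow> ennreal"
    using assms by (subst nn_integral_real_affine[where c=k and t=0]) (auto simp: nn_integral_cmult)
  have i: "indicator {-(k * e)<..<k * e} (k * x) = (indicator {-e<..<e} x :: ennreal)" for x
    using assms mult_less_cancel_left_pos[OF assms, of "- e" x] by (auto simp: indicator_def)
  show "(\<integral>\<^sup>+x. ennreal (fejer_kernel k x) * indicator {-e<..<e} x \<partial>lborel) =
    (\<integral>\<^sup>+x. ennreal (fejer x) * indicator {-(k * e)<..<k * e} x \<partial>lborel)"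
    using assms by (subst *) (simp_all add: i fejer_kernel_def ennreal_mult mult.assoc)
  show "(\<integral>\<^sup>+x. ennreal (fejer_kernel k x) \<partial>lborel) = ennreal (2 * pi)"
    unfolding nn_integral_fejer[symmetric] using assms by (subst *) (simp_all add: fejer_kernel_def ennreal_mult)
qed

definition fejer_mass :: "real \<Rightarrow> real" where
  "fejer_mass r = enn2real (\<integral>\<^sup>+x. ennreal (fejer x) * indicator {-r<..<r} x \<partial>lborel)"

lemma fejer_mass_le_aux: "(\<integral>\<^sup>+x. ennreal (fejer x) * indicator {-r<..<r} x \<partial>lborel) \<le> ennreal (2 * pi)"
  unfolding nn_integral_fejer[symmetric] by (intro nn_integral_mono) (auto simp: indicator_def)

lemma ennreal_fejer_mass: "ennreal (fejer_mass r) = (\<integral>\<^sup>+x. ennreal (fejer x) * indicator {-r<..<r} x \<partial>lborel)"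
  unfolding fejer_mass_def
  using le_less_trans[OF fejer_mass_le_aux ennreal_less_top] by (intro ennreal_enn2real)

lemma fejer_mass_le: "fejer_mass r \<le> 2 * pi"
  using fejer_mass_le_aux[of r] unfolding ennreal_fejer_mass[symmetric] by simp

lemma fejer_mass_tendsto: "(\<lambda>j. fejer_mass (real j)) \<longlonglongrightarrow> 2 * pi"
proof -
  have "(\<lambda>j. \<integral>\<^sup>+x. ennreal (fejer x) * indicator {- real j<..<real j} x \<partial>lborel) \<longlonglongrightarrow> (\<integral>\<^sup>+x. ennreal (fejer x) \<partial>lborel)"
  proof (rule nn_integral_dominated_convergence[where w="\<lambda>x. ennreal (fejer x)"])
    show "AE x in lborel. (\<lambda>j. ennreal (fejer x) * indicator {- real j<..<real j} x) \<longlonglongrightarrow> ennreal (fejer x)"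
    proof (intro AE_I2 tendsto_eventually)
      fix x :: real
      show "\<forall>\<^sub>F j in sequentially. ennreal (fejer x) * indicator {- real j<..<real j} x = ennreal (fejer x)"
        using eventually_gt_at_top[of "nat \<lceil>\<bar>x\<bar>\<rceil>"]
        by eventually_elim (auto simp: indicator_def abs_less_iff; linarith)
    qed
  qed (auto simp: nn_integral_fejer indicator_def)
  then show ?thesis
    unfolding ennreal_fejer_mass[symmetric] nn_integral_fejer by (simp add: fejer_mass_def)
qed

section \<open>Fourier inversion for the smoothed law of the sums\<close>

context planar_variable
begin

definition P :: "nat \<Rightarrow> (nat \<Rightarrow> 'a) measure" where
  "P n = PiM {..<n} (\<lambda>_. M)"

definition SX :: "nat \<Rightarrow> (nat \<Rightarrow> 'a) \<Rightarrow> real" where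
  "SX n x = (\<Sum>i<n. X (x i))"

definition SW :: "nat \<Rightarrow> (nat \<Rightarrow> 'a) \<Rightarrow> real" where
  "SW n x = (\<Sum>i<n. W (x i))"

lemma prob_space_P: "prob_space (P n)"
  unfolding P_def by (intro prob_space_PiM prob_space_axioms)

lemma sums_measurable [measurable]: "SX n \<in> borel_measurable (P n)" "SW n \<in> borel_measurable (P n)"
  unfolding SX_def SW_def P_def by measurable

lemma integral_iexp_sums: "(\<integral>x. iexp (fst u * SX n x + snd u * SW n x) \<partial>P n) = phi u ^ n"
proof -
  interpret product_prob_space "\<lambda>_::nat. M" by unfold_locales
  have "iexp (fst u * SX n x + snd u * SW n x) = (\<Prod>i<n. iexp (fst u * X (x i) + snd u * W (x i)))" for x
    by (simp add: exp_sum[symmetric] SX_def SW_def sum.distrib sum_distrib_left algebra_simps)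
  then have "(\<integral>x. iexp (fst u * SX n x + snd u * SW n x) \<partial>P n) =
      (\<integral>x. (\<Prod>i<n. iexp (fst u * X (x i) + snd u * W (x i))) \<partial>P n)"
    by presburger
  also have "\<dots> = (\<Prod>i<n. phi u)"
    unfolding P_def phi_def by (rule product_integral_prod) (simp_all only: finite_lessThan integrable_iexp_linear)
  finally show ?thesis by simp
qed

text \<open>Up to the factor (2 * pi)^2, the density at y of the law of the sums smoothed by the
  Fejer kernel in both coordinates.\<close>

definition smooth_mass :: "real \<Rightarrow> nat \<Rightarrow> real \<times> real \<Rightarrow> real" where
  "smooth_mass k n y = (\<integral>x. fejer_kernel k (SX n x - fst y) * fejer_kernel k (SW n x - snd y) \<partial>P n)"

text \<open>The kernels are themselves Fourier transforms of tents, so inversion reduces to Fubini;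
  the compact support of the tents supplies the integrability.\<close>

lemma smooth_mass_eq:
  assumes k: "0 < k"
  shows "complex_of_real (smooth_mass k n y) = (\<integral>u. complex_of_real (tent (fst u / k) * tent (snd u / k)) *
    iexp (- (fst u * fst y + snd u * snd y)) * phi u ^ n \<partial>lborel)"
proof -
  interpret Pn: prob_space "P n" by (rule prob_space_P)
  interpret pair_sigma_finite "P n" "lborel :: (real \<times> real) measure" ..
  let ?T = "\<lambda>u. tent (fst u / k) * tent (snd u / k)"
  let ?f = "\<lambda>x u. complex_of_real (?T u) * iexp (fst u * (SX n x - fst y) + snd u * (SW n x - snd y))"
  have nf: "norm (?f x u) = ?T u" for x u
    by (simp add: norm_mult del: of_real_arith)
  have meas: "(\<lambda>(x, u). ?f x u) \<in> borel_measurable (P n \<Otimes>\<^sub>M lborel)"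
    unfolding case_prod_beta' by measurable
  have int: "integrable (P n \<Otimes>\<^sub>M lborel) (\<lambda>(x, u). ?f x u)"
  proof (rule Fubini_integrable[OF meas])
    show "integrable (P n) (\<lambda>x. \<integral>u. norm (case (x, u) of (x, u) \<Rightarrow> ?f x u) \<partial>lborel)"
      unfolding prod.case nf by (rule Pn.integrable_const)
    have "integrable lborel (?f x)" for x
      by (rule Bochner_Integration.integrable_bound[OF integrable_tent2[OF k]]) (simp_all only: nf, simp_all)
    then show "AE x in P n. integrable lborel (\<lambda>u. case (x, u) of (x, u) \<Rightarrow> ?f x u)"
      by simp
  qed
  have "complex_of_real (smooth_mass k n y) = (\<integral>x. complex_of_real (fejer_kernel k (SX n x - fst y) * fejer_kernel k (SW n x - snd y)) \<partial>P n)"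
    unfolding smooth_mass_def by (rule integral_complex_of_real[symmetric])
  also have "\<dots> = (\<integral>x. \<integral>u. ?f x u \<partial>lborel \<partial>P n)"
    by (simp only: integral_tent2_iexp[OF k])
  also have "\<dots> = (\<integral>u. \<integral>x. ?f x u \<partial>P n \<partial>lborel)"
    by (rule Fubini_integral[OF int, symmetric])
  also have "\<dots> = (\<integral>u. (complex_of_real (?T u) * iexp (- (fst u * fst y + snd u * snd y))) * phi u ^ n \<partial>lborel)"
  proof (rule Bochner_Integration.integral_cong[OF refl])
    fix u
    have "?f x u = (complex_of_real (?T u) * iexp (- (fst u * fst y + snd u * snd y))) * iexp (fst u * SX n x + snd u * SW n x)" for x
      by (simp add: exp_add[symmetric] exp_minus[symmetric] mult.assoc right_diff_distrib algebra_simps exp_diff exp_minus field_simps)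
    then have "(\<integral>x. ?f x u \<partial>P n) = (\<integral>x. (complex_of_real (?T u) * iexp (- (fst u * fst y + snd u * snd y))) * iexp (fst u * SX n x + snd u * SW n x) \<partial>P n)"
      by presburger
    also have "\<dots> = (complex_of_real (?T u) * iexp (- (fst u * fst y + snd u * snd y))) * phi u ^ n"
      by (simp only: integral_mult_right_zero integral_iexp_sums)
    finally show "(\<integral>x. ?f x u \<partial>P n) = (complex_of_real (?T u) * iexp (- (fst u * fst y + snd u * snd y))) * phi u ^ n" .
  qed
  finally show ?thesis .
qed

lemma integrable_exp_sq:
  assumes "0 < c"
  shows "integrable lborel (\<lambda>u. exp (- c * sq u))"
proof (rule integrableI_bounded)
  have "(\<integral>\<^sup>+u. ennreal (norm (exp (- c * sq u))) \<partial>lborel) =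
      (\<integral>\<^sup>+u. ennreal (exp (- ((2 * c) * (fst u)\<^sup>2 + 2 * 0 * fst u * snd u + (2 * c) * (snd u)\<^sup>2) / 2)) \<partial>lborel)"
    by (intro nn_integral_cong arg_cong[where f=ennreal]) (simp add: sq_def algebra_simps)
  also have "\<dots> < \<infinity>"
    using assms by (subst nn_integral_gauss_2d) auto
  finally show "(\<integral>\<^sup>+u. ennreal (norm (exp (- c * sq u))) \<partial>lborel) < \<infinity>" .
qed (simp add: sq_def)

lemma integral_exp_Q: "(\<integral>u. exp (- Q u / 2) \<partial>lborel) = 2 * pi / sqrt disc"
proof -
  have "(\<integral>\<^sup>+u. ennreal (exp (- Q u / 2)) \<partial>lborel) = ennreal (2 * pi / sqrt disc)"
    using nn_integral_gauss_2d[OF vX_pos disc_pos[unfolded disc_def]] by (simp only: Q_def disc_def)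
  then show ?thesis
    using disc_pos by (intro integral_eq_nn_integral[THEN trans]) (auto simp: Q_def)
qed

text \<open>The central limit theorem with explicit error: for numbers of modulus at most 1, |x^n -
  y^n| \<le> n |x - y|, and the remainder of \<open>phi_approx\<close> at u / sqrt n is of order
  n^(-3/2).\<close>

lemma phi_power_tendsto:
  "(\<lambda>n. phi ((1 / sqrt (real n)) *\<^sub>R u) ^ n) \<longlonglongrightarrow> complex_of_real (exp (- Q u / 2))"
proof -
  let ?v = "\<lambda>n::nat. (1 / sqrt (real n)) *\<^sub>R u"
  have Qv: "Q (?v n) = Q u / real n" if "n > 0" for n
    using that by (simp add: Q_def power_divide field_simps power2_eq_square)
  let ?C = "(\<bar>fst u\<bar> + \<bar>snd u\<bar>) ^ 3 * R3 / 6"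
  have 1: "(\<lambda>n. complex_of_real ((1 + (- Q u / 2) / real n) ^ n)) \<longlonglongrightarrow> complex_of_real (exp (- Q u / 2))"
    by (intro tendsto_of_real tendsto_exp_limit_sequentially)
  have "(\<lambda>n. phi (?v n) ^ n - complex_of_real ((1 + (- Q u / 2) / real n) ^ n)) \<longlonglongrightarrow> 0"
  proof (rule Lim_null_comparison)
    have "(\<lambda>n. 1 / sqrt (real n)) \<longlonglongrightarrow> 0" by real_asymp
    then show "(\<lambda>n. ?C * (1 / sqrt (real n))) \<longlonglongrightarrow> 0"
      by (rule tendsto_mult_right_zero)
    show "\<forall>\<^sub>F n in sequentially. norm (phi (?v n) ^ n - complex_of_real ((1 + (- Q u / 2) / real n) ^ n)) \<le> ?C * (1 / sqrt (real n))"
      \<comment> \<open>For n > |Q u| the comparison value 1 - Q u / (2 n) has modulus at most 1, as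
        \<open>norm_power_diff\<close> requires.\<close>
      using eventually_gt_at_top[of "nat \<lceil>\<bar>Q u\<bar>\<rceil>"] eventually_gt_at_top[of 0]
    proof eventually_elim
      case (elim n)
      have n: "0 < real n" "\<bar>Q u\<bar> \<le> real n" using elim by linarith+
      have Q0: "0 \<le> Q u" unfolding expectation_square[symmetric] by (intro integral_nonneg_AE) auto
      have "Q u / real n \<le> 1" using n Q0 by simp
      moreover have "0 \<le> Q u / real n" using n Q0 by simp
      ultimately have le1: "norm (complex_of_real (1 + (- Q u / 2) / real n)) \<le> 1"
        unfolding norm_of_real by (simp add: abs_le_iff)
      have "norm (phi (?v n) ^ n - complex_of_real (1 + (- Q u / 2) / real n) ^ n)
          \<le> real n * norm (phi (?v n) - complex_of_real (1 + (- Q u / 2) / real n))"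
        by (rule norm_power_diff[OF phi_le_1 le1])
      also have "phi (?v n) - complex_of_real (1 + (- Q u / 2) / real n) = phi (?v n) - (1 - Q (?v n) / 2)"
        using Qv[of n] elim by (simp add: )
      also have "real n * norm (phi (?v n) - (1 - Q (?v n) / 2)) \<le> real n * ((\<bar>fst (?v n)\<bar> + \<bar>snd (?v n)\<bar>) ^ 3 * R3 / 6)"
        by (intro mult_left_mono phi_approx) simp
      also have "\<bar>fst (?v n)\<bar> + \<bar>snd (?v n)\<bar> = (1 / sqrt (real n)) * (\<bar>fst u\<bar> + \<bar>snd u\<bar>)"
        by (simp add: abs_mult algebra_simps add_divide_distrib)
      also have "real n * (((1 / sqrt (real n)) * (\<bar>fst u\<bar> + \<bar>snd u\<bar>)) ^ 3 * R3 / 6) = ?C * (1 / sqrt (real n))"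
      proof -
        have "real n * (1 / sqrt (real n)) ^ 3 = 1 / sqrt (real n)"
          using n by (simp add: power3_eq_cube field_simps)
        moreover have "real n * ((k * S) ^ 3 * R3 / 6) = (S ^ 3 * R3 / 6) * (real n * k ^ 3)" for k S
          by (simp add: power_mult_distrib)
        ultimately show ?thesis by (simp only:)
      qed
      finally show ?case by (simp only: of_real_power)
    qed
  qed
  from tendsto_add[OF this 1] show ?thesis by simp
qed

text \<open>Substituting u / sqrt n in the inversion formula produces the factor 1 / n of dimension
  two, and \<open>phi_decay\<close> on the support of the tents dominates the integrand by one
  Gaussian for all n > 0. The shift y enters only through a factor of modulus 1, so the bound is
  uniform in y; at u / sqrt n this factor tends to 1, so the limit does not depend on y.\<close>

lemma smooth_mass_asymp:
  assumes k: "0 < k"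
  shows "\<exists>B. \<forall>n>0. \<forall>y. real n * smooth_mass k n y \<le> B"
    and "(\<lambda>n. real n * smooth_mass k n y) \<longlonglongrightarrow> 2 * pi / sqrt disc"
proof -
  let ?T = "\<lambda>u. tent (fst u / k) * tent (snd u / k)"
  let ?v = "\<lambda>n u. (1 / sqrt (real n)) *\<^sub>R (u :: real \<times> real)"
  define F where "F n y u = complex_of_real (?T u) * iexp (- (fst u * fst y + snd u * snd y)) * phi u ^ n" for n and y u :: "real \<times> real"
  have [measurable]: "F n y \<in> borel_measurable borel" for n y
    unfolding F_def by measurable
  obtain c where c: "0 < c" "\<And>u. \<bar>fst u\<bar> \<le> k \<Longrightarrow> \<bar>snd u\<bar> \<le> k \<Longrightarrow> cmod (phi u) \<le> exp (- c * sq u)"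
    using phi_decay[of k] by blast
  have Fle: "norm (F n y u) \<le> exp (- c * (real n * sq u))" for n y u
  proof (cases "\<bar>fst u\<bar> \<le> k \<and> \<bar>snd u\<bar> \<le> k")
    case True
    have "norm (F n y u) = ?T u * cmod (phi u) ^ n"
      by (simp add: F_def norm_mult norm_power del: of_real_arith)
    also have "\<dots> \<le> 1 * exp (- c * sq u) ^ n"
      using True c by (intro mult_mono power_mono mult_le_one) (auto simp: tent_le_1)
    also have "\<dots> = exp (- c * (real n * sq u))"
      by (simp add: exp_of_nat_mult[symmetric] mult_ac)
    finally show ?thesis .
  next
    case False
    then have "1 \<le> \<bar>fst u / k\<bar> \<or> 1 \<le> \<bar>snd u / k\<bar>" using k by auto
    then have "F n y u = 0" by (auto simp: F_def tent_eq_0)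
    then show ?thesis by simp
  qed
  have scaled: "complex_of_real (real n * smooth_mass k n y) = (\<integral>u. F n y (?v n u) \<partial>lborel)" if "n > 0" for n y
  proof -
    have "complex_of_real (smooth_mass k n y) = (\<integral>u. F n y u \<partial>lborel)"
      unfolding F_def by (rule smooth_mass_eq[OF k])
    also have "\<dots> = (1 / sqrt (real n)) ^ DIM(real \<times> real) *\<^sub>R (\<integral>u. F n y (?v n u) \<partial>lborel)"
      using that by (intro integral_lborel_scaleR) auto
    also have "(1 / sqrt (real n)) ^ DIM(real \<times> real) = 1 / real n"
      by (simp add: power_divide)
    finally show ?thesis using that by (simp add: scaleR_conv_of_real)
  qed
  have bound: "norm (F n y (?v n u)) \<le> exp (- c * sq u)" if "n > 0" for n y u
  proof -
    have "real n * sq (?v n u) = sq u"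
      using that by (simp add: sq_def power_divide field_simps)
    then show ?thesis using Fle[of n y "?v n u"] by simp
  qed
  show "\<exists>B. \<forall>n>0. \<forall>y. real n * smooth_mass k n y \<le> B"
  proof (intro exI allI impI)
    fix n :: nat and y assume n: "0 < n"
    have "real n * smooth_mass k n y \<le> cmod (complex_of_real (real n * smooth_mass k n y))"
      by (simp only: norm_of_real abs_ge_self)
    also have "\<dots> \<le> (\<integral>u. norm (F n y (?v n u)) \<partial>lborel)"
      unfolding scaled[OF n] by (rule integral_norm_bound)
    also have "\<dots> \<le> (\<integral>u. exp (- c * sq u) \<partial>lborel)"
      using bound[OF n] by (intro integral_mono' integrable_exp_sq c) auto
    finally show "real n * smooth_mass k n y \<le> (\<integral>u. exp (- c * sq u) \<partial>lborel)" .
  qed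
  have lim0: "(\<lambda>n. 1 / sqrt (real n)) \<longlonglongrightarrow> 0" by real_asymp
  have vlim: "(\<lambda>n. ?v n u) \<longlonglongrightarrow> 0" for u :: "real \<times> real"
    using tendsto_scaleR[OF lim0 tendsto_const[of u]] by simp
  have Tlim: "(\<lambda>n. complex_of_real (?T (?v n u))) \<longlonglongrightarrow> complex_of_real 1" for u
  proof -
    have "isCont tent 0" unfolding tent_def[abs_def] by (intro continuous_intros)
    moreover have "(\<lambda>n. fst (?v n u) / k) \<longlonglongrightarrow> 0" "(\<lambda>n. snd (?v n u) / k) \<longlonglongrightarrow> 0"
      using tendsto_divide[OF tendsto_fst[OF vlim[of u]] tendsto_const[of k]]
        tendsto_divide[OF tendsto_snd[OF vlim[of u]] tendsto_const[of k]] k by simp_all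
    ultimately have "(\<lambda>n. ?T (?v n u)) \<longlonglongrightarrow> tent 0 * tent 0"
      by (intro tendsto_mult isCont_tendsto_compose[of 0 tent])
    then show ?thesis by (intro tendsto_of_real) (simp add: tent_def)
  qed
  have Elim: "(\<lambda>n. iexp (- (fst (?v n u) * fst y + snd (?v n u) * snd y))) \<longlonglongrightarrow> 1" for u
  proof -
    have "(\<lambda>n. iexp (- (fst (?v n u) * fst y + snd (?v n u) * snd y)))
        \<longlonglongrightarrow> iexp (- (fst (0 :: real \<times> real) * fst y + snd (0 :: real \<times> real) * snd y))"
      by (intro tendsto_intros vlim)
    then show ?thesis by simp
  qed
  \<comment> \<open>The index starts at 1 because the rescaling by 1 / sqrt n degenerates at n =
    0.\<close>
  have "(\<lambda>n. \<integral>u. F (Suc n) y (?v (Suc n) u) \<partial>lborel) \<longlonglongrightarrow> (\<integral>u. complex_of_real (exp (- Q u / 2)) \<partial>lborel)"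
  proof (rule integral_dominated_convergence[where w="\<lambda>u. exp (- c * sq u)"])
    show "integrable lborel (\<lambda>u. exp (- c * sq u))" by (rule integrable_exp_sq[OF c(1)])
    show "AE u in lborel. (\<lambda>n. F (Suc n) y (?v (Suc n) u)) \<longlonglongrightarrow> complex_of_real (exp (- Q u / 2))"
    proof (rule AE_I2)
      fix u
      have "(\<lambda>n. F n y (?v n u)) \<longlonglongrightarrow> complex_of_real 1 * 1 * complex_of_real (exp (- Q u / 2))"
        unfolding F_def by (intro tendsto_mult Tlim Elim phi_power_tendsto)
      from LIMSEQ_Suc[OF this] show "(\<lambda>n. F (Suc n) y (?v (Suc n) u)) \<longlonglongrightarrow> complex_of_real (exp (- Q u / 2))"
        by simp
    qed
    show "AE u in lborel. norm (F (Suc n) y (?v (Suc n) u)) \<le> exp (- c * sq u)" for n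
      by (intro AE_I2 bound) simp
  qed (simp_all add: Q_def)
  then have "(\<lambda>n. complex_of_real (real (Suc n) * smooth_mass k (Suc n) y)) \<longlonglongrightarrow> complex_of_real (\<integral>u. exp (- Q u / 2) \<partial>lborel)"
    by (simp only: scaled[OF zero_less_Suc, symmetric] integral_complex_of_real)
  then have "(\<lambda>n. real (Suc n) * smooth_mass k (Suc n) y) \<longlonglongrightarrow> 2 * pi / sqrt disc"
    unfolding tendsto_of_real_iff integral_exp_Q .
  then show "(\<lambda>n. real n * smooth_mass k n y) \<longlonglongrightarrow> 2 * pi / sqrt disc"
    by (rule LIMSEQ_imp_Suc)
qed

end

text \<open>For fixed j the two bounds leave a gap even in the limit; it closes only as j grows. The
  index j will measure the precision of the smoothing.\<close>

lemma tendsto_sandwich_family: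
  fixes u :: "nat \<Rightarrow> real"
  assumes up: "\<And>j n. n > 0 \<Longrightarrow> u n \<le> p j n" "\<And>j. (p j \<longlongrightarrow> p' j) sequentially" "p' \<longlonglongrightarrow> L"
    and lo: "\<And>j n. n > 0 \<Longrightarrow> q j n \<le> u n" "\<And>j. (q j \<longlongrightarrow> q' j) sequentially" "q' \<longlonglongrightarrow> L"
  shows "u \<longlonglongrightarrow> L"
proof (rule order_tendstoI)
  fix a assume "a < L"
  then obtain j where "a < q' j"
    using order_tendstoD(1)[OF lo(3)] by (meson eventually_sequentially order_refl)
  then have "\<forall>\<^sub>F n in sequentially. a < q j n" by (rule order_tendstoD(1)[OF lo(2)])
  then show "\<forall>\<^sub>F n in sequentially. a < u n"
    using eventually_gt_at_top[of 0] by eventually_elim (use lo(1) in \<open>blast intro: less_le_trans\<close>)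
next
  fix a assume "L < a"
  then obtain j where "p' j < a"
    using order_tendstoD(2)[OF up(3)] by (meson eventually_sequentially order_refl)
  then have "\<forall>\<^sub>F n in sequentially. p j n < a" by (rule order_tendstoD(2)[OF up(2)])
  then show "\<forall>\<^sub>F n in sequentially. u n < a"
    using eventually_gt_at_top[of 0] by eventually_elim (use up(1) in \<open>blast intro: le_less_trans\<close>)
qed

section \<open>Removing the smoothing\<close>

context planar_variable
begin

definition tail_exp :: "real \<Rightarrow> real \<Rightarrow> nat \<Rightarrow> real \<Rightarrow> real \<Rightarrow> real" where
  "tail_exp a b n x y = (\<integral>xi. exp_tail a (SX n xi + x) * exp_tail b (SW n xi + y) \<partial>P n)"

definition open_tail_exp :: "real \<Rightarrow> real \<Rightarrow> nat \<Rightarrow> real" where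
  "open_tail_exp a b n = (\<integral>xi. (exp (- a * SX n xi) * indicator {0<..} (SX n xi)) *
    (exp (- b * SW n xi) * indicator {0<..} (SW n xi)) \<partial>P n)"

definition smooth_tail :: "real \<Rightarrow> real \<Rightarrow> real \<Rightarrow> nat \<Rightarrow> real \<Rightarrow> real \<Rightarrow> real" where
  "smooth_tail k a b n x y = (\<integral>v. exp_tail a (fst v) * exp_tail b (snd v) * smooth_mass k n (fst v - x, snd v - y) \<partial>lborel)"

lemma integrable_exp_tail2:
  assumes "0 < a" "0 < b"
  shows "integrable lborel (\<lambda>v. exp_tail a (fst v) * exp_tail b (snd v))"
    and "(\<integral>v. exp_tail a (fst v) * exp_tail b (snd v) \<partial>lborel) = 1 / (a * b)"
proof -
  have "(\<integral>\<^sup>+v. ennreal (exp_tail a (fst v) * exp_tail b (snd v)) \<partial>(lborel \<Otimes>\<^sub>M lborel)) =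
      (\<integral>\<^sup>+s. \<integral>\<^sup>+t. ennreal (exp_tail a s) * ennreal (exp_tail b t) \<partial>lborel \<partial>lborel)"
    by (subst lborel.nn_integral_fst[symmetric]) (simp_all add: ennreal_mult)
  also have "\<dots> = ennreal (1 / a) * ennreal (1 / b)"
    using assms by (simp add: nn_integral_cmult nn_integral_multc nn_integral_exp_tail)
  also have "\<dots> = ennreal (1 / (a * b))"
    using assms by (subst ennreal_mult[symmetric]) auto
  finally have "(\<integral>\<^sup>+v. ennreal (exp_tail a (fst v) * exp_tail b (snd v)) \<partial>(lborel \<Otimes>\<^sub>M lborel)) = ennreal (1 / (a * b))" .
  then have nn: "(\<integral>\<^sup>+v. ennreal (exp_tail a (fst v) * exp_tail b (snd v)) \<partial>lborel) = ennreal (1 / (a * b))"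
    by (simp add: lborel_prod)
  show "integrable lborel (\<lambda>v. exp_tail a (fst v) * exp_tail b (snd v))"
    by (rule integrableI_nonneg) (simp_all add: nn)
  show "(\<integral>v. exp_tail a (fst v) * exp_tail b (snd v) \<partial>lborel) = 1 / (a * b)"
    using assms nn by (subst integral_eq_nn_integral) simp_all
qed

lemma fejer_kernel_le: "0 < k \<Longrightarrow> fejer_kernel k x \<le> k"
proof -
  have "\<bar>sinc y\<bar> \<le> 1" for y :: real
    using abs_sin_x_le_abs_x[of y] by (auto simp: divide_le_eq_1 abs_divide)
  then have "fejer y \<le> 1" for y
    unfolding fejer_def by (simp only: abs_square_le_1)
  then show "0 < k \<Longrightarrow> fejer_kernel k x \<le> k"
    by (simp add: fejer_kernel_def)
qed

lemma integrable_fejer_kernels: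
  assumes "0 < k"
  shows "integrable (P n) (\<lambda>xi. fejer_kernel k (SX n xi - x) * fejer_kernel k (SW n xi - y))"
proof -
  interpret Pn: prob_space "P n" by (rule prob_space_P)
  show ?thesis
    by (rule Pn.integrable_const_bound[where B="k * k"])
       (use assms in \<open>auto intro!: mult_mono fejer_kernel_le simp: fejer_kernel_nonneg abs_mult\<close>)
qed

lemma smooth_mass_nonneg: "0 < k \<Longrightarrow> 0 \<le> smooth_mass k n y"
  unfolding smooth_mass_def by (intro integral_nonneg_AE) (simp add: fejer_kernel_nonneg)

lemma smooth_mass_measurable [measurable]: "smooth_mass k n \<in> borel_measurable borel"
proof -
  interpret Pn: prob_space "P n" by (rule prob_space_P)
  show ?thesis unfolding smooth_mass_def by measurable
qed

text \<open>Integrates \<open>smooth_mass_asymp\<close> against the exponential weight of total mass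
  1 / (a * b). Dominated convergence applies because the bound on \<open>smooth_mass\<close> is
  uniform in its argument, and for the same reason the bound here is uniform in the shift.\<close>

lemma smooth_tail_asymp:
  assumes k: "0 < k" and ab: "0 < a" "0 < b"
  shows "\<exists>C. \<forall>n>0. \<forall>x y. real n * smooth_tail k a b n x y \<le> C"
    and "(\<lambda>n. real n * smooth_tail k a b n x y) \<longlonglongrightarrow> 2 * pi / (sqrt disc * a * b)"
proof -
  obtain B where B: "\<And>n y. n > 0 \<Longrightarrow> real n * smooth_mass k n y \<le> B"
    using smooth_mass_asymp(1)[OF k] by blast
  let ?E = "\<lambda>v. exp_tail a (fst v) * exp_tail b (snd v)"
  have eq: "real n * smooth_tail k a b n x y = (\<integral>v. ?E v * (real n * smooth_mass k n (fst v - x, snd v - y)) \<partial>lborel)" for n x y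
    unfolding smooth_tail_def by (subst integral_mult_right_zero[symmetric]) (simp add: mult_ac)
  have bound: "?E v * (real n * smooth_mass k n (fst v - x, snd v - y)) \<le> ?E v * B" if "n > 0" for n v x y
    using B[OF that] by (intro mult_left_mono) auto
  have B0: "0 \<le> B"
    using order_trans[OF smooth_mass_nonneg[OF k] B[of 1, simplified]] by blast
  have int: "integrable lborel (\<lambda>v. ?E v * B)"
    using integrable_exp_tail2[OF ab] by simp
  show "\<exists>C. \<forall>n>0. \<forall>x y. real n * smooth_tail k a b n x y \<le> C"
    unfolding eq using bound smooth_mass_nonneg[OF k] B0
    by (intro exI[of _ "\<integral>v. ?E v * B \<partial>lborel"] allI impI integral_mono'[OF int]) auto
  have "(\<lambda>n. \<integral>v. ?E v * (real (Suc n) * smooth_mass k (Suc n) (fst v - x, snd v - y)) \<partial>lborel)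
      \<longlonglongrightarrow> (\<integral>v. ?E v * (2 * pi / sqrt disc) \<partial>lborel)"
  proof (rule integral_dominated_convergence[OF _ _ int])
    show "AE v in lborel. (\<lambda>n. ?E v * (real (Suc n) * smooth_mass k (Suc n) (fst v - x, snd v - y))) \<longlonglongrightarrow> ?E v * (2 * pi / sqrt disc)"
      by (intro AE_I2 tendsto_mult tendsto_const LIMSEQ_Suc[OF smooth_mass_asymp(2)[OF k]])
    show "AE v in lborel. norm (?E v * (real (Suc n) * smooth_mass k (Suc n) (fst v - x, snd v - y))) \<le> ?E v * B" for n
    proof (rule AE_I2)
      fix v
      have "0 \<le> ?E v * (real (Suc n) * smooth_mass k (Suc n) (fst v - x, snd v - y))"
        using smooth_mass_nonneg[OF k] by (intro mult_nonneg_nonneg) auto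
      then show "norm (?E v * (real (Suc n) * smooth_mass k (Suc n) (fst v - x, snd v - y))) \<le> ?E v * B"
        using bound[of "Suc n" v x y] by (simp only: real_norm_def abs_of_nonneg zero_less_Suc)
    qed
  qed measurable
  then have "(\<lambda>n. real (Suc n) * smooth_tail k a b (Suc n) x y) \<longlonglongrightarrow> 1 / (a * b) * (2 * pi / sqrt disc)"
    unfolding eq[symmetric] by (simp only: integral_mult_left_zero integrable_exp_tail2[OF ab])
  then have "(\<lambda>n. real n * smooth_tail k a b n x y) \<longlonglongrightarrow> 1 / (a * b) * (2 * pi / sqrt disc)"
    by (rule LIMSEQ_imp_Suc)
  then show "(\<lambda>n. real n * smooth_tail k a b n x y) \<longlonglongrightarrow> 2 * pi / (sqrt disc * a * b)"
    by (simp add: mult_ac)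
qed

text \<open>The locale \<open>smoothing\<close> for the Fejer kernel: \<open>tail_exp\<close>,
  \<open>open_tail_exp\<close> and \<open>smooth_tail\<close> are the real values of its
  \<open>H\<close>, \<open>H0\<close> and \<open>J\<close>. The mass of
  \<open>fejer_kernel k\<close> in (-h, h) depends only on k * h, so h can be small while little
  mass is lost.\<close>

lemma tail_exp_bounds:
  assumes k: "0 < k" and ab: "0 < a" "0 < b" and m: "m = fejer_mass (k * h)" "0 < m"
  shows "m\<^sup>2 * tail_exp a b n x y \<le> exp (2 * (a + b) * h) * smooth_tail k a b n (x + h) (y + h)"
    and "(\<And>x y. tail_exp a b n x y \<le> C) \<Longrightarrow>
      smooth_tail k a b n (- h) (- h) \<le> exp (2 * (a + b) * h) * m\<^sup>2 * open_tail_exp a b n + ((2 * pi)\<^sup>2 - m\<^sup>2) * C"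
proof -
  interpret Pn: prob_space "P n" by (rule prob_space_P)
  interpret S: smoothing "P n" "SX n" "SW n" "fejer_kernel k" a b h m "2 * pi"
  proof unfold_locales
    show "(\<integral>\<^sup>+w. ennreal (fejer_kernel k w) * indicator {-h<..<h} w \<partial>lborel) = ennreal m"
      unfolding m ennreal_fejer_mass by (rule nn_integral_fejer_kernel[OF k])
  qed (use k ab m fejer_mass_le in \<open>auto simp: fejer_kernel_nonneg nn_integral_fejer_kernel\<close>)
  have H: "S.H x y = ennreal (tail_exp a b n x y)" for x y
    unfolding S.H_def tail_exp_def
    by (subst nn_integral_eq_integral[symmetric])
       (use ab in \<open>auto intro!: Pn.integrable_const_bound[where B=1] AE_I2 mult_le_one exp_tail_le_1 simp: ennreal_mult\<close>)
  have H0: "S.H0 = ennreal (open_tail_exp a b n)"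
    unfolding S.H0_def open_tail_exp_def
    by (subst nn_integral_eq_integral[symmetric])
       (use ab in \<open>auto intro!: Pn.integrable_const_bound[where B=1] AE_I2 mult_le_one simp: ennreal_mult indicator_def\<close>)
  have J: "S.J x y = ennreal (smooth_tail k a b n x y)" for x y
  proof -
    let ?E = "\<lambda>v. exp_tail a (fst v) * exp_tail b (snd v)"
    have le: "smooth_mass k n v \<le> k * k" for v
    proof -
      have "smooth_mass k n v \<le> (\<integral>x. k * k \<partial>P n)"
        unfolding smooth_mass_def
        by (intro integral_mono integrable_fejer_kernels mult_mono fejer_kernel_le) (use k in \<open>auto simp: fejer_kernel_nonneg\<close>)
      then show ?thesis by (simp add: Pn.prob_space)
    qed
    have inner: "(\<integral>\<^sup>+xi. ennreal (fejer_kernel k (SX n xi + x - y1)) * ennreal (fejer_kernel k (SW n xi + y - y2)) \<partial>P n)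
        = ennreal (smooth_mass k n (y1 - x, y2 - y))" for y1 y2
    proof -
      have "(\<integral>\<^sup>+xi. ennreal (fejer_kernel k (SX n xi + x - y1)) * ennreal (fejer_kernel k (SW n xi + y - y2)) \<partial>P n)
          = (\<integral>\<^sup>+xi. ennreal (fejer_kernel k (SX n xi - (y1 - x)) * fejer_kernel k (SW n xi - (y2 - y))) \<partial>P n)"
        using k by (intro nn_integral_cong) (simp add: ennreal_mult fejer_kernel_nonneg diff_diff_eq2)
      also have "\<dots> = ennreal (smooth_mass k n (y1 - x, y2 - y))"
        unfolding smooth_mass_def fst_conv snd_conv
        by (rule nn_integral_eq_integral[OF integrable_fejer_kernels[OF k]]) (use k in \<open>simp add: fejer_kernel_nonneg\<close>)
      finally show ?thesis .
    qed
    have "S.J x y = (\<integral>\<^sup>+y1. \<integral>\<^sup>+y2. ennreal (?E (y1, y2) * smooth_mass k n (fst (y1, y2) - x, snd (y1, y2) - y)) \<partial>lborel \<partial>lborel)"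
      unfolding S.J_def inner using smooth_mass_nonneg[OF k] by (simp add: ennreal_mult)
    also have "\<dots> = (\<integral>\<^sup>+v. ennreal (?E v * smooth_mass k n (fst v - x, snd v - y)) \<partial>(lborel \<Otimes>\<^sub>M lborel))"
      by (subst lborel.nn_integral_fst[symmetric]) (simp_all add: lborel_prod)
    also have "\<dots> = ennreal (smooth_tail k a b n x y)"
      unfolding lborel_prod smooth_tail_def
    proof (rule nn_integral_eq_integral)
      show "integrable lborel (\<lambda>v. ?E v * smooth_mass k n (fst v - x, snd v - y))"
        by (rule Bochner_Integration.integrable_bound[where f="\<lambda>v. ?E v * (k * k)"])
           (use integrable_exp_tail2[OF ab] le smooth_mass_nonneg[OF k] in \<open>auto intro!: AE_I2 mult_left_mono simp: abs_mult\<close>)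
    qed (use smooth_mass_nonneg[OF k] in auto)
    finally show ?thesis .
  qed
  have nonneg: "0 \<le> tail_exp a b n x y" "0 \<le> smooth_tail k a b n x y" "0 \<le> open_tail_exp a b n" for x y
    unfolding tail_exp_def smooth_tail_def open_tail_exp_def
    using smooth_mass_nonneg[OF k] by (auto intro!: integral_nonneg_AE)
  show "m\<^sup>2 * tail_exp a b n x y \<le> exp (2 * (a + b) * h) * smooth_tail k a b n (x + h) (y + h)"
    using S.H_le_J[of x y] nonneg unfolding H J by (simp add: ennreal_mult[symmetric])
  assume C: "\<And>x y. tail_exp a b n x y \<le> C"
  then have C0: "0 \<le> C" using order_trans[OF nonneg(1)] by blast
  have mm: "m\<^sup>2 \<le> (2 * pi)\<^sup>2" using m fejer_mass_le by (intro power_mono) auto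
  show "smooth_tail k a b n (- h) (- h) \<le> exp (2 * (a + b) * h) * m\<^sup>2 * open_tail_exp a b n + ((2 * pi)\<^sup>2 - m\<^sup>2) * C"
    using S.J_le_H0[of C] C C0 nonneg mm unfolding H J H0
    by (simp add: ennreal_mult[symmetric] ennreal_plus[symmetric] del: ennreal_plus)
qed

text \<open>The upper bound uses the closed quadrant and the lower bound the open one, so
  \<open>A n\<close> may contain any measurable part of the boundary. The limit is the value at 0 of
  the Gaussian density with determinant \<open>disc\<close>, times the integral 1 / (a * b) of the
  weight.\<close>

theorem exp_tail_asymptotics:
  assumes ab: "0 < a" "0 < b" and A: "\<And>n. A n \<in> sets (P n)"
    and sub: "\<And>n xi. xi \<in> space (P n) \<Longrightarrow> 0 < SX n xi \<Longrightarrow> 0 < SW n xi \<Longrightarrow> xi \<in> A n"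
    and sup: "\<And>n xi. xi \<in> A n \<Longrightarrow> 0 \<le> SX n xi \<and> 0 \<le> SW n xi"
  shows "(\<lambda>n. real n * (\<integral>xi. exp (- a * SX n xi - b * SW n xi) * indicator (A n) xi \<partial>P n)) \<longlonglongrightarrow> 1 / (2 * pi * sqrt disc * a * b)"
proof -
  let ?u = "\<lambda>n. (\<integral>xi. exp (- a * SX n xi - b * SW n xi) * indicator (A n) xi \<partial>P n)"
  note [measurable] = A
  have le: "open_tail_exp a b n \<le> ?u n" "?u n \<le> tail_exp a b n 0 0" for n
  proof -
    interpret Pn: prob_space "P n" by (rule prob_space_P)
    have 1: "exp (- a * SX n xi - b * SW n xi) * indicator (A n) xi \<le> exp_tail a (SX n xi + 0) * exp_tail b (SW n xi + 0)" for xi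
      using sup[of xi n] by (auto simp: exp_tail_def indicator_def exp_diff exp_minus field_simps)
    have 2: "(exp (- a * SX n xi) * indicator {0<..} (SX n xi)) * (exp (- b * SW n xi) * indicator {0<..} (SW n xi))
       \<le> exp (- a * SX n xi - b * SW n xi) * indicator (A n) xi" if "xi \<in> space (P n)" for xi
      using sub[of xi n] that by (auto simp: indicator_def exp_diff exp_minus field_simps)
    have 3: "integrable (P n) (\<lambda>xi. exp_tail a (SX n xi + 0) * exp_tail b (SW n xi + 0))"
      by (rule Pn.integrable_const_bound[where B=1]) (use ab in \<open>auto intro!: mult_le_one exp_tail_le_1\<close>)
    have 4: "integrable (P n) (\<lambda>xi. exp (- a * SX n xi - b * SW n xi) * indicator (A n) xi)"
      by (rule Bochner_Integration.integrable_bound[OF 3]) (use 1 in \<open>auto intro!: AE_I2 simp: abs_mult\<close>)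
    show "?u n \<le> tail_exp a b n 0 0"
      unfolding tail_exp_def by (rule integral_mono[OF 4 3 1])
    show "open_tail_exp a b n \<le> ?u n"
      unfolding open_tail_exp_def by (rule integral_mono'[OF 4]) (use 2 in auto)
  qed
  \<comment> \<open>The width h j tends to 0 while k j * h j = j + 1 + j0 tends to infinity, so the
    shift factor e j tends to 1 and the mass m j inside (-h j, h j) tends to 2 * pi simultaneously.
    The offset j0 makes that mass positive for every j.\<close>
  define h :: "nat \<Rightarrow> real" where "h j = 1 / real (Suc j)" for j
  have "\<forall>\<^sub>F j in sequentially. 0 < fejer_mass (real j)"
    using order_tendstoD(1)[OF fejer_mass_tendsto, of 0] by simp
  then obtain j0 where j0: "\<And>j. j \<ge> j0 \<Longrightarrow> 0 < fejer_mass (real j)"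
    by (auto simp: eventually_sequentially)
  define m where "m j = fejer_mass (real (Suc j + j0))" for j
  define k :: "nat \<Rightarrow> real" where "k j = real (Suc j + j0) * real (Suc j)" for j
  have k: "0 < k j" "m j = fejer_mass (k j * h j)" "0 < m j" for j
    using j0[of "Suc j + j0"] by (simp_all add: k_def m_def h_def)
  have mlim: "m \<longlonglongrightarrow> 2 * pi"
  proof -
    have "(\<lambda>j. fejer_mass (real (j + Suc j0))) \<longlonglongrightarrow> 2 * pi"
      by (rule LIMSEQ_ignore_initial_segment[OF fejer_mass_tendsto])
    then show ?thesis by (simp add: m_def[abs_def] add_ac)
  qed
  have hlim: "h \<longlonglongrightarrow> 0" unfolding h_def[abs_def] by real_asymp
  define e where "e j = exp (2 * (a + b) * h j)" for j
  have e: "0 < e j" for j by (simp add: e_def)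
  have elim: "e \<longlonglongrightarrow> 1"
  proof -
    have "e \<longlonglongrightarrow> exp (2 * (a + b) * 0)" unfolding e_def[abs_def] by (intro tendsto_intros hlim)
    then show ?thesis by simp
  qed
  \<comment> \<open>The shift-uniform bound required by the lower estimate is the upper estimate
    itself, taken at the fixed precision j = 0.\<close>
  have "\<exists>C. \<forall>n>0. \<forall>x y. real n * tail_exp a b n x y \<le> C"
  proof -
    obtain C where C: "\<And>n x y. n > 0 \<Longrightarrow> real n * smooth_tail (k 0) a b n x y \<le> C"
      using smooth_tail_asymp(1)[OF k(1)[of 0] ab] by blast
    have "real n * tail_exp a b n x y \<le> e 0 * C / (m 0)\<^sup>2" if "n > 0" for n x y
    proof -
      have "(m 0)\<^sup>2 * (real n * tail_exp a b n x y) = real n * ((m 0)\<^sup>2 * tail_exp a b n x y)" by simp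
      also have "\<dots> \<le> real n * (e 0 * smooth_tail (k 0) a b n (x + h 0) (y + h 0))"
        unfolding e_def by (intro mult_left_mono tail_exp_bounds(1)[OF k(1) ab k(2,3)]) simp
      also have "\<dots> \<le> e 0 * C"
        using mult_left_mono[OF C[OF that], of "e 0"] e[of 0] by (simp add: mult_ac)
      finally show ?thesis using k(3)[of 0] by (simp add: pos_le_divide_eq mult.commute)
    qed
    then show ?thesis by blast
  qed
  then obtain C where C: "\<And>n x y. n > 0 \<Longrightarrow> real n * tail_exp a b n x y \<le> C" by blast
  let ?l = "2 * pi / (sqrt disc * a * b)"
  show ?thesis
  proof (rule tendsto_sandwich_family)
    fix j n :: nat assume n: "n > 0"
    have "(m j)\<^sup>2 * (real n * ?u n) = real n * ((m j)\<^sup>2 * ?u n)" by simp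
    also have "\<dots> \<le> real n * ((m j)\<^sup>2 * tail_exp a b n 0 0)"
      by (intro mult_left_mono le) auto
    also have "\<dots> \<le> real n * (e j * smooth_tail (k j) a b n (0 + h j) (0 + h j))"
      unfolding e_def by (intro mult_left_mono tail_exp_bounds(1)[OF k(1) ab k(2,3)]) simp
    finally show "real n * ?u n \<le> e j / (m j)\<^sup>2 * (real n * smooth_tail (k j) a b n (h j) (h j))"
      using k(3)[of j] by (simp add: field_simps)
    have "smooth_tail (k j) a b n (- h j) (- h j) \<le> e j * (m j)\<^sup>2 * open_tail_exp a b n + ((2 * pi)\<^sup>2 - (m j)\<^sup>2) * (C / real n)"
      unfolding e_def
      by (rule tail_exp_bounds(2)[OF k(1) ab k(2,3)]) (use C[OF n] n in \<open>simp add: pos_le_divide_eq mult.commute\<close>)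
    also have "\<dots> \<le> e j * (m j)\<^sup>2 * ?u n + ((2 * pi)\<^sup>2 - (m j)\<^sup>2) * (C / real n)"
      using e[of j] by (intro add_right_mono mult_left_mono le) auto
    finally have "real n * smooth_tail (k j) a b n (- h j) (- h j) \<le> real n * (e j * (m j)\<^sup>2 * ?u n + ((2 * pi)\<^sup>2 - (m j)\<^sup>2) * (C / real n))"
      by (intro mult_left_mono) auto
    also have "\<dots> = (e j * (m j)\<^sup>2) * (real n * ?u n) + ((2 * pi)\<^sup>2 - (m j)\<^sup>2) * C"
      using n by (simp add: distrib_left)
    finally have "real n * smooth_tail (k j) a b n (- h j) (- h j) - ((2 * pi)\<^sup>2 - (m j)\<^sup>2) * C \<le> (real n * ?u n) * (e j * (m j)\<^sup>2)"
      by (simp add: mult.commute)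
    moreover have "0 < e j * (m j)\<^sup>2" using e[of j] k(3)[of j] by simp
    ultimately show "(real n * smooth_tail (k j) a b n (- h j) (- h j) - ((2 * pi)\<^sup>2 - (m j)\<^sup>2) * C) / (e j * (m j)\<^sup>2) \<le> real n * ?u n"
      by (simp only: pos_divide_le_eq)
  next
    fix j
    show "(\<lambda>n. e j / (m j)\<^sup>2 * (real n * smooth_tail (k j) a b n (h j) (h j))) \<longlonglongrightarrow> e j / (m j)\<^sup>2 * ?l"
      by (intro tendsto_mult tendsto_const smooth_tail_asymp(2)[OF k(1) ab])
    show "(\<lambda>n. (real n * smooth_tail (k j) a b n (- h j) (- h j) - ((2 * pi)\<^sup>2 - (m j)\<^sup>2) * C) / (e j * (m j)\<^sup>2)) \<longlonglongrightarrow>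
        (?l - ((2 * pi)\<^sup>2 - (m j)\<^sup>2) * C) / (e j * (m j)\<^sup>2)"
      using e[of j] k(3)[of j] by (intro tendsto_divide tendsto_diff tendsto_const smooth_tail_asymp(2)[OF k(1) ab]) auto
  next
    have "(\<lambda>j. e j / (m j)\<^sup>2 * ?l) \<longlonglongrightarrow> 1 / (2 * pi)\<^sup>2 * ?l"
      by (intro tendsto_intros elim mlim) simp
    also have "1 / (2 * pi)\<^sup>2 * ?l = 1 / (2 * pi * sqrt disc * a * b)"
      by (simp add: power2_eq_square)
    finally show "(\<lambda>j. e j / (m j)\<^sup>2 * ?l) \<longlonglongrightarrow> 1 / (2 * pi * sqrt disc * a * b)" .
    have "(\<lambda>j. (?l - ((2 * pi)\<^sup>2 - (m j)\<^sup>2) * C) / (e j * (m j)\<^sup>2)) \<longlonglongrightarrow> (?l - ((2 * pi)\<^sup>2 - (2 * pi)\<^sup>2) * C) / (1 * (2 * pi)\<^sup>2)"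
      by (intro tendsto_intros elim mlim) simp
    also have "(?l - ((2 * pi)\<^sup>2 - (2 * pi)\<^sup>2) * C) / (1 * (2 * pi)\<^sup>2) = 1 / (2 * pi * sqrt disc * a * b)"
      by (simp add: power2_eq_square)
    finally show "(\<lambda>j. (?l - ((2 * pi)\<^sup>2 - (m j)\<^sup>2) * C) / (e j * (m j)\<^sup>2)) \<longlonglongrightarrow> 1 / (2 * pi * sqrt disc * a * b)" .
  qed
qed

end

section \<open>Stirling's formula for the Gamma function\<close>

text \<open>The subtracted term behaves like v^2 / 2 near 0 and grows linearly for large v, which is
  what a dominating function for Laplace's method requires. For v < 0 the stronger bound v - v^2 / 2
  holds.\<close>

lemma ln_add_one_le:
  fixes v :: real
  assumes "- 1 < v"
  shows "ln (1 + v) \<le> v - v\<^sup>2 / (2 * (1 + \<bar>v\<bar>))"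
proof (cases "0 \<le> v")
  case True
  let ?f = "\<lambda>v::real. v - v\<^sup>2 / (2 * (1 + v)) - ln (1 + v)"
  have "?f 0 \<le> ?f v"
  proof (rule DERIV_nonneg_imp_nondecreasing[OF True])
    fix x :: real assume x: "0 \<le> x" "x \<le> v"
    have "(?f has_real_derivative x\<^sup>2 / (2 * (1 + x)\<^sup>2)) (at x)"
    proof -
      define y where "y = 1 + x"
      have y: "x = y - 1" "0 < y" using x by (auto simp: y_def)
      have "(?f has_real_derivative 1 - ((2 * x) * (2 * (1 + x)) - x\<^sup>2 * 2) / (2 * (1 + x))\<^sup>2 - 1 / (1 + x)) (at x)"
        using x by (auto intro!: derivative_eq_intros simp: power2_eq_square)
      moreover have "1 - ((2 * x) * (2 * (1 + x)) - x\<^sup>2 * 2) / (2 * (1 + x))\<^sup>2 - 1 / (1 + x) = x\<^sup>2 / (2 * (1 + x)\<^sup>2)"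
        unfolding y(1) using y(2) by (simp add: field_simps power2_eq_square)
      ultimately show ?thesis by (rule DERIV_cong)
    qed
    then show "\<exists>y. (?f has_real_derivative y) (at x) \<and> 0 \<le> y"
      by (intro exI[of _ "x\<^sup>2 / (2 * (1 + x)\<^sup>2)"]) auto
  qed
  then show ?thesis using True by simp
next
  case False
  let ?f = "\<lambda>v::real. v - v\<^sup>2 / 2 - ln (1 + v)"
  have "?f 0 \<le> ?f v"
  proof (rule DERIV_nonpos_imp_nonincreasing[where f="?f" and a=v and b=0])
    show "v \<le> 0" using False by simp
  next
    fix x :: real assume x: "v \<le> x" "x \<le> 0"
    have "(?f has_real_derivative - x\<^sup>2 / (1 + x)) (at x)"
      using x assms by (auto intro!: derivative_eq_intros simp: field_simps power2_eq_square)
    then show "\<exists>y. (?f has_real_derivative y) (at x) \<and> y \<le> 0"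
      using x assms by (intro exI[of _ "- x\<^sup>2 / (1 + x)"]) (auto intro!: divide_nonpos_pos)
  qed
  then have "ln (1 + v) \<le> v - v\<^sup>2 / 2" by simp
  also have "\<dots> \<le> v - v\<^sup>2 / (2 * (1 + \<bar>v\<bar>))"
    using frac_le[of "v\<^sup>2" "v\<^sup>2" 2 "2 * (1 + \<bar>v\<bar>)"] by simp
  finally show ?thesis .
qed

lemma nn_integral_Gamma:
  assumes "0 < x"
  shows "(\<integral>\<^sup>+t. ennreal (t powr (x - 1) * exp (- t)) * indicator {0..} t \<partial>lborel) = ennreal (Gamma x)"
proof -
  have "(\<integral>\<^sup>+t. ennreal (indicator {0..} t * (t powr (x - 1) / exp t)) \<partial>lborel) = ennreal (Gamma x)"
    by (rule nn_integral_has_integral_lebesgue[OF _ Gamma_integral_real[OF assms]]) auto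
  also have "(\<integral>\<^sup>+t. ennreal (indicator {0..} t * (t powr (x - 1) / exp t)) \<partial>lborel) =
      (\<integral>\<^sup>+t. ennreal (t powr (x - 1) * exp (- t)) * indicator {0..} t \<partial>lborel)"
    by (intro nn_integral_cong) (auto simp: exp_minus field_simps split: split_indicator)
  finally show ?thesis .
qed

text \<open>The integrand t^x exp (- t) of Gamma (x + 1), divided by its maximum x^x exp (- x), in
  the variable t = x + sqrt x * u; positive t becomes u > - sqrt x.\<close>

definition laplace_integrand :: "real \<Rightarrow> real \<Rightarrow> real" where
  "laplace_integrand x u = (if - sqrt x < u then exp (x * ln (1 + u / sqrt x) - sqrt x * u) else 0)"

lemma laplace_integrand_nonneg: "0 \<le> laplace_integrand x u"
  by (simp add: laplace_integrand_def)

lemma laplace_integrand_measurable [measurable]: "laplace_integrand x \<in> borel_measurable borel"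
  unfolding laplace_integrand_def by measurable

text \<open>For x \<ge> 1 the quotient |u / sqrt x| is at most |u|, which frees the bound of
  \<open>ln_add_one_le\<close> from x; then u^2 / (1 + |u|) \<ge> |u| - 1.\<close>

lemma laplace_integrand_le:
  assumes "1 \<le> x"
  shows "laplace_integrand x u \<le> exp (1 / 2) * exp (- (\<bar>u\<bar> / 2))"
proof (cases "- sqrt x < u")
  case True
  let ?s = "sqrt x"
  have s: "1 \<le> ?s" "?s * ?s = x" using assms by auto
  let ?v = "u / ?s"
  have v: "- 1 < ?v" using True s by (simp add: field_simps)
  have "x * ln (1 + ?v) - ?s * u \<le> x * (?v - ?v\<^sup>2 / (2 * (1 + \<bar>?v\<bar>))) - ?s * u"
    using ln_add_one_le[OF v] assms by (intro diff_right_mono mult_left_mono) auto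
  also have "\<dots> = - (u\<^sup>2 / (2 * (1 + \<bar>?v\<bar>)))"
  proof -
    have "x * ?v = ?s * u" "x * ?v\<^sup>2 = u\<^sup>2" using s by (auto simp: field_simps power2_eq_square)
    then show ?thesis by (simp add: right_diff_distrib)
  qed
  also have "\<dots> \<le> - (u\<^sup>2 / (2 * (1 + \<bar>u\<bar>)))"
  proof -
    have "\<bar>?v\<bar> \<le> \<bar>u\<bar>" using s by (simp add: divide_le_eq mult_le_cancel_left1)
    then have "u\<^sup>2 / (2 * (1 + \<bar>u\<bar>)) \<le> u\<^sup>2 / (2 * (1 + \<bar>?v\<bar>))"
      by (intro divide_left_mono) (auto intro!: mult_pos_pos add_pos_nonneg)
    then show ?thesis by simp
  qed
  also have "\<dots> \<le> 1 / 2 + - (\<bar>u\<bar> / 2)"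
  proof -
    have "(\<bar>u\<bar> - 1) * (\<bar>u\<bar> + 1) \<le> u\<^sup>2" by (simp add: algebra_simps power2_eq_square)
    then have "(\<bar>u\<bar> - 1) \<le> u\<^sup>2 / (1 + \<bar>u\<bar>)" by (simp add: pos_le_divide_eq add_pos_nonneg add.commute)
    then show ?thesis by (simp add: field_simps)
  qed
  finally have "exp (x * ln (1 + ?v) - ?s * u) \<le> exp (1 / 2 + - (\<bar>u\<bar> / 2))" by simp
  then show ?thesis using True by (simp only: laplace_integrand_def if_True exp_add)
qed (simp add: laplace_integrand_def)

lemma integrable_exp_abs:
  assumes "0 < c"
  shows "integrable lborel (\<lambda>u::real. exp (- (c * \<bar>u\<bar>)))"
proof -
  have "integrable lborel (\<lambda>x::real. indicator {0<..} x *\<^sub>R exp (- (x * c)))"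
    using integrable_I0i_exp_mscale[OF assms] unfolding set_integrable_def by simp
  then have 1: "integrable lborel (\<lambda>x::real. indicator {0<..} x * exp (- (c * \<bar>x\<bar>)))"
    by (rule Bochner_Integration.integrable_cong[THEN iffD1, rotated -1]) (auto simp: indicator_def mult.commute)
  have 2: "integrable lborel (\<lambda>x::real. indicator {0<..} (0 + (- 1) * x) * exp (- (c * \<bar>0 + (- 1) * x\<bar>)))"
    by (rule lborel_integrable_real_affine[OF 1]) simp
  show ?thesis
    using AE_lborel_singleton[of "0::real"]
    by (intro integrable_cong_AE_imp[OF Bochner_Integration.integrable_add[OF 1 2]])
       (auto simp: indicator_def elim!: eventually_mono)
qed

lemma laplace_integral_tendsto: "((\<lambda>x. \<integral>u. laplace_integrand x u \<partial>lborel) \<longlongrightarrow> sqrt (2 * pi)) at_top"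
proof -
  have "((\<lambda>x. \<integral>u. laplace_integrand x u \<partial>lborel) \<longlongrightarrow> (\<integral>u. exp (- u\<^sup>2 / 2) \<partial>lborel)) at_top"
  proof (rule integral_dominated_convergence_at_top[where w="\<lambda>u. exp (1 / 2) * exp (- (\<bar>u\<bar> / 2))"])
    show "\<forall>\<^sub>F x in at_top. AE u in lborel. norm (laplace_integrand x u) \<le> exp (1 / 2) * exp (- (\<bar>u\<bar> / 2))"
      using eventually_ge_at_top[of 1]
      by eventually_elim (use laplace_integrand_le in \<open>auto simp: laplace_integrand_def\<close>)
    show "AE u in lborel. ((\<lambda>x. laplace_integrand x u) \<longlongrightarrow> exp (- u\<^sup>2 / 2)) at_top"
    proof (rule AE_I2)
      fix u :: real
      have "((\<lambda>x. exp (x * ln (1 + u / sqrt x) - sqrt x * u)) \<longlongrightarrow> exp (- (u * u / 2))) at_top"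
        by real_asymp
      then have "((\<lambda>x. exp (x * ln (1 + u / sqrt x) - sqrt x * u)) \<longlongrightarrow> exp (- u\<^sup>2 / 2)) at_top"
        by (simp add: power2_eq_square)
      moreover have "\<forall>\<^sub>F x in at_top. - sqrt x < u"
        by real_asymp
      then have "\<forall>\<^sub>F x in at_top. exp (x * ln (1 + u / sqrt x) - sqrt x * u) = laplace_integrand x u"
        by eventually_elim (simp add: laplace_integrand_def)
      ultimately show "((\<lambda>x. laplace_integrand x u) \<longlongrightarrow> exp (- u\<^sup>2 / 2)) at_top"
        by (rule Lim_transform_eventually)
    qed
  qed (use integrable_exp_abs[of "1 / 2"] in auto)
  also have "(\<integral>u. exp (- u\<^sup>2 / 2) \<partial>lborel) = sqrt (2 * pi)"
  proof -
    have "(\<integral>u. exp (- u\<^sup>2 / 2) \<partial>lborel) = (\<integral>u. sqrt (2 * pi) * std_normal_density u \<partial>lborel)"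
      by (simp add: std_normal_density_def)
    then show ?thesis by simp
  qed
  finally show ?thesis .
qed

lemma Gamma_eq_laplace:
  assumes "1 \<le> x"
  shows "Gamma (x + 1) = sqrt x * (x powr x * exp (- x)) * (\<integral>u. laplace_integrand x u \<partial>lborel)"
proof -
  let ?s = "sqrt x"
  have s: "0 < ?s" "?s * ?s = x" using assms by auto
  have int: "integrable lborel (laplace_integrand x)"
    by (rule Bochner_Integration.integrable_bound[where f="\<lambda>u. exp (1 / 2) * exp (- (\<bar>u\<bar> / 2))"])
       (use laplace_integrand_le[OF assms] integrable_exp_abs[of "1 / 2"] in \<open>auto simp: laplace_integrand_def\<close>)
  have "ennreal (Gamma (x + 1)) = (\<integral>\<^sup>+t. ennreal (t powr x * exp (- t)) * indicator {0..} t \<partial>lborel)"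
    using nn_integral_Gamma[of "x + 1"] assms by simp
  also have "\<dots> = (\<integral>\<^sup>+t. ennreal (t powr x * exp (- t)) * indicator {0<..} t \<partial>lborel)"
    using AE_lborel_singleton[of "0::real"] by (intro nn_integral_cong_AE) (auto elim!: eventually_mono split: split_indicator)
  also have "\<dots> = ennreal ?s * (\<integral>\<^sup>+u. ennreal ((x + ?s * u) powr x * exp (- (x + ?s * u))) * indicator {0<..} (x + ?s * u) \<partial>lborel)"
    using s by (subst nn_integral_real_affine[where c="?s" and t=x]) auto
  also have "(\<integral>\<^sup>+u. ennreal ((x + ?s * u) powr x * exp (- (x + ?s * u))) * indicator {0<..} (x + ?s * u) \<partial>lborel) =
      (\<integral>\<^sup>+u. ennreal (x powr x * exp (- x)) * ennreal (laplace_integrand x u) \<partial>lborel)"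
  proof (rule nn_integral_cong)
    fix u
    have eq: "x + ?s * u = x * (1 + u / ?s)" using s by (simp add: field_simps)
    have iff: "0 < x + ?s * u \<longleftrightarrow> - ?s < u"
      using s mult_less_cancel_left_pos[OF s(1), of "- ?s" u] by auto
    show "ennreal ((x + ?s * u) powr x * exp (- (x + ?s * u))) * indicator {0<..} (x + ?s * u) =
        ennreal (x powr x * exp (- x)) * ennreal (laplace_integrand x u)"
    proof (cases "- ?s < u")
      case True
      then have "0 < x * (1 + u / ?s)" using iff eq by simp
      then have pos: "0 < 1 + u / ?s" using assms by (simp add: zero_less_mult_iff)
      have "(x + ?s * u) powr x * exp (- (x + ?s * u)) = (x powr x * exp (- x)) * exp (x * ln (1 + u / ?s) - ?s * u)"
        unfolding eq[symmetric] using assms pos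
        by (subst eq, subst powr_mult) (simp_all add: powr_def exp_diff exp_minus exp_add field_simps)
      then show ?thesis using True iff by (simp add: laplace_integrand_def ennreal_mult[symmetric])
    next
      case False
      then show ?thesis using iff by (simp add: laplace_integrand_def)
    qed
  qed
  also have "\<dots> = ennreal (x powr x * exp (- x)) * ennreal (\<integral>u. laplace_integrand x u \<partial>lborel)"
    by (subst nn_integral_cmult) (simp_all add: nn_integral_eq_integral[OF int] laplace_integrand_nonneg)
  finally have eq: "ennreal (Gamma (x + 1)) = ennreal ?s * (ennreal (x powr x * exp (- x)) * ennreal (\<integral>u. laplace_integrand x u \<partial>lborel))" .
  have nonneg: "0 \<le> (\<integral>u. laplace_integrand x u \<partial>lborel)"
    by (intro integral_nonneg_AE) (auto simp: laplace_integrand_nonneg)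
  have "ennreal (Gamma (x + 1)) = ennreal (?s * (x powr x * exp (- x)) * (\<integral>u. laplace_integrand x u \<partial>lborel))"
    using s nonneg unfolding eq mult.assoc
    by (subst ennreal_mult[symmetric], simp, simp, subst ennreal_mult[symmetric]) (simp_all add: mult.assoc)
  moreover note nonneg
  moreover have "0 \<le> Gamma (x + 1)" using assms by (intro less_imp_le Gamma_real_pos) simp
  ultimately show ?thesis using s by (subst (asm) ennreal_inj) auto
qed

text \<open>Formulated for a real argument because it is applied at n / p.\<close>

lemma Gamma_stirling:
  "((\<lambda>x. Gamma (x + 1) * exp x / (x powr x * sqrt (2 * pi * x))) \<longlongrightarrow> 1) at_top"
proof -
  have "((\<lambda>x. (\<integral>u. laplace_integrand x u \<partial>lborel) / sqrt (2 * pi)) \<longlongrightarrow> sqrt (2 * pi) / sqrt (2 * pi)) at_top"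
    by (intro tendsto_divide tendsto_const laplace_integral_tendsto) simp
  then show ?thesis
  proof (rule Lim_transform_eventually[rotated, THEN tendsto_eq_rhs, rotated])
    show "\<forall>\<^sub>F x in at_top. (\<integral>u. laplace_integrand x u \<partial>lborel) / sqrt (2 * pi) =
        Gamma (x + 1) * exp x / (x powr x * sqrt (2 * pi * x))"
      using eventually_ge_at_top[of 1]
    proof eventually_elim
      case (elim x)
      have "Gamma (x + 1) * exp x = sqrt x * x powr x * (exp (- x) * exp x) * (\<integral>u. laplace_integrand x u \<partial>lborel)"
        unfolding Gamma_eq_laplace[OF elim] by (simp only: mult_ac)
      then show ?case
        using elim by (simp add: exp_add[symmetric] real_sqrt_mult field_simps)
    qed
  qed simp
qed

section \<open>Volumes of sublevel sets of power sums\<close>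

definition psum :: "nat \<Rightarrow> real \<Rightarrow> (nat \<Rightarrow> real) \<Rightarrow> real" where
  "psum n r x = (\<Sum>i<n. \<bar>x i\<bar> powr r)"

lemma psum_nonneg [simp]: "0 \<le> psum n r x"
  by (simp add: psum_def sum_nonneg)

lemma psum_measurable [measurable]: "psum n r \<in> borel_measurable (lebn n)"
  unfolding psum_def lebn_def by measurable

lemma product_sigma_finite_lborel: "product_sigma_finite (\<lambda>_::nat. lborel :: real measure)"
  by unfold_locales

lemma sigma_finite_lebn: "sigma_finite_measure (lebn n)"
  unfolding lebn_def
  using product_sigma_finite.sigma_finite[OF product_sigma_finite_lborel] by blast

text \<open>Restricted to the index set, so that the result is again an extensional function and
  hence a point of \<open>lebn n\<close>.\<close>

definition dilate :: "nat \<Rightarrow> real \<Rightarrow> (nat \<Rightarrow> real) \<Rightarrow> nat \<Rightarrow> real" where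
  "dilate n c x = (\<lambda>i\<in>{..<n}. c * x i)"

lemma dilate_measurable [measurable]: "dilate n c \<in> lebn n \<rightarrow>\<^sub>M lebn n"
  unfolding dilate_def lebn_def by measurable

lemma psum_dilate: "0 < c \<Longrightarrow> psum n r (dilate n c x) = c powr r * psum n r x"
  by (simp add: psum_def dilate_def abs_mult powr_mult sum_distrib_left)

lemma emeasure_lborel_scale:
  assumes "0 < c" and [measurable]: "A \<in> sets borel"
  shows "ennreal c * emeasure lborel ((\<lambda>x. c * x) -` A) = emeasure lborel (A :: real set)"
proof -
  have "emeasure lborel A = (\<integral>\<^sup>+x. indicator A x \<partial>lborel)" by simp
  also have "\<dots> = ennreal c * (\<integral>\<^sup>+x. indicator A (0 + c * x) \<partial>lborel)"
    using assms by (subst nn_integral_real_affine[where c=c and t=0]) auto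
  also have "(\<integral>\<^sup>+x. indicator A (0 + c * x) \<partial>lborel) = (\<integral>\<^sup>+x. indicator ((\<lambda>x. c * x) -` A) x \<partial>lborel)"
    by (intro nn_integral_cong) (auto simp: indicator_def)
  also have "\<dots> = emeasure lborel ((\<lambda>x. c * x) -` A)"
    by (rule nn_integral_indicator) (use measurable_sets[of "\<lambda>x. c * x" lborel borel A] in simp)
  finally show ?thesis by simp
qed

lemma lebn_dilate:
  assumes "0 < c"
  shows "scale_measure (ennreal (c ^ n)) (distr (lebn n) (lebn n) (dilate n c)) = lebn n"
proof -
  interpret product_sigma_finite "\<lambda>_::nat. lborel :: real measure" by (rule product_sigma_finite_lborel)
  have "scale_measure (ennreal (c ^ n)) (distr (lebn n) (lebn n) (dilate n c)) = PiM {..<n} (\<lambda>_. lborel)"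
  proof (rule PiM_eqI)
    show "sets (scale_measure (ennreal (c ^ n)) (distr (lebn n) (lebn n) (dilate n c))) = sets (PiM {..<n} (\<lambda>_. lborel))"
      by (simp add: lebn_def)
    fix A :: "nat \<Rightarrow> real set" assume A: "\<And>i. i \<in> {..<n} \<Longrightarrow> A i \<in> sets lborel"
    then have box: "Pi\<^sub>E {..<n} A \<in> sets (lebn n)" unfolding lebn_def by (intro sets_PiM_I_finite) auto
    have "dilate n c -` Pi\<^sub>E {..<n} A \<inter> space (lebn n) = (\<Pi>\<^sub>E i\<in>{..<n}. (\<lambda>x. c * x) -` A i)"
      by (auto simp: dilate_def lebn_def space_PiM PiE_iff extensional_def)
    then have "emeasure (distr (lebn n) (lebn n) (dilate n c)) (Pi\<^sub>E {..<n} A) = emeasure (lebn n) (\<Pi>\<^sub>E i\<in>{..<n}. (\<lambda>x. c * x) -` A i)"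
      by (subst emeasure_distr[OF dilate_measurable box]) simp
    also have "\<dots> = (\<Prod>i<n. emeasure lborel ((\<lambda>x. c * x) -` A i))"
      unfolding lebn_def
      by (rule emeasure_PiM) (use A measurable_sets[of "\<lambda>x. c * x" lborel borel] in auto)
    finally have "emeasure (scale_measure (ennreal (c ^ n)) (distr (lebn n) (lebn n) (dilate n c))) (Pi\<^sub>E {..<n} A)
        = (\<Prod>i<n. ennreal c * emeasure lborel ((\<lambda>x. c * x) -` A i))"
      using assms by (simp add: prod.distrib ennreal_power)
    also have "\<dots> = (\<Prod>i<n. emeasure lborel (A i))"
      using A assms by (intro prod.cong refl emeasure_lborel_scale) auto
    finally show "emeasure (scale_measure (ennreal (c ^ n)) (distr (lebn n) (lebn n) (dilate n c))) (Pi\<^sub>E {..<n} A) = (\<Prod>i<n. emeasure lborel (A i))" .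
  qed simp
  then show ?thesis by (simp add: lebn_def)
qed

lemma emeasure_lebn_dilate:
  assumes "0 < c" "A \<in> sets (lebn n)"
  shows "emeasure (lebn n) A = ennreal (c ^ n) * emeasure (lebn n) {x \<in> space (lebn n). dilate n c x \<in> A}"
proof -
  have "emeasure (lebn n) A = emeasure (scale_measure (ennreal (c ^ n)) (distr (lebn n) (lebn n) (dilate n c))) A"
    by (simp add: lebn_dilate[OF assms(1)])
  also have "\<dots> = ennreal (c ^ n) * emeasure (lebn n) (dilate n c -` A \<inter> space (lebn n))"
    using assms(2) by (simp add: emeasure_distr)
  also have "dilate n c -` A \<inter> space (lebn n) = {x \<in> space (lebn n). dilate n c x \<in> A}" by auto
  finally show ?thesis .
qed

lemma measure_lebn_dilate:
  assumes "0 < c" "A \<in> sets (lebn n)"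
  shows "measure (lebn n) A = c ^ n * measure (lebn n) {x \<in> space (lebn n). dilate n c x \<in> A}"
  using assms by (simp add: measure_def emeasure_lebn_dilate[OF assms] enn2real_mult)

lemma emeasure_psum_le:
  assumes "0 < r" "0 < p"
  shows "emeasure (lebn n) {x \<in> space (lebn n). psum n p x \<le> r} =
    ennreal (r powr (real n / p)) * emeasure (lebn n) {x \<in> space (lebn n). psum n p x \<le> 1}"
proof -
  let ?c = "r powr (1 / p)"
  have c: "0 < ?c" "?c powr p = r" using assms by (simp_all add: powr_powr)
  have cn: "?c ^ n = r powr (real n / p)"
    using assms by (simp add: powr_powr powr_realpow[symmetric])
  have "dilate n ?c x \<in> space (lebn n)" if "x \<in> space (lebn n)" for x
    using measurable_space[OF dilate_measurable that] .
  then have "{x \<in> space (lebn n). dilate n ?c x \<in> {x \<in> space (lebn n). psum n p x \<le> r}} = {x \<in> space (lebn n). psum n p x \<le> 1}"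
    using c assms by (auto simp: psum_dilate mult_le_cancel_left1)
  then show ?thesis
    using emeasure_lebn_dilate[OF c(1), of "{x \<in> space (lebn n). psum n p x \<le> r}" n] unfolding cn by simp
qed

text \<open>Dirichlet's evaluation: writing exp (- S / p) as the integral of exp (- r) over r \<ge>
  S / p and exchanging the integrals leaves the volumes of sublevel sets. By homogeneity these are
  powers of r times the unit volume, so a Gamma integral remains.\<close>

lemma nn_integral_exp_psum:
  assumes "0 < p"
  shows "(\<integral>\<^sup>+y. ennreal (exp (- (\<bar>y\<bar> powr p) / p)) \<partial>lborel) ^ n =
    emeasure (lebn n) {x \<in> space (lebn n). psum n p x \<le> 1} * ennreal (p powr (real n / p) * Gamma (real n / p + 1))"
proof -
  interpret product_sigma_finite "\<lambda>_::nat. lborel :: real measure" by (rule product_sigma_finite_lborel)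
  interpret L: sigma_finite_measure "lebn n" by (rule sigma_finite_lebn)
  interpret pair_sigma_finite lborel "lebn n" ..
  let ?V = "emeasure (lebn n) {x \<in> space (lebn n). psum n p x \<le> 1}"
  have "(\<integral>\<^sup>+y. ennreal (exp (- (\<bar>y\<bar> powr p) / p)) \<partial>lborel) ^ n = (\<Prod>i<n. \<integral>\<^sup>+y. ennreal (exp (- (\<bar>y\<bar> powr p) / p)) \<partial>lborel)"
    by simp
  also have "\<dots> = (\<integral>\<^sup>+x. (\<Prod>i<n. ennreal (exp (- (\<bar>x i\<bar> powr p) / p))) \<partial>lebn n)"
    unfolding lebn_def by (subst product_nn_integral_prod) auto
  also have "\<dots> = (\<integral>\<^sup>+x. ennreal (exp (- psum n p x / p)) \<partial>lebn n)"
    by (intro nn_integral_cong) (simp add: prod_ennreal exp_sum[symmetric] psum_def sum_negf sum_divide_distrib)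
  also have "\<dots> = (\<integral>\<^sup>+x. \<integral>\<^sup>+r. ennreal (exp (- r)) * indicator {psum n p x / p..} r \<partial>lborel \<partial>lebn n)"
  proof (rule nn_integral_cong)
    fix x
    have "(\<integral>\<^sup>+r. ennreal (exp (- r)) * indicator {psum n p x / p..} r \<partial>lborel) = ennreal (0 - - exp (- (psum n p x / p)))"
      by (rule nn_integral_FTC_atLeast) (auto intro!: derivative_eq_intros, real_asymp)
    then show "ennreal (exp (- psum n p x / p)) = (\<integral>\<^sup>+r. ennreal (exp (- r)) * indicator {psum n p x / p..} r \<partial>lborel)"
      by simp
  qed
  also have "\<dots> = (\<integral>\<^sup>+x. \<integral>\<^sup>+r. ennreal (exp (- r)) * (if psum n p x / p \<le> r then 1 else 0) \<partial>lborel \<partial>lebn n)"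
    by (intro nn_integral_cong) (auto simp: indicator_def)
  also have "\<dots> = (\<integral>\<^sup>+r. \<integral>\<^sup>+x. ennreal (exp (- r)) * (if psum n p x / p \<le> r then 1 else 0) \<partial>lebn n \<partial>lborel)"
    by (rule Fubini') measurable
  also have "\<dots> = (\<integral>\<^sup>+r. ennreal (exp (- r)) * emeasure (lebn n) {x \<in> space (lebn n). psum n p x \<le> p * r} \<partial>lborel)"
  proof (rule nn_integral_cong)
    fix r :: real
    have "(\<integral>\<^sup>+x. ennreal (exp (- r)) * (if psum n p x / p \<le> r then 1 else 0) \<partial>lebn n) =
        (\<integral>\<^sup>+x. ennreal (exp (- r)) * indicator {x \<in> space (lebn n). psum n p x \<le> p * r} x \<partial>lebn n)"
      using assms by (intro nn_integral_cong) (auto simp: indicator_def divide_le_eq mult.commute)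
    also have "\<dots> = ennreal (exp (- r)) * emeasure (lebn n) {x \<in> space (lebn n). psum n p x \<le> p * r}"
      by (rule nn_integral_cmult_indicator) measurable
    finally show "(\<integral>\<^sup>+x. ennreal (exp (- r)) * (if psum n p x / p \<le> r then 1 else 0) \<partial>lebn n) = \<dots>" .
  qed
  also have "\<dots> = (\<integral>\<^sup>+r. ?V * ennreal (p powr (real n / p)) * (ennreal (r powr (real n / p + 1 - 1) * exp (- r)) * indicator {0..} r) \<partial>lborel)"
  proof (rule nn_integral_cong_AE)
    \<comment> \<open>The level r = 0 is left out: the scaling law requires a positive level, and
      for n = 0 the two sides differ there because \<open>0 powr 0 = 0\<close>.\<close>
    show "AE r in lborel. ennreal (exp (- r)) * emeasure (lebn n) {x \<in> space (lebn n). psum n p x \<le> p * r} =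
        ?V * ennreal (p powr (real n / p)) * (ennreal (r powr (real n / p + 1 - 1) * exp (- r)) * indicator {0..} r)"
      using AE_lborel_singleton[of "0::real"]
    proof eventually_elim
      case (elim r)
      show ?case
      proof (cases "0 < r")
        case True
        then show ?thesis
          using assms by (subst emeasure_psum_le) (simp_all add: powr_mult ennreal_mult mult_ac)
      next
        case False
        then have r: "p * r < 0" using elim assms by (simp add: mult_pos_neg)
        have "\<not> psum n p x \<le> p * r" for x
          using psum_nonneg[of n p x] r by linarith
        then show ?thesis using False elim by simp
      qed
    qed
  qed
  also have "\<dots> = ?V * ennreal (p powr (real n / p)) * ennreal (Gamma (real n / p + 1))"
    using assms by (subst nn_integral_cmult, simp, subst nn_integral_Gamma) (auto intro!: add_nonneg_pos)
  finally show ?thesis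
    using assms by (simp add: ennreal_mult mult.assoc add_nonneg_pos Gamma_real_pos less_imp_le)
qed

text \<open>The case n = 1 of \<open>nn_integral_exp_psum\<close>, where the unit set is the
  interval [-1, 1] of length 2. This shows that \<open>f_p\<close> is normalized.\<close>

lemma nn_integral_exp_powr:
  assumes "0 < p"
  shows "(\<integral>\<^sup>+y. ennreal (exp (- (\<bar>y\<bar> powr p) / p)) \<partial>lborel) = ennreal (2 * p powr (1 / p) * Gamma (1 + 1 / p))"
proof -
  interpret product_sigma_finite "\<lambda>_::nat. lborel :: real measure" by (rule product_sigma_finite_lborel)
  have iff: "\<bar>y\<bar> powr p \<le> 1 \<longleftrightarrow> y \<in> {-1..1}" for y :: real
  proof (cases "\<bar>y\<bar> \<le> 1")
    case True
    then have "\<bar>y\<bar> powr p \<le> 1 powr p" using assms by (intro powr_mono2) auto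
    then show ?thesis using True by (auto simp: abs_le_iff)
  next
    case False
    then have "1 powr p < \<bar>y\<bar> powr p" using assms by (intro powr_less_mono2) auto
    moreover have "y \<notin> {-1..1}" using False by (simp only: abs_le_iff atLeastAtMost_iff) linarith
    ultimately show ?thesis by simp
  qed
  have "{x \<in> space (lebn 1). psum 1 p x \<le> 1} = (\<Pi>\<^sub>E i\<in>{..<1}. {-1..1})"
  proof (rule set_eqI)
    fix x :: "nat \<Rightarrow> real"
    have L: "{..<1::nat} = {0}" by auto
    show "x \<in> {x \<in> space (lebn 1). psum 1 p x \<le> 1} \<longleftrightarrow> x \<in> (\<Pi>\<^sub>E i\<in>{..<1}. {-1..1})"
      unfolding PiE_iff lebn_def space_PiM mem_Collect_eq psum_def L using iff[of "x 0"]
      by (auto simp del: atLeastAtMost_iff)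
  qed
  moreover have "emeasure (lebn 1) (\<Pi>\<^sub>E i\<in>{..<1::nat}. {-1..1}) = ennreal 2"
    unfolding lebn_def by (subst emeasure_PiM) simp_all
  ultimately have "(\<integral>\<^sup>+y. ennreal (exp (- (\<bar>y\<bar> powr p) / p)) \<partial>lborel) = ennreal 2 * ennreal (p powr (1 / p) * Gamma (1 / p + 1))"
    using nn_integral_exp_psum[OF assms, of 1] by (simp only: power_one_right of_nat_1)
  also have "\<dots> = ennreal (2 * (p powr (1 / p) * Gamma (1 / p + 1)))"
    using assms by (intro ennreal_mult[symmetric] mult_nonneg_nonneg less_imp_le[OF Gamma_real_pos] add_pos_pos) auto
  finally show ?thesis
    by (simp only: add.commute[of 1] mult.assoc)
qed

definition norm_const :: "real \<Rightarrow> real" where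
  "norm_const p = 2 * p powr (1 / p) * Gamma (1 + 1 / p)"

lemma norm_const_pos: "0 < p \<Longrightarrow> 0 < norm_const p"
  by (simp add: norm_const_def add_pos_pos Gamma_real_pos)

lemma emeasure_psum_le_eq:
  assumes "0 < p" "0 < r"
  shows "emeasure (lebn n) {x \<in> space (lebn n). psum n p x \<le> r} =
    ennreal (norm_const p ^ n * (r / p) powr (real n / p) / Gamma (real n / p + 1))"
proof -
  let ?V = "emeasure (lebn n) {x \<in> space (lebn n). psum n p x \<le> 1}"
  let ?G = "p powr (real n / p) * Gamma (real n / p + 1)"
  have G: "0 < ?G" using assms by (intro mult_pos_pos Gamma_real_pos) (auto intro!: add_nonneg_pos)
  have "ennreal (norm_const p ^ n) = ?V * ennreal ?G"
    using nn_integral_exp_psum[OF assms(1), of n] nn_integral_exp_powr[OF assms(1)] norm_const_pos[OF assms(1)]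
    by (simp add: norm_const_def ennreal_power)
  then have "ennreal (norm_const p ^ n) / ennreal ?G = ?V"
  proof -
    have "ennreal ?G \<noteq> 0" using G by (simp only: ennreal_eq_0_iff not_le)
    then show ?thesis
      unfolding \<open>ennreal (norm_const p ^ n) = ?V * ennreal ?G\<close> by (rule mult_divide_eq_ennreal) simp
  qed
  then have V: "?V = ennreal (norm_const p ^ n / ?G)"
    using G norm_const_pos[OF assms(1)] by (simp add: divide_ennreal)
  have "emeasure (lebn n) {x \<in> space (lebn n). psum n p x \<le> r} = ennreal (r powr (real n / p) * (norm_const p ^ n / ?G))"
  proof -
    have "0 \<le> norm_const p ^ n / ?G"
      using G norm_const_pos[OF assms(1)] by (intro divide_nonneg_pos) auto
    then show ?thesis
      by (simp only: emeasure_psum_le[OF assms(2,1)] V ennreal_mult[OF powr_ge_zero])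
  qed
  also have "r powr (real n / p) * (norm_const p ^ n / ?G) = norm_const p ^ n * (r / p) powr (real n / p) / Gamma (real n / p + 1)"
    using assms by (simp add: powr_divide)
  finally show ?thesis .
qed

section \<open>From norms on the ball to power sums\<close>

lemma less_powr_inverse_iff:
  assumes "0 < q" "0 < z" "0 \<le> (s::real)"
  shows "z < s powr (1 / q) \<longleftrightarrow> z powr q < s"
proof
  assume "z < s powr (1 / q)"
  then have "z powr q < (s powr (1 / q)) powr q" using assms by (intro powr_less_mono2) auto
  then show "z powr q < s" using assms by (simp add: powr_powr)
next
  assume "z powr q < s"
  then have "(z powr q) powr (1 / q) < s powr (1 / q)" using assms by (intro powr_less_mono2) auto
  then show "z < s powr (1 / q)" using assms by (simp add: powr_powr)
qed

lemma lnorm_le_one_iff: "0 < p \<Longrightarrow> lnorm n p x \<le> 1 \<longleftrightarrow> psum n p x \<le> 1"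
  unfolding lnorm_def psum_def[symmetric]
  using less_powr_inverse_iff[of p 1 "psum n p x"] by auto

lemma U_np_eq:
  assumes "0 < p" "0 < q" "0 < z" "0 < n"
  shows "U_np n p {x \<in> Ball_p n p. real n powr (1 / p - 1 / q) * lnorm n q x > z} =
    measure (lebn n) {x \<in> space (lebn n). psum n p x \<le> real n \<and> real n * z powr q < psum n q x} /
    measure (lebn n) {x \<in> space (lebn n). psum n p x \<le> real n}"
proof -
  let ?A = "{x \<in> Ball_p n p. real n powr (1 / p - 1 / q) * lnorm n q x > z}"
  let ?c = "real n powr (- 1 / p)"
  have c: "0 < ?c" using assms by simp
  have cp: "?c powr p = 1 / real n"
    unfolding powr_powr using assms by (simp add: powr_minus_divide)
  have Sp: "psum n p (dilate n ?c x) \<le> 1 \<longleftrightarrow> psum n p x \<le> real n" for x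
    unfolding psum_dilate[OF c] cp using assms by simp
  have sp: "dilate n ?c x \<in> space (lebn n)" if "x \<in> space (lebn n)" for x
    using measurable_space[OF dilate_measurable that] .
  have Sq: "real n powr (1 / p - 1 / q) * lnorm n q (dilate n ?c x) > z \<longleftrightarrow> real n * z powr q < psum n q x" for x
  proof -
    have "lnorm n q (dilate n ?c x) = ?c * psum n q x powr (1 / q)"
      unfolding lnorm_def psum_def[symmetric] psum_dilate[OF c] using assms c by (simp add: powr_mult powr_powr)
    then have "real n powr (1 / p - 1 / q) * lnorm n q (dilate n ?c x) = (real n powr (1 / p - 1 / q) * ?c) * psum n q x powr (1 / q)"
      by (simp only: mult.assoc)
    also have "real n powr (1 / p - 1 / q) * ?c = (1 / real n) powr (1 / q)"
    proof -
      have "real n powr (1 / p - 1 / q) * ?c = real n powr (- (1 / q))"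
        by (simp add: powr_add[symmetric])
      also have "\<dots> = (1 / real n) powr (1 / q)"
        using assms by (simp add: powr_divide powr_minus_divide)
      finally show ?thesis .
    qed
    also have "(1 / real n) powr (1 / q) * psum n q x powr (1 / q) = (psum n q x / real n) powr (1 / q)"
      using assms by (simp add: powr_mult[symmetric])
    finally show ?thesis
      using assms less_powr_inverse_iff[of q z "psum n q x / real n"] by (simp add: less_divide_eq mult.commute)
  qed
  have B: "Ball_p n p = {x \<in> space (lebn n). psum n p x \<le> 1}"
    using assms by (auto simp: Ball_p_def lnorm_le_one_iff)
  have A: "?A =
      {x \<in> space (lebn n). psum n p x \<le> 1 \<and> real n powr (1 / p - 1 / q) * (psum n q x powr (1 / q)) > z}"
    unfolding B by (auto simp: lnorm_def psum_def)
  have 1: "measure (lebn n) (Ball_p n p) = ?c ^ n * measure (lebn n) {x \<in> space (lebn n). psum n p x \<le> real n}"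
  proof -
    have "{x \<in> space (lebn n). dilate n ?c x \<in> Ball_p n p} = {x \<in> space (lebn n). psum n p x \<le> real n}"
      unfolding B using Sp sp by auto
    moreover have "Ball_p n p \<in> sets (lebn n)" unfolding B by measurable
    ultimately show ?thesis
      using measure_lebn_dilate[OF c, of "Ball_p n p" n] by (simp only:)
  qed
  have 2: "measure (lebn n) ?A =
      ?c ^ n * measure (lebn n) {x \<in> space (lebn n). psum n p x \<le> real n \<and> real n * z powr q < psum n q x}"
  proof -
    have "{x \<in> space (lebn n). dilate n ?c x \<in> ?A} =
        {x \<in> space (lebn n). psum n p x \<le> real n \<and> real n * z powr q < psum n q x}"
      unfolding B using Sp Sq sp by auto
    moreover have "?A \<in> sets (lebn n)"
      unfolding A by measurable
    ultimately show ?thesis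
      using measure_lebn_dilate[OF c, of "?A" n]
      by (simp only:)
  qed
  show ?thesis unfolding U_np_def 1 2 using c by simp
qed

section \<open>Exponential families on the line\<close>

lemma exp_remainder_le: "\<bar>exp u - 1 - u\<bar> \<le> u\<^sup>2 * exp \<bar>u\<bar>" for u :: real
proof -
  obtain t where t: "\<bar>t\<bar> \<le> \<bar>u\<bar>" "exp u = (\<Sum>m<2. u ^ m / fact m) + exp t / fact 2 * u ^ 2"
    using Maclaurin_exp_le[of u 2] by blast
  have "exp u - 1 - u = exp t / 2 * u\<^sup>2"
    unfolding t(2) by (simp add: numeral_2_eq_2)
  then have "\<bar>exp u - 1 - u\<bar> = \<bar>exp t / 2 * u\<^sup>2\<bar>" by (simp only:)
  also have "\<dots> = exp t / 2 * u\<^sup>2" by simp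
  also have "\<dots> \<le> exp \<bar>u\<bar> * u\<^sup>2"
  proof (rule mult_right_mono)
    have "exp t \<le> exp \<bar>u\<bar>" "0 < exp t" using t(1) by auto
    then show "exp t / 2 \<le> exp \<bar>u\<bar>" by linarith
  qed simp
  finally show ?thesis by (simp add: mult.commute)
qed

text \<open>The difference quotient misses the derivative by at most |h| times the integral in
  \<open>int2\<close>, by the second-order remainder of exp. Since T is nonnegative, the single
  exponent s + d dominates all perturbations with |h| \<le> d of either sign.\<close>

lemma has_real_derivative_integral_exp:
  fixes F T :: "'a \<Rightarrow> real"
  assumes [measurable]: "F \<in> borel_measurable M" "T \<in> borel_measurable M"
    and T: "\<And>y. 0 \<le> T y" and d: "0 < d"
    and int0: "\<And>h. \<bar>h\<bar> \<le> d \<Longrightarrow> integrable M (\<lambda>y. F y * exp ((s + h) * T y))"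
    and int1: "integrable M (\<lambda>y. F y * T y * exp (s * T y))"
    and int2: "integrable M (\<lambda>y. \<bar>F y\<bar> * (T y)\<^sup>2 * exp ((s + d) * T y))"
  shows "((\<lambda>s. \<integral>y. F y * exp (s * T y) \<partial>M) has_real_derivative (\<integral>y. F y * T y * exp (s * T y) \<partial>M)) (at s)"
proof -
  let ?I = "\<lambda>s. \<integral>y. F y * exp (s * T y) \<partial>M"
  let ?D = "\<integral>y. F y * T y * exp (s * T y) \<partial>M"
  let ?C = "\<integral>y. \<bar>F y\<bar> * (T y)\<^sup>2 * exp ((s + d) * T y) \<partial>M"
  have bound: "norm ((?I (s + h) - ?I s) / h - ?D) \<le> ?C * \<bar>h\<bar>" if h: "h \<noteq> 0" "\<bar>h\<bar> \<le> d" for h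
  proof -
    let ?R = "\<lambda>y. F y * exp ((s + h) * T y) - F y * exp (s * T y) - h * (F y * T y * exp (s * T y))"
    have i0: "integrable M (\<lambda>y. F y * exp (s * T y))" using int0[of 0] d by simp
    have ih: "integrable M (\<lambda>y. h * (F y * T y * exp (s * T y)))" using int1 by simp
    have eq: "?I (s + h) - ?I s - h * ?D = (\<integral>y. ?R y \<partial>M)"
      by (simp only: Bochner_Integration.integral_diff[OF Bochner_Integration.integrable_diff[OF int0[OF h(2)] i0] ih]
          Bochner_Integration.integral_diff[OF int0[OF h(2)] i0] integral_mult_right_zero)
    have "\<bar>\<integral>y. ?R y \<partial>M\<bar> \<le> (\<integral>y. h\<^sup>2 * (\<bar>F y\<bar> * (T y)\<^sup>2 * exp ((s + d) * T y)) \<partial>M)"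
    proof (rule order_trans[OF integral_abs_bound], rule integral_mono)
      show "integrable M (\<lambda>y. \<bar>?R y\<bar>)"
        by (intro integrable_abs Bochner_Integration.integrable_diff int0[OF h(2)] i0 ih)
      show "integrable M (\<lambda>y. h\<^sup>2 * (\<bar>F y\<bar> * (T y)\<^sup>2 * exp ((s + d) * T y)))" using int2 by simp
      fix y
      have "?R y =
          F y * exp (s * T y) * (exp (h * T y) - 1 - h * T y)"
        by (simp add: exp_add algebra_simps)
      then have "\<bar>?R y\<bar> =
          \<bar>F y\<bar> * exp (s * T y) * \<bar>exp (h * T y) - 1 - h * T y\<bar>"
        by (simp add: abs_mult)
      also have "\<dots> \<le> \<bar>F y\<bar> * exp (s * T y) * ((h * T y)\<^sup>2 * exp (d * T y))"
      proof (intro mult_left_mono)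
        have "\<bar>h * T y\<bar> \<le> d * T y" using h T[of y] by (simp add: abs_mult mult_right_mono)
        then show "\<bar>exp (h * T y) - 1 - h * T y\<bar> \<le> (h * T y)\<^sup>2 * exp (d * T y)"
          by (intro order_trans[OF exp_remainder_le] mult_left_mono) auto
      qed auto
      also have "\<dots> = h\<^sup>2 * (\<bar>F y\<bar> * (T y)\<^sup>2 * exp ((s + d) * T y))"
        by (simp add: exp_add power_mult_distrib distrib_right)
      finally show "\<bar>?R y\<bar> \<le>
          h\<^sup>2 * (\<bar>F y\<bar> * (T y)\<^sup>2 * exp ((s + d) * T y))" .
    qed
    then have le: "\<bar>?I (s + h) - ?I s - h * ?D\<bar> \<le> h\<^sup>2 * ?C"
      unfolding eq by (simp only: integral_mult_right_zero)
    have "(?I (s + h) - ?I s) / h - ?D = (?I (s + h) - ?I s - h * ?D) / h"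
      using h by (simp add: diff_divide_distrib)
    then have "norm ((?I (s + h) - ?I s) / h - ?D) = \<bar>?I (s + h) - ?I s - h * ?D\<bar> / \<bar>h\<bar>"
      by simp
    also have "\<dots> \<le> h\<^sup>2 * ?C / \<bar>h\<bar>" using le by (intro divide_right_mono) auto
    also have "\<dots> = ?C * \<bar>h\<bar>" using h by (simp add: power2_eq_square abs_if)
    finally show ?thesis .
  qed
  have "((\<lambda>h. (?I (s + h) - ?I s) / h - ?D) \<longlongrightarrow> 0) (at 0)"
  proof (rule Lim_null_comparison)
    show "\<forall>\<^sub>F h in at 0. norm ((?I (s + h) - ?I s) / h - ?D) \<le> ?C * \<bar>h\<bar>"
      unfolding eventually_at using d by (intro exI[of _ d]) (use bound in \<open>auto simp: dist_real_def\<close>)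
    show "((\<lambda>h. ?C * \<bar>h\<bar>) \<longlongrightarrow> 0) (at 0)"
      by (intro tendsto_mult_right_zero tendsto_rabs_zero tendsto_ident_at)
  qed
  then show ?thesis by (simp add: DERIV_def LIM_zero_iff)
qed

text \<open>Dividing by y instead of lowering the exponent carries the sign, so one formula serves
  both half-lines.\<close>

lemma DERIV_abs_powr:
  assumes "y \<noteq> 0"
  shows "((\<lambda>y::real. \<bar>y\<bar> powr r) has_real_derivative (r * \<bar>y\<bar> powr r / y)) (at y)"
proof (cases "0 < y")
  case True
  have "((\<lambda>y. y powr r) has_real_derivative (r * \<bar>y\<bar> powr r / y)) (at y)"
    using True by (auto intro!: derivative_eq_intros simp: powr_diff)
  then show ?thesis
    by (rule has_field_derivative_transform_within_open[where S="{0<..}"]) (use True in auto)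
next
  case False
  have "((\<lambda>y. (- y) powr r) has_real_derivative (r * \<bar>y\<bar> powr r / y)) (at y)"
    using False assms by (auto intro!: derivative_eq_intros simp: powr_diff)
  then show ?thesis
    by (rule has_field_derivative_transform_within_open[where S="{..<0}"]) (use False assms in auto)
qed

text \<open>Lets integration by parts pass through y = 0, where |y|^q has a corner if q = 1: the
  factor y restores differentiability.\<close>

lemma DERIV_mult_ident_0:
  fixes G :: "real \<Rightarrow> real"
  assumes "isCont G 0"
  shows "((\<lambda>y. y * G y) has_real_derivative G 0) (at 0)"
  unfolding CARAT_DERIV by (rule exI[of _ G]) (use assms in auto)

lemma AE_lborel_eq_imp_eq:
  fixes f g :: "real \<Rightarrow> 'b :: {t2_space, second_countable_topology}"
  assumes "AE y in lborel. f y = g y" "continuous_on UNIV f" "continuous_on UNIV g"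
  shows "f y = g y"
proof (rule ccontr)
  assume "f y \<noteq> g y"
  let ?S = "{y. f y \<noteq> g y}"
  have op: "open ?S" using open_Collect_neq[OF assms(2,3)] .
  then have "?S \<in> null_sets lborel"
    using assms(1) by (subst (asm) AE_iff_null) auto
  then have "negligible ?S"
    by (simp add: negligible_iff_null_sets null_sets_completionI)
  then show False using open_not_negligible[OF op] \<open>f y \<noteq> g y\<close> by auto
qed

lemma powr_le_epsilon:
  assumes "0 < q" "q < p" "0 < \<epsilon>"
  shows "\<exists>K\<ge>0. \<forall>u\<ge>0. (u::real) powr q \<le> \<epsilon> * u powr p + K"
proof -
  \<comment> \<open>The point where u^q and \<epsilon> u^p agree: beyond R the second dominates,
    below R the first is at most R^q.\<close>
  define R where "R = \<epsilon> powr (1 / (q - p))"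
  have R: "0 < R" "R powr (q - p) = \<epsilon>" using assms by (simp_all add: R_def powr_powr)
  have "u powr q \<le> \<epsilon> * u powr p + R powr q" if "0 \<le> u" for u
  proof (cases "u \<le> R")
    case True
    then have "u powr q \<le> R powr q" using assms that by (intro powr_mono2) auto
    moreover have "0 \<le> \<epsilon> * u powr p" using assms by simp
    ultimately show ?thesis by linarith
  next
    case False
    then have "u powr (q - p) \<le> R powr (q - p)" using assms R by (intro powr_mono2') auto
    then have "u powr (q - p) * u powr p \<le> \<epsilon> * u powr p" using R by (intro mult_right_mono) auto
    then show ?thesis using False R by (simp add: powr_add[symmetric] add_increasing2)
  qed
  then show ?thesis by (intro exI[of _ "R powr q"]) auto
qed

lemma power_le_exp:
  assumes "0 < c"
  shows "\<exists>K>0. \<forall>x\<ge>0. (1 + x) ^ k \<le> K * exp (c * x :: real)"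
proof (cases "k = 0")
  case True
  then show ?thesis using assms by (intro exI[of _ 1]) auto
next
  case False
  define e where "e = c / real k"
  have e: "0 < e" using assms False by (simp add: e_def)
  have "(1 + x) ^ k \<le> ((1 / e) ^ k * exp c) * exp (c * x)" if "0 \<le> x" for x
  proof -
    have "e * (1 + x) \<le> exp (e * (1 + x))" using exp_ge_add_one_self[of "e * (1 + x)"] by linarith
    then have "1 + x \<le> (1 / e) * exp (e * (1 + x))" using e by (simp add: pos_le_divide_eq mult.commute)
    then have "(1 + x) ^ k \<le> ((1 / e) * exp (e * (1 + x))) ^ k" using that by (intro power_mono) auto
    also have "\<dots> = (1 / e) ^ k * exp (real k * (e * (1 + x)))"
      by (simp only: power_mult_distrib exp_of_nat_mult)
    also have "real k * (e * (1 + x)) = c + c * x" using False by (simp add: e_def distrib_left)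
    finally show ?thesis by (simp add: exp_add mult.assoc)
  qed
  then show ?thesis using e by (intro exI[of _ "(1 / e) ^ k * exp c"]) auto
qed

section \<open>Moment integrals of the exponential family\<close>

locale exponents =
  fixes p q :: real
  assumes q_ge_1: "1 \<le> q" and q_less_p: "q < p"
begin

lemma pq_pos: "0 < q" "0 < p" "1 \<le> p"
  using q_ge_1 q_less_p by auto

text \<open>The indices i and j count factors |y|^q and |y|^p, so that derivatives in s and t merely
  raise an index.\<close>

definition G :: "nat \<Rightarrow> nat \<Rightarrow> real \<Rightarrow> real \<Rightarrow> real \<Rightarrow> real" where
  "G i j s t y = (\<bar>y\<bar> powr q) ^ i * (\<bar>y\<bar> powr p) ^ j * (exp (s * \<bar>y\<bar> powr q + t * \<bar>y\<bar> powr p) * f_p p y)"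

definition J :: "nat \<Rightarrow> nat \<Rightarrow> real \<Rightarrow> real \<Rightarrow> real" where
  "J i j s t = (\<integral>y. G i j s t y \<partial>lborel)"

lemma f_p_eq: "f_p p y = exp (- (\<bar>y\<bar> powr p) / p) / norm_const p"
  by (simp add: f_p_def norm_const_def)

lemma f_p_pos: "0 < f_p p y"
  using norm_const_pos[OF pq_pos(2)] by (simp add: f_p_eq)

lemma continuous_abs_powr [continuous_intros]: "0 < r \<Longrightarrow> continuous_on S (\<lambda>y::real. \<bar>y\<bar> powr r)"
  by (intro continuous_on_powr' continuous_intros) auto

lemma continuous_G: "continuous_on S (G i j s t)"
  unfolding G_def f_p_def using pq_pos norm_const_pos[OF pq_pos(2), unfolded norm_const_def]
  by (intro continuous_intros) auto

lemma G_measurable [measurable]: "G i j s t \<in> borel_measurable borel"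
  by (rule borel_measurable_continuous_onI[OF continuous_G])

lemma G_nonneg: "0 \<le> G i j s t y"
  using f_p_pos[of y] by (simp add: G_def)

lemma G_00_pos: "0 < G 0 0 s t y"
  using f_p_pos[of y] by (simp add: G_def)

lemma G_bound:
  assumes "t < 1 / p"
  shows "\<exists>C c. 0 < c \<and> (\<forall>y. G i j s t y \<le> C * exp (- (c * \<bar>y\<bar>)))"
proof -
  \<comment> \<open>The gap 1 / p - t is cut into thirds: one absorbs the powers, one absorbs s
    |y|^q (possible for every real s since q < p), and one remains as decay.\<close>
  define c where "c = (1 / p - t) / 3"
  have c: "0 < c" using assms by (simp add: c_def)
  obtain K where K: "0 \<le> K" "\<And>u. 0 \<le> u \<Longrightarrow> u powr q \<le> c / (\<bar>s\<bar> + 1) * u powr p + K"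
    using powr_le_epsilon[of q p "c / (\<bar>s\<bar> + 1)"] pq_pos q_less_p c by (auto simp: add_nonneg_pos)
  obtain K' where K': "0 < K'" "\<And>x. 0 \<le> x \<Longrightarrow> (1 + x) ^ (i + j) \<le> K' * exp (c * x)"
    using power_le_exp[OF c, of "i + j"] by blast
  let ?N = "norm_const p"
  have N: "0 < ?N" using norm_const_pos pq_pos by simp
  have "G i j s t y \<le> (K' * exp (\<bar>s\<bar> * K) * exp c / ?N) * exp (- (c * \<bar>y\<bar>))" for y
  proof -
    let ?A = "\<bar>y\<bar> powr q" and ?B = "\<bar>y\<bar> powr p"
    have AB: "0 \<le> ?A" "0 \<le> ?B" by auto
    have A1: "?A \<le> 1 + ?B" 
    proof (cases "\<bar>y\<bar> \<le> 1")
      case True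
      then have "?A \<le> 1 powr q" using pq_pos by (intro powr_mono2) auto
      then show ?thesis using AB by (simp add: add_increasing2)
    next
      case False
      then have "?A \<le> ?B" using q_less_p by (intro powr_mono) auto
      then show ?thesis by simp
    qed
    have B1: "\<bar>y\<bar> - 1 \<le> ?B"
    proof (cases "\<bar>y\<bar> \<le> 1")
      case True then show ?thesis using AB by linarith
    next
      case False
      then have "\<bar>y\<bar> powr 1 \<le> ?B" using pq_pos by (intro powr_mono) auto
      then show ?thesis using False by simp
    qed
    have "?A ^ i * ?B ^ j \<le> (1 + ?B) ^ i * (1 + ?B) ^ j"
      using A1 AB by (intro mult_mono power_mono) auto
    also have "\<dots> \<le> K' * exp (c * ?B)" using K'(2)[of ?B] by (simp add: power_add)
    finally have 1: "?A ^ i * ?B ^ j \<le> K' * exp (c * ?B)" .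
    have "s * ?A \<le> \<bar>s\<bar> * ?A" using AB by (intro mult_right_mono) auto
    also have "\<dots> \<le> \<bar>s\<bar> * (c / (\<bar>s\<bar> + 1) * ?B + K)" by (intro mult_left_mono K) auto
    also have "\<dots> = (\<bar>s\<bar> / (\<bar>s\<bar> + 1)) * (c * ?B) + \<bar>s\<bar> * K" by (simp add: distrib_left)
    also have "\<dots> \<le> 1 * (c * ?B) + \<bar>s\<bar> * K"
      using c AB by (intro add_right_mono mult_right_mono) auto
    finally have 2: "s * ?A \<le> c * ?B + \<bar>s\<bar> * K" by simp
    have tB: "t * ?B - ?B / p = - 3 * c * ?B"
      by (simp add: c_def algebra_simps)
    have "c * ?B + (s * ?A + t * ?B - ?B / p) \<le> \<bar>s\<bar> * K - c * ?B"
      using 2 tB by linarith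
    also have "\<dots> \<le> \<bar>s\<bar> * K + c + - (c * \<bar>y\<bar>)"
      using mult_left_mono[OF B1, of c] c by (simp add: right_diff_distrib)
    finally have 3: "exp (c * ?B + (s * ?A + t * ?B - ?B / p)) \<le> exp (\<bar>s\<bar> * K) * exp c * exp (- (c * \<bar>y\<bar>))"
      by (simp add: exp_add[symmetric])
    have "G i j s t y = (?A ^ i * ?B ^ j) * exp (s * ?A + t * ?B - ?B / p) / ?N"
      by (simp add: G_def f_p_eq exp_diff exp_minus field_simps)
    also have "\<dots> \<le> (K' * exp (c * ?B)) * exp (s * ?A + t * ?B - ?B / p) / ?N"
      using 1 N by (intro divide_right_mono mult_right_mono) auto
    also have "\<dots> = K' * exp (c * ?B + (s * ?A + t * ?B - ?B / p)) / ?N"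
      by (simp only: exp_add mult.assoc)
    also have "\<dots> \<le> K' * (exp (\<bar>s\<bar> * K) * exp c * exp (- (c * \<bar>y\<bar>))) / ?N"
      using 3 N K' by (intro divide_right_mono mult_left_mono) auto
    finally show ?thesis by simp
  qed
  then show ?thesis using c by blast
qed

lemma integrable_G:
  assumes "t < 1 / p"
  shows "integrable lborel (G i j s t)"
proof -
  obtain C c where C: "0 < c" "\<And>y. G i j s t y \<le> C * exp (- (c * \<bar>y\<bar>))"
    using G_bound[OF assms] by blast
  show ?thesis
    by (rule Bochner_Integration.integrable_bound[where f="\<lambda>y. C * exp (- (c * \<bar>y\<bar>))"])
       (use C integrable_exp_abs[OF C(1)] G_nonneg order_trans[OF G_nonneg C(2)] in \<open>auto intro!: AE_I2\<close>)
qed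

lemma J_00_pos: "t < 1 / p \<Longrightarrow> 0 < J 0 0 s t"
proof -
  assume t: "t < 1 / p"
  have "0 \<le> J 0 0 s t" unfolding J_def by (intro integral_nonneg_AE) (auto simp: G_nonneg)
  moreover have "J 0 0 s t \<noteq> 0"
  proof
    assume "J 0 0 s t = 0"
    then have "AE y in lborel. G 0 0 s t y = 0"
      unfolding J_def by (subst (asm) integral_nonneg_eq_0_iff_AE[OF integrable_G[OF t]]) (auto simp: G_nonneg)
    from AE_lborel_eq_imp_eq[OF this continuous_G continuous_on_const, of 0] show False
      using G_00_pos[of s t 0] by simp
  qed
  ultimately show ?thesis by simp
qed

lemma J_deriv_1:
  assumes t: "t < 1 / p"
  shows "((\<lambda>s. J i j s t) has_real_derivative J (Suc i) j s t) (at s)"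
proof -
  let ?F = "\<lambda>y. G i j 0 t y" and ?T = "\<lambda>y::real. \<bar>y\<bar> powr q"
  have eq: "?F y * exp (s * ?T y) = G i j s t y" for s y
    by (simp add: G_def exp_add mult_ac)
  have eq1: "?F y * ?T y * exp (s * ?T y) = G (Suc i) j s t y" for s y
    by (simp add: G_def exp_add mult_ac)
  have eq2: "\<bar>?F y\<bar> * (?T y)\<^sup>2 * exp (s * ?T y) = G (Suc (Suc i)) j s t y" for s y
    unfolding abs_of_nonneg[OF G_nonneg] by (simp add: G_def exp_add mult_ac power2_eq_square)
  have "((\<lambda>s. \<integral>y. ?F y * exp (s * ?T y) \<partial>lborel) has_real_derivative (\<integral>y. ?F y * ?T y * exp (s * ?T y) \<partial>lborel)) (at s)"
    by (rule has_real_derivative_integral_exp[where d=1])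
       (simp_all only: eq eq1 eq2 integrable_G[OF t], simp_all)
  then show ?thesis by (simp only: eq eq1 J_def[symmetric])
qed

lemma J_deriv_2:
  assumes t: "t < 1 / p"
  shows "((\<lambda>t. J i j s t) has_real_derivative J i (Suc j) s t) (at t)"
proof -
  let ?F = "\<lambda>y. G i j s 0 y" and ?T = "\<lambda>y::real. \<bar>y\<bar> powr p"
  have eq: "?F y * exp (t * ?T y) = G i j s t y" for t y
    by (simp add: G_def exp_add mult_ac)
  have eq1: "?F y * ?T y * exp (t * ?T y) = G i (Suc j) s t y" for t y
    by (simp add: G_def exp_add mult_ac)
  have eq2: "\<bar>?F y\<bar> * (?T y)\<^sup>2 * exp (t * ?T y) = G i (Suc (Suc j)) s t y" for t y
    unfolding abs_of_nonneg[OF G_nonneg] by (simp add: G_def exp_add mult_ac power2_eq_square)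
  define d where "d = (1 / p - t) / 2"
  have d: "0 < d" "t + d < 1 / p" using t by (auto simp: d_def field_simps)
  have "((\<lambda>t. \<integral>y. ?F y * exp (t * ?T y) \<partial>lborel) has_real_derivative (\<integral>y. ?F y * ?T y * exp (t * ?T y) \<partial>lborel)) (at t)"
  proof (rule has_real_derivative_integral_exp[OF _ _ _ d(1)])
    fix h assume "\<bar>h\<bar> \<le> d"
    then have "t + h < 1 / p" using d by linarith
    then show "integrable lborel (\<lambda>y. ?F y * exp ((t + h) * ?T y))" by (simp only: eq integrable_G)
  qed (simp_all only: eq eq1 eq2 integrable_G[OF t] integrable_G[OF d(2)], simp_all)
  then show ?thesis by (simp only: eq eq1 J_def[symmetric])
qed

text \<open>The Euler operator y d/dy multiplies |y|^r by r, so differentiating y * G mixes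
  \<open>G\<close> only with neighbours of raised index.\<close>

lemma G_ibp_deriv:
  "((\<lambda>y. y * G i j s t y) has_real_derivative
    ((1 + real i * q + real j * p) * G i j s t y + s * q * G (Suc i) j s t y + (t - 1 / p) * p * G i (Suc j) s t y)) (at y)"
proof (cases "y = 0")
  case True
  have "isCont (G i j s t) 0" using continuous_G[of UNIV] by (simp add: continuous_on_eq_continuous_at)
  from DERIV_mult_ident_0[OF this]
  show ?thesis unfolding True by (rule DERIV_cong) (cases i; cases j; simp add: G_def)
next
  case False
  let ?N = "norm_const p"
  have N: "0 < ?N" using norm_const_pos pq_pos by simp
  let ?A = "\<lambda>y::real. \<bar>y\<bar> powr q" and ?B = "\<lambda>y::real. \<bar>y\<bar> powr p"
  have pow: "((\<lambda>y. f y ^ k) has_real_derivative (real k * r * f y ^ k / y)) (at y)"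
    if "(f has_real_derivative (r * f y / y)) (at y)" for f :: "real \<Rightarrow> real" and k r
    using DERIV_power[OF that, of k] by (rule DERIV_cong) (cases k; simp)
  note dA = DERIV_abs_powr[OF False, of q] and dB = DERIV_abs_powr[OF False, of p]
  have e: "((\<lambda>y. exp (s * ?A y + (t - 1 / p) * ?B y) / ?N) has_real_derivative
      (exp (s * ?A y + (t - 1 / p) * ?B y) / ?N * ((s * q * ?A y + (t - 1 / p) * p * ?B y) / y))) (at y)"
    by (rule DERIV_cong[OF DERIV_cdivide[OF DERIV_chain2[OF DERIV_exp DERIV_add[OF DERIV_cmult[OF dA] DERIV_cmult[OF dB]]]]])
       (simp add: add_divide_distrib)
  have Geq: "G i j s t = (\<lambda>y. ?A y ^ i * ?B y ^ j * (exp (s * ?A y + (t - 1 / p) * ?B y) / ?N))" for i j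
    by (simp add: G_def fun_eq_iff f_p_eq exp_add[symmetric] left_diff_distrib)
  have alg: "1 * (a * b * E) + ((k * q * a / y * b + l * p * b / y * a) * E + E * ((s * q * A + w * p * B) / y) * (a * b)) * y =
      (1 + k * q + l * p) * (a * b * E) + s * q * (A * a * b * E) + w * p * (a * (B * b) * E)" for a b E k l w A B
    using False by (simp add: field_simps)
  show ?thesis
    unfolding Geq power_Suc
    by (rule DERIV_cong, rule DERIV_mult[OF DERIV_ident DERIV_mult[OF DERIV_mult[OF pow[OF dA] pow[OF dB]] e]])
       (rule alg)
qed

text \<open>Integrates \<open>G_ibp_deriv\<close> over the line; y * G vanishes at both ends by
  \<open>G_bound\<close>. These recursions are the source of all relations between \<tau>, z and the
  Hessian.\<close>

lemma J_ibp:
  assumes t: "t < 1 / p"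
  shows "(1 + real i * q + real j * p) * J i j s t + s * q * J (Suc i) j s t + (t - 1 / p) * p * J i (Suc j) s t = 0"
proof -
  let ?h = "\<lambda>y. (1 + real i * q + real j * p) * G i j s t y + s * q * G (Suc i) j s t y + (t - 1 / p) * p * G i (Suc j) s t y"
  let ?F = "\<lambda>y. y * G i j s t y"
  obtain C c where C: "0 < c" "\<And>y. G i j s t y \<le> C * exp (- (c * \<bar>y\<bar>))"
    using G_bound[OF t] by blast
  have le: "norm (?F y) \<le> C * (\<bar>y\<bar> * exp (- (c * \<bar>y\<bar>)))" for y
    using mult_left_mono[OF C(2)[of y], of "\<bar>y\<bar>"] G_nonneg[of i j s t y] by (simp add: abs_mult mult_ac)
  have xe: "((\<lambda>x. x * exp (- (c * x))) \<longlongrightarrow> 0) at_top" using C(1) by real_asymp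
  have top: "(?F \<longlongrightarrow> 0) at_top"
  proof (rule Lim_null_comparison)
    show "\<forall>\<^sub>F y in at_top. norm (?F y) \<le> C * (y * exp (- (c * y)))"
      using eventually_ge_at_top[of 0] by eventually_elim (use le in \<open>metis abs_of_nonneg\<close>)
  qed (rule tendsto_mult_right_zero[OF xe])
  have bot: "(?F \<longlongrightarrow> 0) at_bot"
    unfolding filterlim_at_bot_mirror
  proof (rule Lim_null_comparison)
    show "\<forall>\<^sub>F y in at_top. norm (?F (- y)) \<le> C * (y * exp (- (c * y)))"
      using eventually_ge_at_top[of 0] by eventually_elim (use le in \<open>metis abs_of_nonneg abs_minus_cancel\<close>)
  qed (rule tendsto_mult_right_zero[OF xe])
  have int: "integrable lborel ?h" using integrable_G[OF t] by simp
  have "(LBINT y=-\<infinity>..\<infinity>. ?h y) = 0 - 0"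
  proof (rule interval_integral_FTC_integrable[where F="?F"])
    show "(?F has_vector_derivative ?h y) (at y)" for y
      using G_ibp_deriv[of i j s t y] by (simp add: has_real_derivative_iff_has_vector_derivative)
    show "isCont ?h y" for y
      using continuous_G[of UNIV] by (intro continuous_intros) (auto simp: continuous_on_eq_continuous_at)
    show "set_integrable lborel (einterval (-\<infinity>) \<infinity>) ?h"
      using int by (simp add: set_integrable_def)
    show "((?F \<circ> real_of_ereal) \<longlongrightarrow> 0) (at_right (-\<infinity>))"
      using bot by (simp add: ereal_tendsto_simps)
    show "((?F \<circ> real_of_ereal) \<longlongrightarrow> 0) (at_left \<infinity>)"
      using top by (simp add: ereal_tendsto_simps)
  qed simp
  then have "(\<integral>y. ?h y \<partial>lborel) = 0"
    by (simp add: interval_lebesgue_integral_def set_lebesgue_integral_def)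
  then show ?thesis
    using integrable_G[OF t] by (simp add: J_def)
qed

end

section \<open>The cumulant generating function and its dual\<close>

context exponents
begin

text \<open>Mixed moments of |y|^q and |y|^p under the tilted density with parameter (s, t).\<close>

definition mom :: "nat \<Rightarrow> nat \<Rightarrow> real \<Rightarrow> real \<Rightarrow> real" where
  "mom i j s t = J i j s t / J 0 0 s t"

lemma Lambda_p_eq: "Lambda_p p q (s, t) = ln (J 0 0 s t)"
  by (simp add: Lambda_p_def J_def G_def)

lemma Lambda_p_deriv_1:
  assumes "t < 1 / p"
  shows "((\<lambda>s. Lambda_p p q (s, t)) has_real_derivative mom 1 0 s t) (at s)"
  unfolding Lambda_p_eq using J_00_pos[OF assms, of s]
  by (auto intro!: derivative_eq_intros J_deriv_1[OF assms] simp: mom_def)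

lemma Lambda_p_deriv_2:
  assumes "t < 1 / p"
  shows "((\<lambda>t. Lambda_p p q (s, t)) has_real_derivative mom 0 1 s t) (at t)"
  unfolding Lambda_p_eq using J_00_pos[OF assms, of s]
  by (auto intro!: derivative_eq_intros J_deriv_2[OF assms] simp: mom_def)

lemma d1_Lambda_p: "t < 1 / p \<Longrightarrow> d1 (Lambda_p p q) (s, t) = mom 1 0 s t"
  unfolding d1_def fst_conv snd_conv by (rule DERIV_imp_deriv[OF Lambda_p_deriv_1])

lemma d2_Lambda_p: "t < 1 / p \<Longrightarrow> d2 (Lambda_p p q) (s, t) = mom 0 1 s t"
  unfolding d2_def fst_conv snd_conv by (rule DERIV_imp_deriv[OF Lambda_p_deriv_2])

lemma mom_deriv_1:
  assumes "t < 1 / p"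
  shows "((\<lambda>s. mom i j s t) has_real_derivative mom (Suc i) j s t - mom i j s t * mom 1 0 s t) (at s)"
proof -
  have Z: "J 0 0 s t \<noteq> 0" using J_00_pos[OF assms, of s] by simp
  have "((\<lambda>s. mom i j s t) has_real_derivative
      (J (Suc i) j s t * J 0 0 s t - J i j s t * J 1 0 s t) / (J 0 0 s t * J 0 0 s t)) (at s)"
    unfolding mom_def by (rule DERIV_divide[OF J_deriv_1[OF assms] J_deriv_1[OF assms, of 0, folded One_nat_def] Z])
  then show ?thesis
    by (rule DERIV_cong) (use Z in \<open>simp add: mom_def diff_divide_distrib\<close>)
qed

lemma mom_deriv_2:
  assumes "t < 1 / p"
  shows "((\<lambda>t. mom i j s t) has_real_derivative mom i (Suc j) s t - mom i j s t * mom 0 1 s t) (at t)"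
proof -
  have Z: "J 0 0 s t \<noteq> 0" using J_00_pos[OF assms, of s] by simp
  have "((\<lambda>t. mom i j s t) has_real_derivative
      (J i (Suc j) s t * J 0 0 s t - J i j s t * J 0 1 s t) / (J 0 0 s t * J 0 0 s t)) (at t)"
    unfolding mom_def by (rule DERIV_divide[OF J_deriv_2[OF assms] J_deriv_2[OF assms, of 0 0, folded One_nat_def] Z])
  then show ?thesis
    by (rule DERIV_cong) (use Z in \<open>simp add: mom_def diff_divide_distrib\<close>)
qed

lemma d1_d1_Lambda_p:
  assumes "t < 1 / p"
  shows "d1 (d1 (Lambda_p p q)) (s, t) = mom 2 0 s t - (mom 1 0 s t)\<^sup>2"
  unfolding d1_def[of "d1 (Lambda_p p q)"] fst_conv snd_conv d1_Lambda_p[OF assms]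
  using DERIV_imp_deriv[OF mom_deriv_1[OF assms, of 1 0 s]] by (simp add: numeral_2_eq_2)

lemma d2_deriv:
  assumes t: "t < 1 / p" and F: "\<And>t. t < 1 / p \<Longrightarrow> F (s, t) = mom i j s t"
  shows "d2 F (s, t) = mom i (Suc j) s t - mom i j s t * mom 0 1 s t"
  unfolding d2_def fst_conv snd_conv
  by (rule DERIV_imp_deriv, rule has_field_derivative_transform_within_open[OF mom_deriv_2[OF t], where S="{..<1 / p}"])
     (use t F in auto)

lemma d2_d1_Lambda_p:
  "t < 1 / p \<Longrightarrow> d2 (d1 (Lambda_p p q)) (s, t) = mom 1 1 s t - mom 1 0 s t * mom 0 1 s t"
  using d2_deriv[of t "d1 (Lambda_p p q)" s 1 0] d1_Lambda_p by simp

lemma d2_d2_Lambda_p: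
  "t < 1 / p \<Longrightarrow> d2 (d2 (Lambda_p p q)) (s, t) = mom 0 2 s t - (mom 0 1 s t)\<^sup>2"
  using d2_deriv[of t "d2 (Lambda_p p q)" s 0 1] d2_Lambda_p by (simp add: numeral_2_eq_2)

lemma mom_ibp:
  assumes "t < 1 / p"
  shows "(1 + real i * q + real j * p) * mom i j s t + s * q * mom (Suc i) j s t = (1 / p - t) * p * mom i (Suc j) s t"
proof -
  have "((1 + real i * q + real j * p) * J i j s t + s * q * J (Suc i) j s t + (t - 1 / p) * p * J i (Suc j) s t) / J 0 0 s t = 0"
    using J_ibp[OF assms, of i j s] by simp
  then have "(1 + real i * q + real j * p) * mom i j s t + s * q * mom (Suc i) j s t + (t - 1 / p) * p * mom i (Suc j) s t = 0"
    unfolding mom_def by (simp only: add_divide_distrib times_divide_eq_right)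
  then show ?thesis by (simp add: algebra_simps)
qed

lemma mom_0_0: "t < 1 / p \<Longrightarrow> mom 0 0 s t = 1"
  using J_00_pos[of t s] by (simp add: mom_def)

lemma exp_eq_add_one_iff: "exp x = 1 + x \<longleftrightarrow> x = 0" for x :: real
  using ln_eq_minus_one[of "exp x"] by auto

text \<open>Jensen's inequality under the tilted density: \<mu> is the mean of the exponent
  difference u, and exp u \<ge> exp \<mu> * (1 + (u - \<mu>)) pointwise. Equality forces u = \<mu>
  almost everywhere, by continuity everywhere, and the values at y = 0, 1, 2 give s' = s and t' = t.
  This strict convexity yields the uniqueness of \<tau>, the sign of \<tau>_1 and the Legendre
  transform.\<close>

lemma Lambda_p_tangent:
  fixes s s' t t' :: real
  assumes t: "t < 1 / p" and t': "t' < 1 / p"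
  defines "\<mu> \<equiv> (s' - s) * mom 1 0 s t + (t' - t) * mom 0 1 s t"
  shows "\<mu> \<le> Lambda_p p q (s', t') - Lambda_p p q (s, t)"
    and "\<mu> = Lambda_p p q (s', t') - Lambda_p p q (s, t) \<Longrightarrow> s' = s \<and> t' = t"
proof -
  define u where "u y = (s' - s) * \<bar>y\<bar> powr q + (t' - t) * \<bar>y\<bar> powr p" for y :: real
  define E where "E y = G 0 0 s t y * (exp (u y) - exp \<mu> * (1 + (u y - \<mu>)))" for y
  have Z: "0 < J 0 0 s t" "0 < J 0 0 s' t'" using J_00_pos t t' by auto
  have e: "exp (u y) = exp \<mu> * exp (u y - \<mu>)" for y by (simp add: exp_add[symmetric])
  have E0: "0 \<le> E y" for y
    unfolding E_def e using G_00_pos[of s t y] exp_ge_add_one_self[of "u y - \<mu>"] by (simp add: mult_left_mono)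
  have Eeq: "E = (\<lambda>y. G 0 0 s' t' y - exp \<mu> * ((1 - \<mu>) * G 0 0 s t y + (s' - s) * G 1 0 s t y + (t' - t) * G 0 1 s t y))"
  proof
    fix y
    have "G 0 0 s' t' y = G 0 0 s t y * exp (u y)"
      by (simp add: G_def u_def exp_add[symmetric] algebra_simps)
    moreover have "G 1 0 s t y = \<bar>y\<bar> powr q * G 0 0 s t y" "G 0 1 s t y = \<bar>y\<bar> powr p * G 0 0 s t y"
      by (simp_all add: G_def)
    ultimately show "E y = G 0 0 s' t' y - exp \<mu> * ((1 - \<mu>) * G 0 0 s t y + (s' - s) * G 1 0 s t y + (t' - t) * G 0 1 s t y)"
      by (simp add: E_def u_def algebra_simps)
  qed
  have Eint: "integrable lborel E"
    unfolding Eeq using integrable_G[OF t] integrable_G[OF t'] by simp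
  have "integral\<^sup>L lborel E = J 0 0 s' t' - exp \<mu> * ((1 - \<mu>) * J 0 0 s t + (s' - s) * J 1 0 s t + (t' - t) * J 0 1 s t)"
    unfolding Eeq J_def using integrable_G[OF t] integrable_G[OF t'] by simp
  also have "(1 - \<mu>) * J 0 0 s t + (s' - s) * J 1 0 s t + (t' - t) * J 0 1 s t = J 0 0 s t"
    using Z by (simp add: \<mu>_def mom_def field_simps)
  finally have IE: "integral\<^sup>L lborel E = J 0 0 s' t' - exp \<mu> * J 0 0 s t" .
  have "0 \<le> integral\<^sup>L lborel E" using E0 by (intro integral_nonneg_AE) auto
  then have "exp \<mu> * J 0 0 s t \<le> J 0 0 s' t'" by (simp add: IE)
  then have "ln (exp \<mu> * J 0 0 s t) \<le> ln (J 0 0 s' t')" using Z by simp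
  then show "\<mu> \<le> Lambda_p p q (s', t') - Lambda_p p q (s, t)"
    using Z by (simp add: Lambda_p_eq ln_mult)
  assume eq: "\<mu> = Lambda_p p q (s', t') - Lambda_p p q (s, t)"
  have "exp \<mu> * J 0 0 s t = J 0 0 s' t'"
    unfolding eq Lambda_p_eq using Z by (simp add: exp_diff)
  then have ae: "AE y in lborel. E y = 0"
    using IE integral_nonneg_eq_0_iff_AE[OF Eint] E0 by auto
  have cont: "continuous_on UNIV E"
    unfolding Eeq by (intro continuous_on_diff continuous_on_add continuous_on_mult continuous_on_const continuous_G)
  have "E y = 0" for y
    using AE_lborel_eq_imp_eq[OF ae cont continuous_on_const] .
  then have "exp (u y - \<mu>) = 1 + (u y - \<mu>)" for y
  proof -
    have "E y = G 0 0 s t y * exp \<mu> * (exp (u y - \<mu>) - (1 + (u y - \<mu>)))"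
      unfolding E_def e by (simp add: algebra_simps)
    then show ?thesis using \<open>E y = 0\<close> G_00_pos[of s t y] by simp
  qed
  then have u: "u y = \<mu>" for y
    using exp_eq_add_one_iff[of "u y - \<mu>"] by simp
  have "\<mu> = 0" using u[of 0] by (simp add: u_def)
  then have 1: "(s' - s) + (t' - t) = 0" and 2: "(s' - s) * 2 powr q + (t' - t) * 2 powr p = 0"
    using u[of 1] u[of 2] by (simp_all add: u_def)
  have "(s' - s) * (2 powr q - 2 powr p) = 0"
  proof -
    have "t' - t = - (s' - s)" using 1 by simp
    with 2 show ?thesis by algebra
  qed
  moreover have "2 powr q < 2 powr p" using q_less_p by simp
  ultimately show "s' = s \<and> t' = t" using 1 by simp
qed

text \<open>Here w stands for z^q, t for \<tau>_1 (elsewhere s) and B for p * b; r1 and r2 determine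
  h12 and h22 from h11.\<close>

lemma bracket_identity:
  fixes w t h11 h12 h22 B :: real
  assumes B: "B = 1 + q * w * t" "B \<noteq> 0"
    and r1: "B * h12 = q * w + t * q * h11" and r2: "B * h22 = p + t * q * h12"
    and det: "h11 * h22 - h12\<^sup>2 \<noteq> 0"
  shows "(w\<^sup>2 * q\<^sup>2 / p\<^sup>2) * (h22 / (h11 * h22 - h12\<^sup>2)) + (2 * w * q / p) * (- h12 / (h11 * h22 - h12\<^sup>2))
      + h11 / (h11 * h22 - h12\<^sup>2) + t * (w * q * (q - p) / p\<^sup>2) = 1 / p"
proof -
  let ?d = "h11 * h22 - h12\<^sup>2"
  \<comment> \<open>The factor B^2 clears the denominators of r1 and r2: B h12, B^2 h22 and B^2
    times the determinant all become affine in h11.\<close>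
  have "B\<^sup>2 * (w\<^sup>2 * q\<^sup>2 * h22 - 2 * w * q * p * h12 + p\<^sup>2 * h11 + t * (w * q * (q - p)) * ?d - p * ?d) = 0"
    using B(1) r1 r2 by algebra
  then have "w\<^sup>2 * q\<^sup>2 * h22 - 2 * w * q * p * h12 + p\<^sup>2 * h11 + t * (w * q * (q - p)) * ?d = p * ?d"
    using B(2) by simp
  moreover have "(w\<^sup>2 * q\<^sup>2 / p\<^sup>2) * (h22 / d) + (2 * w * q / p) * (- h12 / d) + h11 / d + t * (w * q * (q - p) / p\<^sup>2) =
      (w\<^sup>2 * q\<^sup>2 * h22 - 2 * w * q * p * h12 + p\<^sup>2 * h11 + t * (w * q * (q - p)) * d) / (p\<^sup>2 * d)" if "d \<noteq> 0" for d
    using that pq_pos by (simp add: add_divide_distrib diff_divide_distrib power2_eq_square)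
  ultimately show ?thesis
    using det pq_pos by (simp add: power2_eq_square)
qed

end

section \<open>The dual point and the constant gamma(z)\<close>

locale dual_point = exponents +
  fixes z s t :: real
  assumes z_gt: "z > m_pq p q" and t_less: "t < 1 / p"
    and mom_q: "mom 1 0 s t = z powr q" and mom_p: "mom 0 1 s t = 1"
    and diff: "Lambda_p p q differentiable (at (s, t))"
begin

abbreviation "w \<equiv> z powr q"

definition "b = 1 / p - t"

lemmas moms = mom_q mom_p mom_q[unfolded One_nat_def] mom_p[unfolded One_nat_def]

lemma b_pos: "0 < b" using t_less by (simp add: b_def)

lemma z_pos: "0 < z"
  using z_gt unfolding m_pq_def by (rule le_less_trans[OF powr_ge_zero])

text \<open>For two points with the same gradient the two tangent inequalities bound the same
  difference from both sides, so equality holds and its characterization identifies the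
  points.\<close>

lemma tau_of_eq: "tau_of p q (zstar q z) = (s, t)"
  unfolding tau_of_def
proof (rule the_equality)
  show "(s, t) \<in> D_p p \<and> Lambda_p p q differentiable at (s, t) \<and> grad_Lambda p q (s, t) = zstar q z"
    using t_less diff by (simp add: D_p_def grad_Lambda_def d1_Lambda_p d2_Lambda_p moms zstar_def)
  fix \<tau> assume \<tau>: "\<tau> \<in> D_p p \<and> Lambda_p p q differentiable at \<tau> \<and> grad_Lambda p q \<tau> = zstar q z"
  obtain s' t' where st: "\<tau> = (s', t')" by fastforce
  have t': "t' < 1 / p" and m: "mom 1 0 s' t' = w" "mom 0 1 s' t' = 1"
    using \<tau> by (auto simp: st D_p_def grad_Lambda_def d1_Lambda_p d2_Lambda_p zstar_def)
  have "(s' - s) * w + (t' - t) \<le> Lambda_p p q (s', t') - Lambda_p p q (s, t)"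
    using Lambda_p_tangent(1)[OF t_less t', of s' s] by (simp add: moms)
  moreover have "(s - s') * w + (t - t') \<le> Lambda_p p q (s, t) - Lambda_p p q (s', t')"
    using Lambda_p_tangent(1)[OF t' t_less, of s s'] by (simp add: m m[unfolded One_nat_def])
  moreover have "(s - s') * w + (t - t') = - ((s' - s) * w + (t' - t))" by (simp add: algebra_simps)
  ultimately have "(s' - s) * w + (t' - t) = Lambda_p p q (s', t') - Lambda_p p q (s, t)" by linarith
  then show "\<tau> = (s, t)"
    using Lambda_p_tangent(2)[OF t_less t', of s' s] by (simp add: moms st)
qed

lemma ibp_00: "1 + s * q * w = b * p"
  using mom_ibp[OF t_less, of 0 0 s] mom_0_0[OF t_less, of s] by (simp add: moms b_def)

text \<open>Monotonicity of the gradient between (0, 0) and (s, t): both gradients have second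
  component 1, so adding the tangent inequalities leaves s * (w - M_p p q) \<ge> 0, and z > m_pq
  makes the second factor positive. If s were 0, \<open>ibp_00\<close> would give t = 0 and then w =
  M_p p q.\<close>

lemma s_pos: "0 < s"
proof -
  have J0: "J 0 0 0 0 = 1"
  proof -
    have "(\<integral>\<^sup>+y. ennreal (exp (- (\<bar>y\<bar> powr p) / p)) \<partial>lborel) = ennreal (norm_const p)"
      using nn_integral_exp_powr[OF pq_pos(2)] by (simp add: norm_const_def)
    then have "(\<integral>y. exp (- (\<bar>y\<bar> powr p) / p) \<partial>lborel) = norm_const p"
      using norm_const_pos[OF pq_pos(2)] by (subst integral_eq_nn_integral) auto
    then show ?thesis
      using norm_const_pos[OF pq_pos(2)] by (simp add: J_def G_def f_p_eq)
  qed
  have 0: "(0::real) < 1 / p" using pq_pos by simp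
  have M: "mom 1 0 0 0 = M_p p q"
    unfolding mom_def J0 by (simp add: M_p_def J_def G_def)
  have m1: "mom 0 1 0 0 = 1"
    using mom_ibp[OF 0, of 0 0 0] mom_0_0[OF 0, of 0] pq_pos by simp
  have M0: "0 \<le> M_p p q"
    unfolding M_p_def by (intro integral_nonneg_AE) (auto intro!: AE_I2 mult_nonneg_nonneg less_imp_le[OF f_p_pos])
  have gt: "M_p p q < w"
  proof -
    have "(M_p p q powr (1 / q)) powr q < z powr q"
      using z_gt pq_pos by (intro powr_less_mono2) (auto simp: m_pq_def)
    then show ?thesis using M0 pq_pos by (simp add: powr_powr)
  qed
  have 1: "s * M_p p q + t \<le> Lambda_p p q (s, t) - Lambda_p p q (0, 0)"
    using Lambda_p_tangent(1)[OF 0 t_less, of s 0] by (simp add: M m1 M[unfolded One_nat_def] m1[unfolded One_nat_def])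
  have 2: "- (s * w) - t \<le> Lambda_p p q (0, 0) - Lambda_p p q (s, t)"
    using Lambda_p_tangent(1)[OF t_less 0, of 0 s] by (simp add: moms)
  have "0 \<le> s * (w - M_p p q)"
    using 1 2 by (simp add: right_diff_distrib)
  then have "0 \<le> s" using gt by (simp add: zero_le_mult_iff)
  moreover have "s \<noteq> 0"
  proof
    assume "s = 0"
    then have "b * p = 1" using ibp_00 by simp
    then have "t = 0" using pq_pos by (simp add: b_def left_diff_distrib)
    with \<open>s = 0\<close> have "w = M_p p q" using mom_q M by (simp only:)
    then show False using gt by simp
  qed
  ultimately show ?thesis by simp
qed

lemma Lambda_star_eq: "Lambda_star p q (zstar q z) = w * s + t - Lambda_p p q (s, t)"
  unfolding Lambda_star_def
proof (rule cSup_eq_maximum)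
  show "w * s + t - Lambda_p p q (s, t) \<in> (\<lambda>\<tau>. fst (zstar q z) * fst \<tau> + snd (zstar q z) * snd \<tau> - Lambda_p p q \<tau>) ` D_p p"
    by (rule image_eqI[of _ _ "(s, t)"]) (use t_less in \<open>auto simp: zstar_def D_p_def\<close>)
  fix x assume "x \<in> (\<lambda>\<tau>. fst (zstar q z) * fst \<tau> + snd (zstar q z) * snd \<tau> - Lambda_p p q \<tau>) ` D_p p"
  then obtain s' t' where x: "x = w * s' + t' - Lambda_p p q (s', t')" and t': "t' < 1 / p"
    by (auto simp: zstar_def D_p_def)
  show "x \<le> w * s + t - Lambda_p p q (s, t)"
    using Lambda_p_tangent(1)[OF t_less t', of s' s] unfolding x by (simp add: moms algebra_simps)
qed

abbreviation "h11 \<equiv> mom 2 0 s t - w\<^sup>2"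
abbreviation "h12 \<equiv> mom 1 1 s t - w"
abbreviation "h22 \<equiv> mom 0 2 s t - 1"

lemma H_eq: "H11 p q (zstar q z) = h11" "H12 p q (zstar q z) = h12" "H22 p q (zstar q z) = h22"
  using t_less by (simp_all add: H11_def H12_def H22_def tau_of_eq d1_d1_Lambda_p d2_d1_Lambda_p d2_d2_Lambda_p moms)

lemma gamma_z_eq:
  assumes det: "0 < h11 * h22 - h12\<^sup>2"
  shows "gamma_z p q z = sqrt (h11 * h22 - h12\<^sup>2) * s * b * sqrt p"
proof -
  \<comment> \<open>The relations r1 and r2 are the cases (1, 0) and (0, 1) of
    \<open>mom_ibp\<close>; subtracting w times, respectively once, the case (0, 0) turns moments
    into covariances.\<close>
  have "(1 + q) * w + s * q * mom 2 0 s t = b * p * mom 1 1 s t"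
    using mom_ibp[OF t_less, of 1 0 s] by (simp add: moms b_def numeral_2_eq_2)
  then have r1: "(b * p) * h12 = q * w + s * q * h11"
    using ibp_00 by algebra
  have "(1 + p) + s * q * mom 1 1 s t = b * p * mom 0 2 s t"
    using mom_ibp[OF t_less, of 0 1 s] by (simp add: moms b_def numeral_2_eq_2)
  then have r2: "(b * p) * h22 = p + s * q * h12"
    using ibp_00 by algebra
  have w2: "z powr (2 * q) = w\<^sup>2"
    by (simp add: powr_add[symmetric] power2_eq_square)
  have B: "b * p = 1 + q * w * s" using ibp_00 by (simp add: mult_ac)
  have "gamma_sq p q z = (h11 * h22 - h12\<^sup>2) * s\<^sup>2 * (b * p)\<^sup>2 * (1 / p)"
  proof -
    have 1: "b * p \<noteq> 0" using b_pos pq_pos by simp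
    have 2: "h11 * h22 - h12\<^sup>2 \<noteq> 0" using det by simp
    have 3: "q * w * s + 1 = b * p" using B by simp
    show ?thesis
      unfolding gamma_sq_def Let_def tau_of_eq fst_conv Hinv11_def Hinv12_def Hinv22_def detH_def H_eq w2 3
        bracket_identity[OF B 1 r1 r2 2] ..
  qed
  also have "\<dots> = (h11 * h22 - h12\<^sup>2) * (s * b)\<^sup>2 * p"
    using pq_pos by (simp add: power2_eq_square)
  finally show ?thesis
    using s_pos b_pos by (simp add: gamma_z_def real_sqrt_mult)
qed

end

section \<open>The tilted random walk\<close>

lemma PiM_density_lborel:
  fixes g :: "real \<Rightarrow> real"
  assumes g [measurable]: "g \<in> borel_measurable borel" and nonneg: "\<And>y. 0 \<le> g y"
    and prob: "prob_space (density lborel (\<lambda>y. ennreal (g y)))"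
  shows "PiM {..<n} (\<lambda>_. density lborel (\<lambda>y. ennreal (g y))) = density (lebn n) (\<lambda>x. ennreal (\<Prod>i<n. g (x i)))"
proof -
  let ?D = "density lborel (\<lambda>y. ennreal (g y))" and ?L = "density (lebn n) (\<lambda>x. ennreal (\<Prod>i<n. g (x i)))"
  interpret prob_space ?D by (rule prob)
  interpret D: product_prob_space "\<lambda>_::nat. ?D" by unfold_locales
  show ?thesis
  proof (rule D.PiM_eqI[symmetric])
    show "sets ?L = sets (PiM {..<n} (\<lambda>_. ?D))"
      unfolding lebn_def by (simp cong: sets_PiM_cong)
next
    interpret L: product_sigma_finite "\<lambda>_::nat. lborel :: real measure" by (rule product_sigma_finite_lborel)
    fix A :: "nat \<Rightarrow> real set" assume A: "\<And>i. i \<in> {..<n} \<Longrightarrow> A i \<in> sets ?D"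
    then have A': "\<And>i. i \<in> {..<n} \<Longrightarrow> A i \<in> sets borel" by simp
    have box: "Pi\<^sub>E {..<n} A \<in> sets (lebn n)" unfolding lebn_def using A' by (intro sets_PiM_I_finite) auto
    have m: "(\<lambda>x. ennreal (\<Prod>i<n. g (x i))) \<in> borel_measurable (lebn n)"
      unfolding lebn_def by measurable
    have "emeasure ?L (Pi\<^sub>E {..<n} A) =
        (\<integral>\<^sup>+x. ennreal (\<Prod>i<n. g (x i)) * indicator (Pi\<^sub>E {..<n} A) x \<partial>lebn n)"
      by (rule emeasure_density[OF m box])
    also have "\<dots> = (\<integral>\<^sup>+x. (\<Prod>i<n. ennreal (g (x i)) * indicator (A i) (x i)) \<partial>lebn n)"
    proof (rule nn_integral_cong)
      fix x assume x: "x \<in> space (lebn n)"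
      have "indicator (Pi\<^sub>E {..<n} A) x = (\<Prod>i<n. indicator (A i) (x i) :: ennreal)"
      proof (cases "\<forall>i<n. x i \<in> A i")
        case True
        then have "x \<in> Pi\<^sub>E {..<n} A" using x by (auto simp: lebn_def space_PiM PiE_iff)
        then show ?thesis using True by simp
    next
        case False
        then obtain i where i: "i < n" "x i \<notin> A i" by auto
        then have "x \<notin> Pi\<^sub>E {..<n} A" by (auto simp: PiE_iff)
        then show ?thesis using i by (auto intro!: prod_zero[symmetric] bexI[of _ i])
      qed
      then show "ennreal (\<Prod>i<n. g (x i)) * indicator (Pi\<^sub>E {..<n} A) x = (\<Prod>i<n. ennreal (g (x i)) * indicator (A i) (x i))"
        using nonneg by (simp add: prod.distrib prod_ennreal)
    qed
    also have "\<dots> = (\<Prod>i<n. \<integral>\<^sup>+y. ennreal (g y) * indicator (A i) y \<partial>lborel)"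
      unfolding lebn_def using A' by (intro L.product_nn_integral_prod) auto
    also have "\<dots> = (\<Prod>i<n. emeasure ?D (A i))"
      using A' by (intro prod.cong refl emeasure_density[symmetric]) auto
    finally show "emeasure ?L (Pi\<^sub>E {..<n} A) =
        (\<Prod>i<n. emeasure ?D (A i))" .
  qed simp
qed

lemma powr_combination_not_constant:
  assumes "0 < q" "q < p" "\<And>y::real. 0 < y \<Longrightarrow> a * q * y powr q = b * p * y powr p" "0 < p"
  shows "a = 0" "b = 0"
proof -
  have 1: "a * q = b * p" using assms(3)[of 1] by simp
  then have "b * p * 2 powr q = b * p * 2 powr p" using assms(3)[of 2] by simp
  moreover have "(2::real) powr q < 2 powr p" using assms by simp
  ultimately show "b = 0" using assms by auto
  then show "a = 0" using 1 assms by auto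
qed

section \<open>The tilted law as input for the local limit theorem\<close>

context dual_point
begin

definition tilt :: "real \<Rightarrow> real" where
  "tilt y = G 0 0 s t y / J 0 0 s t"

definition "tilt_measure = density lborel (\<lambda>y. ennreal (tilt y))"

lemma tilt_pos: "0 < tilt y"
  using G_00_pos J_00_pos[OF t_less] by (simp add: tilt_def)

lemma tilt_measurable [measurable]: "tilt \<in> borel_measurable borel"
  unfolding tilt_def by measurable

lemma integrable_tilt:
  fixes F :: "real \<Rightarrow> 'b :: {banach, second_countable_topology}"
  assumes "F \<in> borel_measurable borel"
  shows "integrable tilt_measure F \<longleftrightarrow> integrable lborel (\<lambda>y. tilt y *\<^sub>R F y)"
  unfolding tilt_measure_def using assms tilt_pos
  by (intro integrable_density) (auto intro!: AE_I2 less_imp_le)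

lemma integral_tilt:
  fixes F :: "real \<Rightarrow> 'b :: {banach, second_countable_topology}"
  assumes "F \<in> borel_measurable borel"
  shows "integral\<^sup>L tilt_measure F = (\<integral>y. tilt y *\<^sub>R F y \<partial>lborel)"
  unfolding tilt_measure_def using assms tilt_pos
  by (intro integral_density) (auto intro!: AE_I2 less_imp_le)

lemma has_bochner_integral_tilt:
  "has_bochner_integral tilt_measure (\<lambda>y. (\<bar>y\<bar> powr q) ^ i * (\<bar>y\<bar> powr p) ^ j) (mom i j s t)"
proof -
  have eq: "tilt y *\<^sub>R ((\<bar>y\<bar> powr q) ^ i * (\<bar>y\<bar> powr p) ^ j) = G i j s t y / J 0 0 s t" for y
    by (simp add: tilt_def G_def)
  show ?thesis
    unfolding has_bochner_integral_iff
    by (subst integrable_tilt, simp, subst integral_tilt, simp, unfold eq)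
       (simp add: integrable_G[OF t_less] mom_def J_def)
qed

lemma prob_space_tilt: "prob_space tilt_measure"
proof
  have "emeasure tilt_measure (space tilt_measure) = (\<integral>\<^sup>+y. ennreal (tilt y) \<partial>lborel)"
    by (simp add: tilt_measure_def emeasure_density)
  also have "\<dots> = ennreal (\<integral>y. tilt y \<partial>lborel)"
    using integrable_G[OF t_less] tilt_pos by (intro nn_integral_eq_integral) (auto simp: tilt_def less_imp_le intro!: AE_I2)
  also have "(\<integral>y. tilt y \<partial>lborel) = 1"
    using J_00_pos[OF t_less, of s] by (simp add: tilt_def J_def[symmetric])
  finally show "emeasure tilt_measure (space tilt_measure) = 1" by simp
qed

lemma sets_tilt [measurable_cong]: "sets tilt_measure = sets borel"
  by (simp add: tilt_measure_def)

text \<open>If the characteristic function had modulus 1 at (u, v), then the phase would be constant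
  modulo \<open>2 \<pi>\<close> almost everywhere, hence everywhere; differentiating it on \<open>y > 0\<close> forces u = v = 0.\<close>

lemma tilt_nonlattice:
  assumes uv: "(u, v) \<noteq> (0, 0)"
  shows "cmod (\<integral>y. iexp (u * (\<bar>y\<bar> powr q - w) + v * (1 - \<bar>y\<bar> powr p)) \<partial>tilt_measure) < 1"
proof (rule ccontr)
  interpret T: prob_space tilt_measure by (rule prob_space_tilt)
  let ?\<theta> = "\<lambda>y::real. u * (\<bar>y\<bar> powr q - w) + v * (1 - \<bar>y\<bar> powr p)"
  define c where "c = (\<integral>y. iexp (?\<theta> y) \<partial>tilt_measure)"
  assume "\<not> cmod (\<integral>y. iexp (?\<theta> y) \<partial>tilt_measure) < 1"
  then have c1: "1 \<le> cmod c" by (simp only: c_def not_less)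
  have int: "integrable tilt_measure (\<lambda>y. iexp (?\<theta> y))"
    by (rule T.integrable_const_bound[where B=1]) (auto simp del: of_real_arith)
  have cont: "continuous_on UNIV (\<lambda>y. iexp (?\<theta> y))"
    using pq_pos by (intro continuous_intros) auto
  \<comment> \<open>Rotates the mean c onto the positive real axis. Then Re (d * iexp ...) is at
    most 1 everywhere but has mean at least 1, hence equals 1 almost everywhere.\<close>
  define d where "d = cnj c / cmod c"
  have d: "cmod d = 1" using c1 by (auto simp: d_def norm_divide)
  have dc: "d * c = cmod c"
  proof -
    have "d * c = (c * cnj c) / complex_of_real (cmod c)" by (simp add: d_def)
    also have "\<dots> = complex_of_real (cmod c)"
      unfolding complex_norm_square[symmetric] by (simp add: power2_eq_square)
    finally show ?thesis .
  qed
  have "(\<integral>y. 1 - Re (d * iexp (?\<theta> y)) \<partial>tilt_measure) = 1 - Re (d * c)"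
    unfolding c_def using int
    by (subst Bochner_Integration.integral_diff)
       (auto simp: T.prob_space simp del: of_real_arith)
  also have "\<dots> \<le> 0" using c1 dc by simp
  finally have I: "(\<integral>y. 1 - Re (d * iexp (?\<theta> y)) \<partial>tilt_measure) \<le> 0" .
  have re: "Re (d * iexp (?\<theta> y)) \<le> 1" for y
    using complex_Re_le_cmod[of "d * iexp (?\<theta> y)"] d by (simp add: norm_mult del: of_real_arith)
  have int2: "integrable tilt_measure (\<lambda>y. 1 - Re (d * iexp (?\<theta> y)))"
    using int by (intro Bochner_Integration.integrable_diff integrable_Re integrable_mult_right) auto
  have "(\<integral>y. 1 - Re (d * iexp (?\<theta> y)) \<partial>tilt_measure) = 0"
    using I re by (intro antisym integral_nonneg_AE) auto
  then have "AE y in tilt_measure. 1 - Re (d * iexp (?\<theta> y)) = 0"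
    using integral_nonneg_eq_0_iff_AE[OF int2] re by auto
  then have "AE y in lborel. 1 - Re (d * iexp (?\<theta> y)) = 0"
    unfolding tilt_measure_def using tilt_pos by (subst (asm) AE_density) auto
  then have "AE y in lborel. Re (d * iexp (?\<theta> y)) = 1"
    by eventually_elim simp
  moreover have "continuous_on UNIV (\<lambda>y. Re (d * iexp (?\<theta> y)))"
    by (intro continuous_intros cont)
  ultimately have Re1: "Re (d * iexp (?\<theta> y)) = 1" for y
    by (rule AE_lborel_eq_imp_eq[OF _ _ continuous_on_const])
  \<comment> \<open>Modulus 1 and real part 1 leave only the number 1 itself, so the exponential of
    the phase is constant on the whole line.\<close>
  have const: "d * iexp (?\<theta> y) = 1" for y
  proof -
    have "cmod (d * iexp (?\<theta> y)) = 1"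
      using d by (simp add: norm_mult del: of_real_arith)
    then have "(Re (d * iexp (?\<theta> y)))\<^sup>2 + (Im (d * iexp (?\<theta> y)))\<^sup>2 = 1"
      by (simp only: cmod_power2[symmetric] power_one)
    then have "Im (d * iexp (?\<theta> y)) = 0" unfolding Re1 by simp
    then show ?thesis using Re1[of y] by (simp only: complex_eq_iff one_complex.sel)
  qed
  have "u * q * y powr q = v * p * y powr p" if y: "0 < y" for y
  proof -
    let ?D = "u * (q * \<bar>y\<bar> powr q / y) - v * (p * \<bar>y\<bar> powr p / y)"
    have "(?\<theta> has_real_derivative ?D) (at y)"
      using y by (auto intro!: derivative_eq_intros DERIV_abs_powr[of y, THEN DERIV_cong] simp: mult_ac)
    then have "((\<lambda>y. d * iexp (?\<theta> y)) has_vector_derivative d * (?D *\<^sub>R (\<i> * iexp (?\<theta> y)))) (at y)"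
      by (intro has_vector_derivative_mult_right vector_diff_chain_at[unfolded o_def, OF _ has_vector_derivative_iexp])
         (simp add: has_real_derivative_iff_has_vector_derivative)
    moreover have "((\<lambda>y. d * iexp (?\<theta> y)) has_vector_derivative 0) (at y)"
      unfolding const by (rule has_vector_derivative_const)
    ultimately have "d * (?D *\<^sub>R (\<i> * iexp (?\<theta> y))) = 0"
      by (rule vector_derivative_unique_at)
    then have "?D = 0" using d by (auto simp del: of_real_arith)
    then show ?thesis using y by (simp add: field_simps)
  qed
  then have "u = 0" "v = 0"
    using powr_combination_not_constant[OF pq_pos(1) q_less_p _ pq_pos(2), of u v] by auto
  then show False using uv by simp
qed

lemma tilt_moments:
  "integrable tilt_measure (\<lambda>y. (\<bar>y\<bar> powr q) ^ i * (\<bar>y\<bar> powr p) ^ j)"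
  "(\<integral>y. (\<bar>y\<bar> powr q) ^ i * (\<bar>y\<bar> powr p) ^ j \<partial>tilt_measure) = mom i j s t"
  using has_bochner_integral_tilt[of i j] by (simp_all add: has_bochner_integral_iff)

lemma tilt_moments_simps [simp]:
  "integrable tilt_measure (\<lambda>y. \<bar>y\<bar> powr q)" "(\<integral>y. \<bar>y\<bar> powr q \<partial>tilt_measure) = w"
  "integrable tilt_measure (\<lambda>y. \<bar>y\<bar> powr p)" "(\<integral>y. \<bar>y\<bar> powr p \<partial>tilt_measure) = 1"
  "integrable tilt_measure (\<lambda>y. (\<bar>y\<bar> powr q)\<^sup>2)" "(\<integral>y. (\<bar>y\<bar> powr q)\<^sup>2 \<partial>tilt_measure) = mom 2 0 s t"
  "integrable tilt_measure (\<lambda>y. (\<bar>y\<bar> powr p)\<^sup>2)" "(\<integral>y. (\<bar>y\<bar> powr p)\<^sup>2 \<partial>tilt_measure) = mom 0 2 s t"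
  "integrable tilt_measure (\<lambda>y. \<bar>y\<bar> powr q * \<bar>y\<bar> powr p)"
  "(\<integral>y. \<bar>y\<bar> powr q * \<bar>y\<bar> powr p \<partial>tilt_measure) = mom 1 1 s t"
  "integrable tilt_measure (\<lambda>y. (\<bar>y\<bar> powr q) ^ 3)" "integrable tilt_measure (\<lambda>y. (\<bar>y\<bar> powr p) ^ 3)"
  using tilt_moments[of 1 0] tilt_moments[of 0 1] tilt_moments[of 2 0] tilt_moments[of 0 2] tilt_moments[of 1 1]
    tilt_moments[of 3 0] tilt_moments[of 0 3] by (simp_all add: moms)

lemma planar_variable_tilt: "planar_variable tilt_measure (\<lambda>y. \<bar>y\<bar> powr q - w) (\<lambda>y. 1 - \<bar>y\<bar> powr p)"
proof -
  interpret T: prob_space tilt_measure by (rule prob_space_tilt)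
  have le: "\<bar>a - b\<bar> ^ 3 \<le> a ^ 3 + b ^ 3" if "0 \<le> a" "0 \<le> b" for a b :: real
  proof (cases "a \<le> b")
    case True
    then have "\<bar>a - b\<bar> ^ 3 \<le> b ^ 3" using that by (intro power_mono) auto
    then show ?thesis using zero_le_power[OF that(1), of 3] by linarith
  next
    case False
    then have "\<bar>a - b\<bar> ^ 3 \<le> a ^ 3" using that by (intro power_mono) auto
    then show ?thesis using zero_le_power[OF that(2), of 3] by linarith
  qed
  have int: "integrable tilt_measure (\<lambda>y. \<bar>f y - g y\<bar> ^ 3)"
    if f: "integrable tilt_measure (\<lambda>y. f y ^ 3)" "integrable tilt_measure (\<lambda>y. g y ^ 3)"
      and m: "f \<in> borel_measurable borel" "g \<in> borel_measurable borel"
      and nn: "\<And>y. 0 \<le> f y" "\<And>y. 0 \<le> g y" for f g :: "real \<Rightarrow> real"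
  proof (rule Bochner_Integration.integrable_bound[OF Bochner_Integration.integrable_add[OF f]])
    show "(\<lambda>y. \<bar>f y - g y\<bar> ^ 3) \<in> borel_measurable tilt_measure" using m by measurable
    show "AE y in tilt_measure. norm (\<bar>f y - g y\<bar> ^ 3) \<le> norm (f y ^ 3 + g y ^ 3)"
      using le nn by (intro AE_I2) (simp add: )
  qed
  show ?thesis
  proof unfold_locales
    show "integrable tilt_measure (\<lambda>y. \<bar>\<bar>y\<bar> powr q - w\<bar> ^ 3)"
      by (rule int) auto
    show "integrable tilt_measure (\<lambda>y. \<bar>1 - \<bar>y\<bar> powr p\<bar> ^ 3)"
      by (rule int[of "\<lambda>_. 1"]) auto
    show "T.expectation (\<lambda>y. \<bar>y\<bar> powr q - w) = 0" "T.expectation (\<lambda>y. 1 - \<bar>y\<bar> powr p) = 0"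
      by (simp_all add: T.prob_space)
    show "cmod (\<integral>y. iexp (u * (\<bar>y\<bar> powr q - w) + v * (1 - \<bar>y\<bar> powr p)) \<partial>tilt_measure) < 1" if "(u, v) \<noteq> (0, 0)" for u v
      by (rule tilt_nonlattice[OF that])
  qed measurable
qed

sublocale walk: planar_variable tilt_measure "\<lambda>y. \<bar>y\<bar> powr q - w" "\<lambda>y. 1 - \<bar>y\<bar> powr p"
  by (rule planar_variable_tilt)

lemma walk_disc: "walk.disc = h11 * h22 - h12\<^sup>2"
proof -
  have 1: "(\<lambda>y::real. (\<bar>y\<bar> powr q - w)\<^sup>2) = (\<lambda>y. (\<bar>y\<bar> powr q)\<^sup>2 - 2 * w * (\<bar>y\<bar> powr q) + w\<^sup>2)"
    by (auto simp: power2_eq_square algebra_simps)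
  have 2: "(\<lambda>y::real. (1 - \<bar>y\<bar> powr p)\<^sup>2) = (\<lambda>y. (\<bar>y\<bar> powr p)\<^sup>2 - 2 * (\<bar>y\<bar> powr p) + 1)"
    by (auto simp: power2_eq_square algebra_simps)
  have 3: "(\<lambda>y::real. (\<bar>y\<bar> powr q - w) * (1 - \<bar>y\<bar> powr p)) =
      (\<lambda>y. \<bar>y\<bar> powr q - \<bar>y\<bar> powr q * \<bar>y\<bar> powr p + w * (\<bar>y\<bar> powr p) - w)"
    by (auto simp: algebra_simps)
  have "walk.vX = h11" unfolding walk.vX_def 1 by (simp add: walk.prob_space) (simp add: power2_eq_square)
  moreover have "walk.vW = h22" unfolding walk.vW_def 2 by (simp add: walk.prob_space)
  \<comment> \<open>The reversed sign of the second variable flips the covariance, but only its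
    square enters the determinant.\<close>
  moreover have "walk.cov = - h12" unfolding walk.cov_def 3 by (simp add: walk.prob_space)
  ultimately show ?thesis by (simp only: walk.disc_def power2_minus)
qed

lemma walk_P: "walk.P n = density (lebn n) (\<lambda>x. ennreal (\<Prod>i<n. tilt (x i)))"
  unfolding walk.P_def using prob_space_tilt tilt_pos
  by (subst tilt_measure_def, intro PiM_density_lborel) (auto simp: tilt_measure_def less_imp_le)

lemma space_walk_P: "space (walk.P n) = space (lebn n)"
  by (simp add: walk_P)

lemma walk_SX: "walk.SX n x = psum n q x - real n * w"
  and walk_SW: "walk.SW n x = real n - psum n p x"
  by (simp_all add: walk.SX_def walk.SW_def psum_def sum_subtractf)

text \<open>One inequality is weak and the other strict, so in terms of the sums this is neither the
  open nor the closed quadrant; hence the freedom left to \<open>A n\<close> in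
  \<open>exp_tail_asymptotics\<close>.\<close>

definition rare :: "nat \<Rightarrow> (nat \<Rightarrow> real) set" where
  "rare n = {x \<in> space (lebn n). psum n p x \<le> real n \<and> real n * w < psum n q x}"

lemma rare_sets: "rare n \<in> sets (lebn n)"
  unfolding rare_def by measurable

definition walk_exp :: "nat \<Rightarrow> real" where
  "walk_exp n = (\<integral>x. exp (- s * walk.SX n x - b * walk.SW n x) * indicator (rare n) x \<partial>walk.P n)"

lemma walk_exp_tendsto:
  "(\<lambda>n. real n * walk_exp n) \<longlonglongrightarrow> 1 / (2 * pi * sqrt (h11 * h22 - h12\<^sup>2) * s * b)"
  unfolding walk_exp_def walk_disc[symmetric]
proof (rule walk.exp_tail_asymptotics[OF s_pos b_pos])
  show "rare n \<in> sets (walk.P n)" for n using rare_sets by (simp add: walk_P)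
qed (auto simp: rare_def walk_SX walk_SW space_walk_P)

abbreviation "Z \<equiv> J 0 0 s t"

lemma Z_pos: "0 < Z" by (rule J_00_pos[OF t_less])

lemma prod_tilt: "(\<Prod>i<n. tilt (x i)) = exp (s * psum n q x - b * psum n p x) / (norm_const p * Z) ^ n"
proof -
  have "tilt y = exp (s * \<bar>y\<bar> powr q - b * \<bar>y\<bar> powr p) / (norm_const p * Z)" for y
    by (simp add: tilt_def G_def f_p_eq b_def exp_add[symmetric] left_diff_distrib algebra_simps)
  then show ?thesis
    by (simp add: prod_dividef exp_sum[symmetric] sum_subtractf sum_distrib_left psum_def)
qed

text \<open>The exponential weight undoes the tilting up to the constant exponent n * (s * w - b),
  so the expectation becomes this constant factor times a plain volume.\<close>

lemma walk_exp_eq: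
  "walk_exp n = exp (real n * (s * w - b)) / (norm_const p * Z) ^ n * measure (lebn n) (rare n)"
proof -
  let ?K = "exp (real n * (s * w - b)) / (norm_const p * Z) ^ n"
  have N: "0 < norm_const p * Z" using norm_const_pos[OF pq_pos(2)] Z_pos by simp
  have m: "(\<lambda>x. \<Prod>i<n. tilt (x i)) \<in> borel_measurable (lebn n)" unfolding lebn_def by measurable
  note [measurable] = rare_sets[of n]
  have nn: "0 \<le> (\<Prod>i<n. tilt (x i))" for x
    by (intro prod_nonneg) (auto intro: less_imp_le[OF tilt_pos])
  have "walk_exp n = (\<integral>x. (\<Prod>i<n. tilt (x i)) *\<^sub>R (exp (- s * walk.SX n x - b * walk.SW n x) * indicator (rare n) x) \<partial>lebn n)"
    unfolding walk_exp_def walk_P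
    by (rule integral_density) (use m nn in \<open>auto simp: walk_SX walk_SW\<close>)
  also have "\<dots> = (\<integral>x. ?K * indicator (rare n) x \<partial>lebn n)"
  proof (rule Bochner_Integration.integral_cong[OF refl])
    fix x
    have "exp (s * psum n q x - b * psum n p x) * exp (- s * walk.SX n x - b * walk.SW n x) = exp (real n * (s * w - b))"
      unfolding exp_add[symmetric] by (intro arg_cong[where f=exp]) (simp add: walk_SX walk_SW algebra_simps)
    then show "(\<Prod>i<n. tilt (x i)) *\<^sub>R (exp (- s * walk.SX n x - b * walk.SW n x) * indicator (rare n) x) = ?K * indicator (rare n) x"
      by (simp add: prod_tilt)
  qed
  also have "\<dots> = ?K * measure (lebn n) (rare n \<inter> space (lebn n))"
    by (simp only: integral_mult_right_zero Bochner_Integration.integral_indicator)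
  also have "rare n \<inter> space (lebn n) = rare n" by (auto simp: rare_def)
  finally show ?thesis .
qed

definition stirling_ratio :: "nat \<Rightarrow> real" where
  "stirling_ratio n = Gamma (real n / p + 1) * exp (real n / p) /
    ((real n / p) powr (real n / p) * sqrt (2 * pi * (real n / p)))"

lemma stirling_ratio_tendsto: "stirling_ratio \<longlonglongrightarrow> 1"
proof -
  have "filterlim (\<lambda>n. real n / p) at_top sequentially"
    using pq_pos(2) by real_asymp
  from filterlim_compose[OF Gamma_stirling this] show ?thesis
    by (simp add: stirling_ratio_def[abs_def])
qed

text \<open>An identity for every n > 0; all asymptotics are confined to \<open>walk_exp\<close> and
  \<open>stirling_ratio\<close>.\<close>

lemma U_np_exact:
  assumes n: "0 < n"
  shows "U_np n p {x \<in> Ball_p n p. real n powr (1 / p - 1 / q) * lnorm n q x > z} =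
    exp (- real n * Lambda_star p q (zstar q z)) * walk_exp n * (stirling_ratio n * sqrt (2 * pi * (real n / p)))"
  (is "U_np n p ?A = ?E * _ * ?S")
proof -
  let ?N = "norm_const p" and ?X = "(real n / p) powr (real n / p)" and ?\<Gamma> = "Gamma (real n / p + 1)"
  have N: "0 < ?N" using norm_const_pos[OF pq_pos(2)] .
  have X: "0 < ?X" using n pq_pos by simp
  have Gam: "0 < ?\<Gamma>" using pq_pos by (intro Gamma_real_pos add_nonneg_pos) auto
  have "measure (lebn n) {x \<in> space (lebn n). psum n p x \<le> real n} = ?N ^ n * ?X / ?\<Gamma>"
    using emeasure_psum_le_eq[OF pq_pos(2), of "real n" n] n N X Gam by (simp add: measure_def)
  moreover have "measure (lebn n) (rare n) = walk_exp n * ((?N * Z) ^ n / exp (real n * (s * w - b)))"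
    unfolding walk_exp_eq using N Z_pos by simp
  ultimately have "U_np n p ?A =
      walk_exp n * ((?N * Z) ^ n / exp (real n * (s * w - b))) / (?N ^ n * ?X / ?\<Gamma>)"
    using U_np_eq[OF pq_pos(2,1) z_pos n] by (simp only: rare_def)
  also have "\<dots> = (Z ^ n / exp (real n * (s * w - b))) * walk_exp n * (?\<Gamma> / ?X)"
    using N by (simp add: power_mult_distrib)
  \<comment> \<open>The surplus exp (n / p) comes from b = 1 / p - t and is exactly the exponential
    in \<open>stirling_ratio\<close>.\<close>
  also have "Z ^ n / exp (real n * (s * w - b)) = ?E * exp (real n / p)"
  proof -
    have "Z ^ n = exp (real n * ln Z)" using Z_pos by (simp add: exp_of_nat_mult)
    then have "Z ^ n / exp (real n * (s * w - b)) = exp (real n * ln Z - real n * (s * w - b))"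
      by (simp only: exp_diff)
    also have "\<dots> = exp (- real n * Lambda_star p q (zstar q z) + real n / p)"
      unfolding Lambda_star_eq Lambda_p_eq b_def by (intro arg_cong[where f=exp]) (simp add: algebra_simps)
    finally show ?thesis by (simp only: exp_add)
  qed
  also have "?E * exp (real n / p) * walk_exp n * (?\<Gamma> / ?X) =
      ?E * walk_exp n * ?S"
  proof -
    have "0 < sqrt (2 * pi * (real n / p))" using n pq_pos by simp
    then have "stirling_ratio n * sqrt (2 * pi * (real n / p)) = exp (real n / p) * (?\<Gamma> / ?X)"
      unfolding stirling_ratio_def by simp
    then show ?thesis by (simp only: mult_ac)
  qed
  finally show ?thesis .
qed

lemma sharp_large_deviation:
  "\<exists>e :: nat \<Rightarrow> real. e \<longlonglongrightarrow> 0 \<and>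
    (\<forall>\<^sub>F n in sequentially.
       U_np n p {x \<in> Ball_p n p. real n powr (1 / p - 1 / q) * lnorm n q x > z}
       = 1 / (sqrt (2 * pi * real n) * gamma_z p q z) * exp (- real n * Lambda_star p q (zstar q z))
         * (1 + e n))"
proof -
  let ?d = "h11 * h22 - h12\<^sup>2"
  have d: "0 < ?d" using walk.disc_pos by (simp only: walk_disc)
  let ?\<gamma> = "sqrt ?d * s * b * sqrt p"
  have \<gamma>: "0 < ?\<gamma>" using d s_pos b_pos pq_pos by simp
  \<comment> \<open>Obtained by solving the claimed formula for the error after inserting the exact
    value of the probability.\<close>
  define e where "e n = real n * walk_exp n * stirling_ratio n * (2 * pi * ?\<gamma> / sqrt p) - 1" for n
  have "(\<lambda>n. real n * walk_exp n * stirling_ratio n * (2 * pi * ?\<gamma> / sqrt p)) \<longlonglongrightarrow>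
      1 / (2 * pi * sqrt ?d * s * b) * 1 * (2 * pi * ?\<gamma> / sqrt p)"
    by (intro tendsto_mult walk_exp_tendsto stirling_ratio_tendsto tendsto_const)
  also have "1 / (2 * pi * sqrt ?d * s * b) * 1 * (2 * pi * ?\<gamma> / sqrt p) = 1"
    using d s_pos b_pos pq_pos by simp
  finally have "(\<lambda>n. real n * walk_exp n * stirling_ratio n * (2 * pi * ?\<gamma> / sqrt p)) \<longlonglongrightarrow> 1" .
  from tendsto_diff[OF this tendsto_const[of 1]] have "e \<longlonglongrightarrow> 0"
    by (simp add: e_def[abs_def])
  moreover have "U_np n p {x \<in> Ball_p n p. real n powr (1 / p - 1 / q) * lnorm n q x > z}
       = 1 / (sqrt (2 * pi * real n) * gamma_z p q z) * exp (- real n * Lambda_star p q (zstar q z)) * (1 + e n)"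
    if n: "0 < n" for n
  proof -
    let ?r = "sqrt (2 * pi * real n)"
    have r: "0 < ?r" "?r * ?r = 2 * pi * real n" using n by auto
    \<comment> \<open>The factor sqrt (2 pi n / p) from Stirling against the 1 / n of the local
      limit theorem leaves the order n^(-1/2); the remaining sqrt p belongs to gamma(z).\<close>
    have c: "1 / (?r * g) * E * (real n * I * S * (2 * pi * g / sqrt p)) = E * I * (S * sqrt (2 * pi * (real n / p)))"
      if "0 < g" for g E I S :: real
    proof -
      have "1 / (?r * g) * E * (real n * I * S * (2 * pi * g / sqrt p)) = E * I * S * ((2 * pi * real n) / (?r * sqrt p))"
        using that by simp
      also have "(2 * pi * real n) / (?r * sqrt p) = ?r / sqrt p"
      proof -
        have "R / (r * k) = r / k" if "0 < r" "r * r = R" for r R k :: real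
          using that by auto
        from this[OF r] show ?thesis .
      qed
      also have "?r / sqrt p = sqrt (2 * pi * (real n / p))"
        by (simp add: real_sqrt_divide[symmetric])
      finally show ?thesis by (simp only: mult.assoc)
    qed
    have e1: "1 + e n = real n * walk_exp n * stirling_ratio n * (2 * pi * ?\<gamma> / sqrt p)"
      by (simp add: e_def)
    show ?thesis
      unfolding U_np_exact[OF n] gamma_z_eq[OF d] e1 by (rule c[OF \<gamma>, symmetric])
  qed
  ultimately show ?thesis
    by (intro exI[of _ e] conjI eventually_mono[OF eventually_gt_at_top[of 0]]) auto
qed

end

theorem theorem3p2:
  fixes p q z :: real
  assumes "1 \<le> q" "q < p"
    and "z > m_pq p q"
    and "zstar q z \<in> J_p p q"
  shows "\<exists>e :: nat \<Rightarrow> real. e \<longlonglongrightarrow> 0 \<and>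
    (\<forall>\<^sub>F n in sequentially.
       U_np n p {x \<in> Ball_p n p. real n powr (1 / p - 1 / q) * lnorm n q x > z}
       = 1 / (sqrt (2 * pi * real n) * gamma_z p q z) * exp (- real n * Lambda_star p q (zstar q z))
         * (1 + e n))"
proof -
  interpret exponents p q using assms by unfold_locales
  obtain s t where st: "(s, t) \<in> D_p p" "Lambda_p p q differentiable at (s, t)" "grad_Lambda p q (s, t) = zstar q z"
    using assms(4) by (auto simp: J_p_def)
  then have t: "t < 1 / p" by (simp add: D_p_def)
  interpret dual_point p q z s t
    using st t assms by unfold_locales (auto simp: grad_Lambda_def zstar_def d1_Lambda_p d2_Lambda_p)
  show ?thesis by (rule sharp_large_deviation)
qed

end
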